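(* Let $p$ be a prime number, let $H$ be a finite group, and let $V$ be a finite-dimensional $\mathbb F_pH$-module. Then $V$ has a divisible hull if and only if it has an integral cover.
   Context: Let $r:=\dim_{\mathbb F_p}V$. A divisible hull of $V$ is a divisible abelian $p$-group $A$ of rank $r$ (i.e. isomorphic to a direct sum of $r$ copies of the Prüfer $p$-group $C_{p^\infty}$) for which there is an embedding $H\leq\mathrm{Aut}\,A$ such that $A[p]:=\{x\in A\mid px=0\}\cong V$ as $\mathbb F_pH$-modules. An integral cover of $V$ is an $RH$-module $M$ that is free of rank $r$ as an $R$-module and such that $M/pM\cong V$ as $H$-modules, where $R$ is some integral domain of characteristic $0$ such that $R/pR\cong\mathbb F_p$. The ring $R$ is not specified in advance: $V$ "has an integral cover" if one exists for some such $R$.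
   Formalization: The embedding of H in Aut A is required only when H acts faithfully on V; for general V it is replaced by a homomorphism from H to Aut A, since otherwise the claim fails (V = 0 with H nontrivial, or C_3 acting trivially on F_2). *)

theory Defs
  imports
    "HOL-Library.Equipollence"
    "HOL-Number_Theory.Residues"
    "HOL-Algebra.Bij"
    "HOL-Algebra.Group_Action"
    "HOL-Algebra.Product_Groups"
    "HOL-Algebra.QuotRing"
    "Jordan_Normal_Form.Missing_VectorSpace"
begin

abbreviation prime_field :: "nat \<Rightarrow> int ring" where
  "prime_field p \<equiv> residue_ring (int p)"

text \<open>
  A module over the group ring of \<open>H\<close> with coefficients in \<open>R\<close> is an \<open>R\<close>-module together with
  an action of \<open>H\<close> by \<open>R\<close>-linear maps.
\<close>

locale group_module =
  module R M + group_action H "carrier M" \<rho>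
  for R :: "('r, 'k) ring_scheme" and H :: "('h, 'l) monoid_scheme"
    and M :: "('r, 'm, 'n) module_scheme" and \<rho> :: "'h \<Rightarrow> 'm \<Rightarrow> 'm" +
  assumes linear: "h \<in> carrier H \<Longrightarrow> \<rho> h \<in> module_hom R M M"

text \<open>Two modules with a family of operators indexed by \<open>H\<close> are isomorphic over \<open>R\<close> and \<open>H\<close>.\<close>

definition group_module_isomorphic ::
  "('r, 'k) ring_scheme \<Rightarrow> ('h, 'l) monoid_scheme \<Rightarrow>
   ('r, 'm, 'i) module_scheme \<Rightarrow> ('h \<Rightarrow> 'm \<Rightarrow> 'm) \<Rightarrow>
   ('r, 'n, 'j) module_scheme \<Rightarrow> ('h \<Rightarrow> 'n \<Rightarrow> 'n) \<Rightarrow> bool" where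
  "group_module_isomorphic R H M \<rho> N \<sigma> \<longleftrightarrow>
     (\<exists>f \<in> module_hom R M N. bij_betw f (carrier M) (carrier N) \<and>
        (\<forall>h \<in> carrier H. \<forall>x \<in> carrier M. f (\<rho> h x) = \<sigma> h (f x)))"

definition prufer_group :: "nat \<Rightarrow> complex monoid" where
  "prufer_group p = \<lparr>carrier = {z. \<exists>n. z ^ (p ^ n) = 1}, monoid.mult = (*), one = 1\<rparr>"

definition divisible_p_group_of_rank :: "nat \<Rightarrow> nat \<Rightarrow> 'a monoid \<Rightarrow> bool" where
  "divisible_p_group_of_rank p r A \<longleftrightarrow>
     comm_group A \<and> A \<cong> sum_group {..<r} (\<lambda>_. prufer_group p)"

text \<open>
  \<open>A[p]\<close> as a vector space over the field of order \<open>p\<close>. The group \<open>A\<close> is written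
  multiplicatively. The multiplicative part of the record is not used.
\<close>

definition p_torsion :: "nat \<Rightarrow> 'a monoid \<Rightarrow> (int, 'a) module" where
  "p_torsion p A =
     \<lparr>carrier = {x \<in> carrier A. x [^]\<^bsub>A\<^esub> p = \<one>\<^bsub>A\<^esub>},
      monoid.mult = (\<otimes>\<^bsub>A\<^esub>), one = \<one>\<^bsub>A\<^esub>,
      ring.zero = \<one>\<^bsub>A\<^esub>, ring.add = (\<otimes>\<^bsub>A\<^esub>),
      smult = (\<lambda>k x. x [^]\<^bsub>A\<^esub> k)\<rparr>"

definition divisible_hull_via ::
  "nat \<Rightarrow> 'h monoid \<Rightarrow> (int, 'v) module \<Rightarrow> ('h \<Rightarrow> 'v \<Rightarrow> 'v) \<Rightarrow>
   'a monoid \<Rightarrow> ('h \<Rightarrow> 'a \<Rightarrow> 'a) \<Rightarrow> bool" where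
  "divisible_hull_via p H V \<sigma> A \<phi> \<longleftrightarrow>
     divisible_p_group_of_rank p (vectorspace.dim (prime_field p) V) A \<and>
     \<phi> \<in> hom H (AutoGroup A) \<and>
     group_module_isomorphic (prime_field p) H (p_torsion p A) \<phi> V \<sigma>"

text \<open>
  Existence of a divisible hull. The type argument names the type from which the elements of \<open>A\<close>
  are taken. In the first version \<open>H\<close> is embedded in \<open>Aut A\<close>. In the second version \<open>H\<close> only
  acts on \<open>A\<close>, that is, the homomorphism to \<open>Aut A\<close> need not be injective. If \<open>H\<close> acts
  faithfully on \<open>V\<close>, the two coincide. If it does not, an embedding may fail to exist for trivial
  reasons: for \<open>V = 0\<close> the group \<open>Aut A\<close> is trivial, although \<open>V\<close> has the integral cover 0.
\<close>

definition has_divisible_hull ::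
  "'a itself \<Rightarrow> nat \<Rightarrow> 'h monoid \<Rightarrow> (int, 'v) module \<Rightarrow> ('h \<Rightarrow> 'v \<Rightarrow> 'v) \<Rightarrow> bool" where
  "has_divisible_hull TYPE('a) p H V \<sigma> \<longleftrightarrow>
     (\<exists>(A :: 'a monoid) \<phi>. divisible_hull_via p H V \<sigma> A \<phi> \<and> inj_on \<phi> (carrier H))"

definition has_divisible_hull_action ::
  "'a itself \<Rightarrow> nat \<Rightarrow> 'h monoid \<Rightarrow> (int, 'v) module \<Rightarrow> ('h \<Rightarrow> 'v \<Rightarrow> 'v) \<Rightarrow> bool" where
  "has_divisible_hull_action TYPE('a) p H V \<sigma> \<longleftrightarrow>
     (\<exists>(A :: 'a monoid) \<phi>. divisible_hull_via p H V \<sigma> A \<phi>)"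

definition free_module_of_rank ::
  "('r, 'k) ring_scheme \<Rightarrow> ('r, 'm, 'n) module_scheme \<Rightarrow> nat \<Rightarrow> bool" where
  "free_module_of_rank R M r \<longleftrightarrow>
     (\<exists>B \<subseteq> carrier M. finite B \<and> card B = r \<and>
        \<not> module.lin_dep R M B \<and> module.span R M B = carrier M)"

definition cover_coefficient_ring :: "nat \<Rightarrow> 'r ring \<Rightarrow> bool" where
  "cover_coefficient_ring p R \<longleftrightarrow>
     domain R \<and>
     (\<forall>n::nat. 0 < n \<longrightarrow> [n] \<cdot>\<^bsub>R\<^esub> \<one>\<^bsub>R\<^esub> \<noteq> \<zero>\<^bsub>R\<^esub>) \<and>
     R Quot (PIdl\<^bsub>R\<^esub> ([p] \<cdot>\<^bsub>R\<^esub> \<one>\<^bsub>R\<^esub>)) \<simeq> prime_field p"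

definition multiples :: "nat \<Rightarrow> ('r, 'm) module \<Rightarrow> 'm set" where
  "multiples p M = {[p] \<cdot>\<^bsub>M\<^esub> x | x. x \<in> carrier M}"

text \<open>The action of \<open>H\<close> on \<open>M/pM\<close> sends a coset \<open>C\<close> to its image \<open>\<rho> h ` C\<close>.\<close>

definition integral_cover ::
  "nat \<Rightarrow> 'h monoid \<Rightarrow> (int, 'v) module \<Rightarrow> ('h \<Rightarrow> 'v \<Rightarrow> 'v) \<Rightarrow>
   'r ring \<Rightarrow> ('r, 'm) module \<Rightarrow> ('h \<Rightarrow> 'm \<Rightarrow> 'm) \<Rightarrow> bool" where
  "integral_cover p H V \<sigma> R M \<rho> \<longleftrightarrow>
     cover_coefficient_ring p R \<and>
     group_module R H M \<rho> \<and>
     free_module_of_rank R M (vectorspace.dim (prime_field p) V) \<and>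
     (\<exists>f \<in> iso (M A_Mod multiples p M) (add_monoid V).
        \<forall>h \<in> carrier H. \<forall>C \<in> carrier (M A_Mod multiples p M). f (\<rho> h ` C) = \<sigma> h (f C))"

text \<open>
  The elements of \<open>R\<close> and \<open>M\<close> are taken from the types \<open>'r\<close> and \<open>'m\<close>, on which no algebraic
  structure is assumed. As with the type argument of \<open>has_divisible_hull\<close>, these types only have to
  be large enough to contain isomorphic copies of all relevant objects.
\<close>

definition has_integral_cover ::
  "'r itself \<Rightarrow> 'm itself \<Rightarrow> nat \<Rightarrow> 'h monoid \<Rightarrow> (int, 'v) module \<Rightarrow>
   ('h \<Rightarrow> 'v \<Rightarrow> 'v) \<Rightarrow> bool" where
  "has_integral_cover TYPE('r) TYPE('m) p H V \<sigma> \<longleftrightarrow>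
     (\<exists>(R :: 'r ring) (M :: ('r, 'm) module) \<rho>. integral_cover p H V \<sigma> R M \<rho>)"

end

theory Submission
  imports Defs "HOL-Algebra.Weak_Morphisms" "HOL-Analysis.Abstract_Topology_2"
begin

text \<open>
  Let \<open>C\<close> be the Pruefer \<open>p\<close>-group, let \<open>\<zeta>\<^sub>n \<in> C\<close> be the standard root of unity of order \<open>p^n\<close>, and let
  \<open>r = dim V\<close>.

  From a cover \<open>M\<close> over \<open>R\<close> to a hull: since \<open>R\<close> is a domain of characteristic 0 with \<open>R/pR\<close> of order
  \<open>p\<close>, every \<open>x \<in> R\<close> is congruent modulo \<open>p^n R\<close> to an integer \<open>k\<close>, unique modulo \<open>p^n\<close>, and
  \<open>x \<mapsto> \<zeta>\<^sub>n^k\<close> has kernel \<open>p^n R\<close>. Applied to coordinates this gives maps \<open>\<Phi> n : M \<rightarrow> C^r\<close> with kernel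
  \<open>p^n M\<close>, with \<open>\<Phi> (n + 1) (p m) = \<Phi> n m\<close>, and with images exhausting \<open>C^r\<close>. So \<open>C^r\<close> is \<open>M[1/p]/M\<close>:
  endomorphisms of \<open>M\<close> extend functorially to it, and its \<open>p\<close>-torsion is the image of \<open>\<Phi> 1\<close>, that is, \<open>M/pM\<close>.

  From a hull \<open>A\<close> to a cover: take \<open>R = End C\<close> (the \<open>p\<close>-adic integers) and \<open>M = Hom(C, A)\<close>, on which \<open>R\<close>
  acts by precomposition and \<open>H\<close> by postcomposition. As \<open>A\<close> is isomorphic to \<open>C^r\<close>, the module \<open>M\<close> is free of
  rank \<open>r\<close>. Evaluation at \<open>\<zeta>\<^sub>1\<close> maps \<open>M\<close> onto the \<open>p\<close>-torsion of \<open>A\<close> with kernel \<open>pM\<close>, because a homomorphism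
  that kills the \<open>p\<close>-torsion of the divisible group \<open>C\<close> factors through multiplication by \<open>p\<close>.
\<close>

section \<open>Coefficient rings and quotients modulo p\<close>

text \<open>The coefficient ring of a given cover may be far from the \<open>p\<close>-adic
  integers: in Z_(p) + x Q[x], for instance, the element x is divisible by every power of
  \<open>p\<close>, so this ring does not embed in them. Hence there is no completion, and only
  residues modulo each \<open>p ^ n\<close> are used; they exist for every admissible ring. Nor is
  M[1/p]/M formed: any copy of C^r serves as A, which gives the rank condition at once, and the
  action is carried over through the maps from M. In the other direction End C is admissible because
  an endomorphism of C is a power map on each finite level (so End C is commutative) and a nonzero
  one is surjective (so End C is a domain). All carriers must lie in prescribed types. C^r is
  countable, so it fits into any infinite type. End C and Hom(C, A) consist of functions between
  countable sets, so they are moved by injections into any type that contains a copy of the reals.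
  The version for faithful \<open>\<sigma>\<close> follows because a hull action restricted to the
  \<open>p\<close>-torsion is \<open>\<sigma>\<close> up to isomorphism.\<close>

lemma residues_prime_field: "prime p \<Longrightarrow> residues (int p)"
  by (simp add: residues_def prime_gt_Suc_0_nat)

lemma prime_field_simps:
  "carrier (prime_field p) = {0..int p - 1}"
  "add (prime_field p) x y = (x + y) mod int p"
  "monoid.mult (prime_field p) x y = (x * y) mod int p"
  "zero (prime_field p) = 0" "one (prime_field p) = 1"
  by (simp_all add: residue_ring_def)

lemma (in cring) PIdl_nat:
  fixes n :: nat
  shows "PIdl ([n] \<cdot> \<one>) = {[n] \<cdot> x | x. x \<in> carrier R}"
proof -
  have "PIdl ([n] \<cdot> \<one>) = (\<lambda>x. x \<otimes> [n] \<cdot> \<one>) ` carrier R"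
    by (auto simp: cgenideal_def)
  also have "\<dots> = (\<lambda>x. [n] \<cdot> x) ` carrier R"
    by (rule image_cong) (simp_all add: add_pow_rdistr)
  finally show ?thesis by auto
qed

text \<open>First isomorphism theorem: a surjection onto the prime field with kernel pR replaces the
  isomorphism from the quotient ring. This lemma and its converse below are the only places that
  handle cosets of the ideal.\<close>

lemma cover_coefficient_ringI:
  fixes R :: "'r ring"
  assumes "prime p" "domain R"
    and char0: "\<And>n::nat. 0 < n \<Longrightarrow> [n] \<cdot>\<^bsub>R\<^esub> \<one>\<^bsub>R\<^esub> \<noteq> \<zero>\<^bsub>R\<^esub>"
    and hom: "h \<in> ring_hom R (prime_field p)"
    and surj: "h ` carrier R = carrier (prime_field p)"
    and ker: "\<And>x. x \<in> carrier R \<Longrightarrow> h x = 0 \<longleftrightarrow> (\<exists>y\<in>carrier R. x = [p] \<cdot>\<^bsub>R\<^esub> y)"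
  shows "cover_coefficient_ring p R"
proof -
  interpret R: domain R by fact
  interpret P: residues "int p" "prime_field p"
    using \<open>prime p\<close> by (rule residues_prime_field)
  interpret h: ring_hom_ring R "prime_field p" h
    by (rule ring_hom_ringI2[OF R.ring_axioms P.ring_axioms hom])
  have "a_kernel R (prime_field p) h = PIdl\<^bsub>R\<^esub> ([p] \<cdot>\<^bsub>R\<^esub> \<one>\<^bsub>R\<^esub>)"
  proof -
    have "a_kernel R (prime_field p) h = {x \<in> carrier R. h x = 0}"
      unfolding a_kernel_def' prime_field_simps ..
    also have "\<dots> = {[p] \<cdot>\<^bsub>R\<^esub> x | x. x \<in> carrier R}"
      using ker R.add.nat_pow_closed by blast
    finally show ?thesis by (simp only: R.PIdl_nat)
  qed
  then show ?thesis
    using h.FactRing_iso[OF surj] char0 R.domain_axioms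
    by (simp add: cover_coefficient_ring_def)
qed

lemma cover_coefficient_ringE:
  assumes "prime p" "cover_coefficient_ring p R"
  obtains h where "h \<in> ring_hom R (prime_field p)"
    and "h ` carrier R = carrier (prime_field p)"
    and "\<And>x. x \<in> carrier R \<Longrightarrow> h x = 0 \<longleftrightarrow> (\<exists>y\<in>carrier R. x = [p] \<cdot>\<^bsub>R\<^esub> y)"
proof -
  interpret R: domain R using assms(2) by (simp add: cover_coefficient_ring_def)
  interpret P: residues "int p" "prime_field p"
    using \<open>prime p\<close> by (rule residues_prime_field)
  let ?I = "PIdl\<^bsub>R\<^esub> ([p] \<cdot>\<^bsub>R\<^esub> \<one>\<^bsub>R\<^esub>)"
  interpret I: ideal ?I R by (simp add: R.cgenideal_ideal)
  interpret Q: ring "R Quot ?I" by (rule I.quotient_is_ring)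
  obtain g where g: "g \<in> ring_iso (R Quot ?I) (prime_field p)"
    using assms(2) by (auto simp: cover_coefficient_ring_def is_ring_iso_def)
  then have gh: "g \<in> ring_hom (R Quot ?I) (prime_field p)"
    and gb: "bij_betw g (carrier (R Quot ?I)) (carrier (prime_field p))"
    by (auto simp: ring_iso_def)
  interpret g: ring_hom_ring "R Quot ?I" "prime_field p" g
    by (rule ring_hom_ringI2[OF Q.ring_axioms P.ring_axioms gh])
  let ?h = "g \<circ> (+>\<^bsub>R\<^esub>) ?I"
  have carr: "carrier (R Quot ?I) = (+>\<^bsub>R\<^esub>) ?I ` carrier R"
    by (auto simp: FactRing_def A_RCOSETS_def')
  have "?h \<in> ring_hom R (prime_field p)"
    using ring_hom_trans[OF I.rcos_ring_hom gh] .
  moreover have "?h ` carrier R = carrier (prime_field p)"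
    using gb by (simp add: carr bij_betw_def image_comp)
  moreover have "?h x = 0 \<longleftrightarrow> (\<exists>y\<in>carrier R. x = [p] \<cdot>\<^bsub>R\<^esub> y)" if x: "x \<in> carrier R" for x
  proof -
    have "?h x = 0 \<longleftrightarrow> ?I +>\<^bsub>R\<^esub> x = \<zero>\<^bsub>R Quot ?I\<^esub>"
      using inj_on_eq_iff[OF bij_betw_imp_inj_on[OF gb], of "?I +>\<^bsub>R\<^esub> x" "\<zero>\<^bsub>R Quot ?I\<^esub>"]
        g.hom_zero x Q.zero_closed unfolding prime_field_simps carr comp_apply by simp
    also have "\<dots> \<longleftrightarrow> x \<in> ?I"
      using I.a_rcos_const[of x] I.a_rcos_self[OF x] unfolding FactRing_def by auto
    also have "\<dots> \<longleftrightarrow> (\<exists>y\<in>carrier R. x = [p] \<cdot>\<^bsub>R\<^esub> y)"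
      unfolding R.PIdl_nat by blast
    finally show ?thesis .
  qed
  ultimately show ?thesis by (rule that)
qed

section \<open>Group modules and the induced action on M/nM\<close>

context group_module begin

lemma act_closed: "h \<in> carrier H \<Longrightarrow> x \<in> carrier M \<Longrightarrow> \<rho> h x \<in> carrier M"
  using element_image by blast

lemma act_add: "h \<in> carrier H \<Longrightarrow> x \<in> carrier M \<Longrightarrow> y \<in> carrier M \<Longrightarrow>
  \<rho> h (x \<oplus>\<^bsub>M\<^esub> y) = \<rho> h x \<oplus>\<^bsub>M\<^esub> \<rho> h y"
  using linear by (simp add: module_hom_def)

lemma act_hom: "h \<in> carrier H \<Longrightarrow> \<rho> h \<in> hom (add_monoid M) (add_monoid M)"
  by (auto simp: hom_def act_closed act_add)

end

text \<open>\<open>multiples\<close> is defined for plain module records only, while the locale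
  \<open>group_module\<close> admits record extensions; hence the assumption is restated here for
  the plain type.\<close>

context
  fixes R :: "('r, 'k) ring_scheme" and H :: "('h, 'l) monoid_scheme"
    and M :: "('r, 'm) module" and \<rho> :: "'h \<Rightarrow> 'm \<Rightarrow> 'm"
  assumes group_module: "group_module R H M \<rho>"
begin

interpretation group_module R H M \<rho>
  by (rule group_module)

lemma subgroup_multiples: "subgroup (multiples n M) (add_monoid M)"
proof (rule M.add.subgroupI)
  show "multiples n M \<noteq> {}"
    using M.zero_closed by (auto simp: multiples_def)
  fix a assume "a \<in> multiples n M"
  then obtain x where x: "x \<in> carrier M" "a = [n] \<cdot>\<^bsub>M\<^esub> x" by (auto simp: multiples_def)
  have "\<ominus>\<^bsub>M\<^esub> a = [n] \<cdot>\<^bsub>M\<^esub> (\<ominus>\<^bsub>M\<^esub> x)"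
    using x by (simp add: M.add.nat_pow_inv a_inv_def[symmetric])
  then show "\<ominus>\<^bsub>M\<^esub> a \<in> multiples n M"
    using x by (auto simp: multiples_def a_inv_def[symmetric])
  fix b assume "b \<in> multiples n M"
  then obtain y where y: "y \<in> carrier M" "b = [n] \<cdot>\<^bsub>M\<^esub> y" by (auto simp: multiples_def)
  then show "a \<oplus>\<^bsub>M\<^esub> b \<in> multiples n M"
    using x M.add.nat_pow_distrib[of x y n] unfolding multiples_def
    by (metis (mono_tags, lifting) M.a_closed mem_Collect_eq)
qed (auto simp: multiples_def)

text \<open>Additivity alone maps nM into nM. Surjectivity of \<open>\<rho> h\<close> makes the
  image all of nM, so that the image of a coset is again a full coset; this is why taking images
  defines an action on M/pM.\<close>

lemma act_coset:
  assumes h: "h \<in> carrier H" and x: "x \<in> carrier M"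
  shows "\<rho> h ` (multiples n M #>\<^bsub>add_monoid M\<^esub> x) = multiples n M #>\<^bsub>add_monoid M\<^esub> \<rho> h x"
proof -
  interpret g: group_hom "add_monoid M" "add_monoid M" "\<rho> h"
    using act_hom[OF h] by (intro group_hom.intro M.a_group group_hom_axioms.intro)
  have pow: "\<rho> h ([n] \<cdot>\<^bsub>M\<^esub> y) = [n] \<cdot>\<^bsub>M\<^esub> \<rho> h y" if "y \<in> carrier M" for y
    using g.hom_nat_pow[of y n] that by (simp add: add_pow_def)
  have "\<rho> h ` multiples n M = (\<lambda>y. [n] \<cdot>\<^bsub>M\<^esub> y) ` \<rho> h ` carrier M"
  proof -
    have "\<rho> h ` multiples n M = (\<lambda>y. \<rho> h ([n] \<cdot>\<^bsub>M\<^esub> y)) ` carrier M"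
      by (auto simp: multiples_def)
    also have "\<dots> = (\<lambda>y. [n] \<cdot>\<^bsub>M\<^esub> \<rho> h y) ` carrier M"
      by (rule image_cong) (simp_all add: pow)
    finally show ?thesis by (simp add: image_image)
  qed
  then have "\<rho> h ` multiples n M = multiples n M"
    using surj_prop[OF h] by (auto simp: multiples_def)
  moreover have "\<rho> h ` (multiples n M #>\<^bsub>add_monoid M\<^esub> x) = \<rho> h ` multiples n M #>\<^bsub>add_monoid M\<^esub> \<rho> h x"
  proof -
    have "\<rho> h ` (multiples n M #>\<^bsub>add_monoid M\<^esub> x) = (\<lambda>k. \<rho> h (k \<oplus>\<^bsub>M\<^esub> x)) ` multiples n M"
      by (auto simp: r_coset_def)
    also have "\<dots> = (\<lambda>k. \<rho> h k \<oplus>\<^bsub>M\<^esub> \<rho> h x) ` multiples n M"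
      using h x by (intro image_cong refl act_add) (auto simp: multiples_def)
    finally show ?thesis by (auto simp: r_coset_def)
  qed
  ultimately show ?thesis by simp
qed

text \<open>An equivariant first isomorphism theorem. With its converse below, the isomorphism on
  cosets in \<open>integral_cover\<close> can be traded for an equivariant surjection defined on M
  itself.\<close>

lemma A_Mod_multiples_isoI:
  assumes N: "group (add_monoid N)" and g: "g \<in> hom (add_monoid M) (add_monoid N)"
    and surj: "g ` carrier M = carrier N"
    and ker: "\<And>x. x \<in> carrier M \<Longrightarrow> g x = \<zero>\<^bsub>N\<^esub> \<longleftrightarrow> x \<in> multiples n M"
    and equi: "\<And>h x. h \<in> carrier H \<Longrightarrow> x \<in> carrier M \<Longrightarrow> g (\<rho> h x) = \<sigma> h (g x)"
  shows "\<exists>f \<in> iso (M A_Mod multiples n M) (add_monoid N).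
    \<forall>h \<in> carrier H. \<forall>C \<in> carrier (M A_Mod multiples n M). f (\<rho> h ` C) = \<sigma> h (f C)"
proof -
  interpret g: group_hom "add_monoid M" "add_monoid N" g
    using g N by (intro group_hom.intro M.a_group group_hom_axioms.intro)
  have k: "kernel (add_monoid M) (add_monoid N) g = multiples n M"
    using ker subgroup.subset[OF subgroup_multiples, of n] by (auto simp: kernel_def)
  let ?f = "\<lambda>C. the_elem (g ` C)"
  have iso: "?f \<in> iso (M A_Mod multiples n M) (add_monoid N)"
    using g.FactGroup_iso_set surj by (simp add: A_FactGroup_def k)
  have f: "?f (multiples n M #>\<^bsub>add_monoid M\<^esub> x) = g x" if "x \<in> carrier M" for x
  proof -
    have "g (y \<oplus>\<^bsub>M\<^esub> x) = g x" if "y \<in> multiples n M" for y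
      using g.hom_mult[of y x] g.hom_closed[of x] that \<open>x \<in> carrier M\<close> monoid.l_one[OF group.is_monoid[OF N], of "g x"]
      unfolding k[symmetric] kernel_def by simp
    moreover have "\<zero>\<^bsub>M\<^esub> \<in> multiples n M"
      using subgroup.one_closed[OF subgroup_multiples, of n] by simp
    ultimately have "(\<lambda>y. g (y \<oplus>\<^bsub>M\<^esub> x)) ` multiples n M = {g x}"
      by (auto intro!: image_eqI[where x = "\<zero>\<^bsub>M\<^esub>"])
    moreover have "g ` (multiples n M #>\<^bsub>add_monoid M\<^esub> x) = (\<lambda>y. g (y \<oplus>\<^bsub>M\<^esub> x)) ` multiples n M"
      by (auto simp: r_coset_def)
    ultimately have "g ` (multiples n M #>\<^bsub>add_monoid M\<^esub> x) = {g x}"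
      by simp
    then show ?thesis by simp
  qed
  have eq: "?f (\<rho> h ` C) = \<sigma> h (?f C)"
    if h: "h \<in> carrier H" and C: "C \<in> carrier (M A_Mod multiples n M)" for h C
  proof -
    obtain x where "x \<in> carrier M" "C = multiples n M #>\<^bsub>add_monoid M\<^esub> x"
      using C unfolding A_FactGroup_def carrier_FactGroup by auto
    then show ?thesis
      using h by (simp only: act_coset f act_closed equi)
  qed
  show ?thesis
    by (rule bexI[OF _ iso]) (intro ballI eq)
qed

lemma A_Mod_multiples_isoE:
  assumes N: "group (add_monoid N)" and f: "f \<in> iso (M A_Mod multiples n M) (add_monoid N)"
    and f_equi: "\<And>h C. h \<in> carrier H \<Longrightarrow> C \<in> carrier (M A_Mod multiples n M) \<Longrightarrow> f (\<rho> h ` C) = \<sigma> h (f C)"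
  obtains g where "g \<in> hom (add_monoid M) (add_monoid N)"
    and "g ` carrier M = carrier N"
    and "\<And>x. x \<in> carrier M \<Longrightarrow> g x = \<zero>\<^bsub>N\<^esub> \<longleftrightarrow> x \<in> multiples n M"
    and "\<And>h x. h \<in> carrier H \<Longrightarrow> x \<in> carrier M \<Longrightarrow> g (\<rho> h x) = \<sigma> h (g x)"
proof -
  interpret S: normal "multiples n M" "add_monoid M"
    using subgroup_multiples by (simp add: M.a_comm_group comm_group.subgroup_imp_normal)
  let ?q = "\<lambda>x. multiples n M #>\<^bsub>add_monoid M\<^esub> x"
  have fh: "f \<in> hom (add_monoid M Mod multiples n M) (add_monoid N)"
    and fb: "bij_betw f (?q ` carrier M) (carrier N)"
    using f by (auto simp: iso_def A_FactGroup_def carrier_FactGroup)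
  interpret f: group_hom "add_monoid M Mod multiples n M" "add_monoid N" f
    using fh N by (intro group_hom.intro S.factorgroup_is_group group_hom_axioms.intro)
  have "f \<circ> ?q \<in> hom (add_monoid M) (add_monoid N)"
    using hom_compose[OF S.r_coset_hom_Mod fh] by simp
  moreover have "(f \<circ> ?q) ` carrier M = carrier N"
    using fb by (simp add: bij_betw_def image_comp)
  moreover have "(f \<circ> ?q) x = \<zero>\<^bsub>N\<^esub> \<longleftrightarrow> x \<in> multiples n M" if x: "x \<in> carrier M" for x
  proof -
    have "?q \<zero>\<^bsub>M\<^esub> = multiples n M" "f (multiples n M) = \<zero>\<^bsub>N\<^esub>"
      using M.add.coset_mult_one S.subset f.hom_one by auto
    then have "(f \<circ> ?q) x = \<zero>\<^bsub>N\<^esub> \<longleftrightarrow> ?q x = multiples n M"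
      using inj_on_eq_iff[OF bij_betw_imp_inj_on[OF fb], of "?q x" "?q \<zero>\<^bsub>M\<^esub>"]
        imageI[OF x, of ?q] imageI[OF M.zero_closed, of ?q] by simp
    also have "\<dots> \<longleftrightarrow> x \<in> multiples n M"
      using M.add.coset_join1[OF _ _ subgroup_multiples] M.add.coset_join2[OF _ subgroup_multiples] x
      by (metis partial_object.select_convs(1))
    finally show ?thesis .
  qed
  moreover have "(f \<circ> ?q) (\<rho> h x) = \<sigma> h ((f \<circ> ?q) x)" if "h \<in> carrier H" "x \<in> carrier M" for h x
    using f_equi[of h "?q x"] that by (simp add: act_coset A_FactGroup_def carrier_FactGroup)
  ultimately show ?thesis by (rule that)
qed

end

section \<open>Free modules of finite rank\<close>

text \<open>A family indexed by \<open>{..<r}\<close> allows arguments coordinate by coordinate,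
  whereas the definition asks for a set of cardinality \<open>r\<close>. Over the zero ring
  \<open>indep\<close> holds vacuously and would not make \<open>b\<close> injective, hence the
  separate assumption \<open>inj\<close>.\<close>

lemma free_module_of_rankI:
  assumes "module R M"
    and b: "b \<in> {..<r} \<rightarrow> carrier M" and inj: "inj_on b {..<r}"
    and gen: "\<And>m. m \<in> carrier M \<Longrightarrow>
      \<exists>c \<in> {..<r} \<rightarrow> carrier R. m = (\<Oplus>\<^bsub>M\<^esub>j\<in>{..<r}. c j \<odot>\<^bsub>M\<^esub> b j)"
    and indep: "\<And>c j. c \<in> {..<r} \<rightarrow> carrier R \<Longrightarrow>
      (\<Oplus>\<^bsub>M\<^esub>j\<in>{..<r}. c j \<odot>\<^bsub>M\<^esub> b j) = \<zero>\<^bsub>M\<^esub> \<Longrightarrow> j < r \<Longrightarrow> c j = \<zero>\<^bsub>R\<^esub>"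
  shows "free_module_of_rank R M r"
proof -
  interpret module R M by fact
  let ?B = "b ` {..<r}"
  have B: "?B \<subseteq> carrier M" "finite ?B" "card ?B = r"
    using b inj by (auto simp: card_image)
  have lin: "lincomb a ?B = (\<Oplus>\<^bsub>M\<^esub>j\<in>{..<r}. a (b j) \<odot>\<^bsub>M\<^esub> b j)" if "a \<in> ?B \<rightarrow> carrier R" for a
  proof -
    have "(\<lambda>v. a v \<odot>\<^bsub>M\<^esub> v) \<in> ?B \<rightarrow> carrier M"
      using that b by auto
    then show ?thesis
      unfolding lincomb_def by (rule M.finsum_reindex[OF _ inj])
  qed
  have "\<not> lin_dep ?B"
  proof (rule finite_lin_indpt2[OF B(2,1)])
    fix a assume a: "a \<in> ?B \<rightarrow> carrier R" and z: "lincomb a ?B = \<zero>\<^bsub>M\<^esub>"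
    have "a (b j) = \<zero>\<^bsub>R\<^esub>" if "j < r" for j
      using a z[unfolded lin[OF a]] that by (intro indep[of "\<lambda>j. a (b j)" j]) auto
    then show "\<forall>v\<in>?B. a v = \<zero>\<^bsub>R\<^esub>" by auto
  qed
  moreover have "span ?B = carrier M"
  proof
    show "span ?B \<subseteq> carrier M" using span_is_subset2[OF B(1)] .
    show "carrier M \<subseteq> span ?B"
    proof
      fix m assume "m \<in> carrier M"
      then obtain c where c: "c \<in> {..<r} \<rightarrow> carrier R" "m = (\<Oplus>\<^bsub>M\<^esub>j\<in>{..<r}. c j \<odot>\<^bsub>M\<^esub> b j)"
        using gen by blast
      let ?a = "\<lambda>v. c (inv_into {..<r} b v)"
      have a: "?a \<in> ?B \<rightarrow> carrier R" using c(1) inj by auto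
      have "lincomb ?a ?B = (\<Oplus>\<^bsub>M\<^esub>j\<in>{..<r}. c j \<odot>\<^bsub>M\<^esub> b j)"
        unfolding lin[OF a] using c(1) b inj by (intro M.finsum_cong') auto
      then have "m = lincomb ?a ?B" using c(2) by simp
      then show "m \<in> span ?B"
        using a B(2) unfolding span_def by (intro CollectI exI[of _ ?a] exI[of _ ?B]) auto
    qed
  qed
  ultimately show ?thesis
    unfolding free_module_of_rank_def using B by blast
qed

text \<open>\<open>K\<close> inverts the map \<open>T\<close> from coefficient families to linear
  combinations. Addition is what is recorded, because the tower built from the coordinates concerns
  M as an abelian group.\<close>

lemma free_module_of_rank_coords:
  assumes "module R M" "free_module_of_rank R M r"
  obtains K where "bij_betw K (carrier M) ({..<r} \<rightarrow>\<^sub>E carrier R)"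
    and "\<And>x y j. x \<in> carrier M \<Longrightarrow> y \<in> carrier M \<Longrightarrow> j < r \<Longrightarrow>
      K (x \<oplus>\<^bsub>M\<^esub> y) j = K x j \<oplus>\<^bsub>R\<^esub> K y j"
proof -
  interpret module R M by fact
  obtain B where B: "B \<subseteq> carrier M" "finite B" "card B = r" "\<not> lin_dep B" "span B = carrier M"
    using assms(2) unfolding free_module_of_rank_def by blast
  obtain b where b: "bij_betw b {..<r} B"
    using ex_bij_betw_nat_finite[OF B(2)] B(3) by (auto simp: atLeast0LessThan)
  then have inj: "inj_on b {..<r}" and bB: "b ` {..<r} = B" by (auto simp: bij_betw_def)
  define E where "E = {..<r} \<rightarrow>\<^sub>E carrier R"
  define T where "T c = (\<Oplus>\<^bsub>M\<^esub>j\<in>{..<r}. c j \<odot>\<^bsub>M\<^esub> b j)" for c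
  have bM: "b j \<in> carrier M" if "j < r" for j
    using bB B(1) that by auto
  have lin: "lincomb a B = (\<Oplus>\<^bsub>M\<^esub>j\<in>{..<r}. a (b j) \<odot>\<^bsub>M\<^esub> b j)" if "a \<in> B \<rightarrow> carrier R" for a
  proof -
    have "(\<lambda>v. a v \<odot>\<^bsub>M\<^esub> v) \<in> b ` {..<r} \<rightarrow> carrier M"
      using that bM bB by auto
    then show ?thesis
      unfolding lincomb_def bB[symmetric] by (rule M.finsum_reindex[OF _ inj])
  qed
  have T_closed: "T c \<in> carrier M" if "c \<in> E" for c
    unfolding T_def using that bM by (intro M.finsum_closed) (auto simp: E_def)
  have T_add: "T (\<lambda>j\<in>{..<r}. c j \<oplus>\<^bsub>R\<^esub> d j) = T c \<oplus>\<^bsub>M\<^esub> T d" if "c \<in> E" "d \<in> E" for c d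
  proof -
    have cd: "c j \<in> carrier R" "d j \<in> carrier R" if "j < r" for j
      using \<open>c \<in> E\<close> \<open>d \<in> E\<close> that unfolding E_def by (auto dest: PiE_mem)
    have "T (\<lambda>j\<in>{..<r}. c j \<oplus>\<^bsub>R\<^esub> d j) = (\<Oplus>\<^bsub>M\<^esub>j\<in>{..<r}. c j \<odot>\<^bsub>M\<^esub> b j \<oplus>\<^bsub>M\<^esub> d j \<odot>\<^bsub>M\<^esub> b j)"
      unfolding T_def using bM cd by (intro M.finsum_cong') (auto simp: smult_l_distr)
    also have "\<dots> = T c \<oplus>\<^bsub>M\<^esub> T d"
      unfolding T_def using bM cd by (intro M.finsum_addf) auto
    finally show ?thesis .
  qed
  have T_zero: "c j = \<zero>\<^bsub>R\<^esub>" if "c \<in> E" "T c = \<zero>\<^bsub>M\<^esub>" "j < r" for c j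
  proof (rule ccontr)
    assume nz: "c j \<noteq> \<zero>\<^bsub>R\<^esub>"
    let ?a = "\<lambda>v. c (inv_into {..<r} b v)"
    have cR: "c i \<in> carrier R" if "i < r" for i
      using \<open>c \<in> E\<close> that unfolding E_def by (auto dest: PiE_mem)
    then have a: "?a \<in> B \<rightarrow> carrier R" using inj unfolding bB[symmetric] by auto
    have "lincomb ?a B = T c"
      unfolding lin[OF a] T_def using cR bM inj by (intro M.finsum_cong') auto
    moreover have "?a (b j) \<noteq> \<zero>\<^bsub>R\<^esub>" using nz that(3) inj by simp
    moreover have "b j \<in> B" using bB that(3) by blast
    ultimately have "lin_dep B"
      using a that(2) by (intro lin_dep_crit[OF B(2), of B ?a "b j"]) auto
    then show False using B(4) by simp
  qed
  have "inj_on T E"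
  proof (rule inj_onI)
    fix c d assume cd: "c \<in> E" "d \<in> E" and eq: "T c = T d"
    \<comment> \<open>Injectivity is reduced to a trivial kernel by adding -d to both families:
      \<open>?e\<close> is c - d and \<open>?z\<close> is d - d = 0.\<close>
    let ?m = "\<lambda>j\<in>{..<r}. \<ominus>\<^bsub>R\<^esub> d j"
    let ?e = "\<lambda>j\<in>{..<r}. c j \<oplus>\<^bsub>R\<^esub> ?m j"
    let ?z = "\<lambda>j\<in>{..<r}. d j \<oplus>\<^bsub>R\<^esub> ?m j"
    have cdR: "c j \<in> carrier R" "d j \<in> carrier R" if "j < r" for j
      using cd that unfolding E_def by (auto dest: PiE_mem)
    have m: "?m \<in> E" "?e \<in> E" "?z \<in> E"
      unfolding E_def using cdR by auto
    have "T ?e = T ?z" using T_add[OF cd(1) m(1)] T_add[OF cd(2) m(1)] eq by (simp only:)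
    also have "\<dots> = (\<Oplus>\<^bsub>M\<^esub>j\<in>{..<r}. \<zero>\<^bsub>M\<^esub>)"
      unfolding T_def using cdR bM
      by (intro M.finsum_cong') (auto simp: R.r_neg smult_l_null)
    finally have "T ?e = \<zero>\<^bsub>M\<^esub>" by simp
    then have "c j \<oplus>\<^bsub>R\<^esub> \<ominus>\<^bsub>R\<^esub> d j = \<zero>\<^bsub>R\<^esub>" if "j < r" for j
      using T_zero[OF m(2) _ that] that by simp
    then have "c j = d j" if "j < r" for j
      using R.r_right_minus_eq[of "c j" "d j"] cdR that by (simp add: a_minus_def)
    then show "c = d"
      using cd unfolding E_def by (intro PiE_ext) auto
  qed
  moreover have "T ` E = carrier M"
  proof
    show "T ` E \<subseteq> carrier M" using T_closed by blast
    show "carrier M \<subseteq> T ` E"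
    proof
      fix m assume "m \<in> carrier M"
      then have "m \<in> {lincomb a B | a. a \<in> B \<rightarrow> carrier R}"
        using B(5) finite_span[OF B(2,1)] by metis
      then obtain a where a: "a \<in> B \<rightarrow> carrier R" "m = lincomb a B"
        by blast
      have aR: "a (b j) \<in> carrier R" if "j < r" for j
        using a(1) that unfolding bB[symmetric] by auto
      have "T (\<lambda>j\<in>{..<r}. a (b j)) = lincomb a B"
        unfolding T_def lin[OF a(1)] using aR bM by (intro M.finsum_cong') auto
      moreover have "(\<lambda>j\<in>{..<r}. a (b j)) \<in> E"
        unfolding E_def using aR by auto
      ultimately show "m \<in> T ` E" using a(2) by (metis image_eqI)
    qed
  qed
  ultimately have T: "bij_betw T E (carrier M)" by (simp add: bij_betw_def)
  let ?K = "inv_into E T"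
  have K: "bij_betw ?K (carrier M) E" by (rule bij_betw_inv_into[OF T])
  have "?K (x \<oplus>\<^bsub>M\<^esub> y) j = ?K x j \<oplus>\<^bsub>R\<^esub> ?K y j"
    if "x \<in> carrier M" "y \<in> carrier M" "j < r" for x y j
  proof -
    have c: "?K x \<in> E" "?K y \<in> E" "T (?K x) = x" "T (?K y) = y"
      using that bij_betwE[OF K] bij_betw_inv_into_right[OF T] by auto
    let ?s = "\<lambda>j\<in>{..<r}. ?K x j \<oplus>\<^bsub>R\<^esub> ?K y j"
    have "?s \<in> E" using c(1,2) unfolding E_def by (auto dest: PiE_mem)
    moreover have "T ?s = x \<oplus>\<^bsub>M\<^esub> y" using T_add c by simp
    ultimately have "?K (x \<oplus>\<^bsub>M\<^esub> y) = ?s"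
      using bij_betw_inv_into_left[OF T] by force
    then show ?thesis using that(3) by simp
  qed
  then show ?thesis using that K unfolding E_def by blast
qed

section \<open>The Pruefer group\<close>

definition prufer_root :: "nat \<Rightarrow> nat \<Rightarrow> complex" where
  "prufer_root p n = cis (2 * pi / real (p ^ n))"

lemma carrier_prufer: "carrier (prufer_group p) = {z. \<exists>n. z ^ (p ^ n) = 1}"
  and mult_prufer [simp]: "x \<otimes>\<^bsub>prufer_group p\<^esub> y = x * y"
  and one_prufer [simp]: "\<one>\<^bsub>prufer_group p\<^esub> = 1"
  by (simp_all add: prufer_group_def)

lemma prufer_common_level:
  assumes "x ^ (p ^ n) = (1 :: complex)" "n \<le> m"
  shows "x ^ (p ^ m) = 1"
proof -
  have "p ^ m = p ^ n * p ^ (m - n)" using assms(2) by (simp flip: power_add)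
  then show ?thesis using assms(1) by (simp add: power_mult)
qed

lemma comm_group_prufer:
  assumes "p > 0"
  shows "comm_group (prufer_group p)"
proof (rule comm_groupI)
  fix x y assume "x \<in> carrier (prufer_group p)" "y \<in> carrier (prufer_group p)"
  then obtain n m where "x ^ (p ^ n) = 1" "y ^ (p ^ m) = 1" by (auto simp: carrier_prufer)
  then have "(x * y) ^ (p ^ max n m) = 1"
    using prufer_common_level[of x p n "max n m"] prufer_common_level[of y p m "max n m"]
    by (simp add: power_mult_distrib)
  then show "x \<otimes>\<^bsub>prufer_group p\<^esub> y \<in> carrier (prufer_group p)" by (auto simp: carrier_prufer)
next
  fix x assume "x \<in> carrier (prufer_group p)"
  then obtain n where n: "x ^ (p ^ n) = 1" by (auto simp: carrier_prufer)
  then have "x \<noteq> 0" using assms by (auto simp: power_0_left)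
  moreover have "inverse x \<in> carrier (prufer_group p)"
    using n by (auto simp: carrier_prufer power_inverse)
  ultimately show "\<exists>y\<in>carrier (prufer_group p). y \<otimes>\<^bsub>prufer_group p\<^esub> x = \<one>\<^bsub>prufer_group p\<^esub>"
    by (intro bexI[of _ "inverse x"]) auto
qed (auto simp: carrier_prufer)

lemma pow_prufer [simp]: "x [^]\<^bsub>prufer_group p\<^esub> (n :: nat) = x ^ n"
  by (induction n) (simp_all add: nat_pow_def prufer_group_def mult.commute)

lemma prufer_nonzero: "p > 0 \<Longrightarrow> x \<in> carrier (prufer_group p) \<Longrightarrow> x \<noteq> 0"
  by (auto simp: carrier_prufer power_0_left)

text \<open>The enumeration of the q-th roots of unity is injective on \<open>{..<q}\<close>, so the
  exponent is first reduced modulo \<open>q\<close>.\<close>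

lemma cis_root_eq_1_iff:
  assumes "q > 0"
  shows "cis (2 * pi / real q) ^ k = 1 \<longleftrightarrow> q dvd k"
proof -
  have *: "cis (2 * pi / real q) ^ k = cis (2 * pi * real (k mod q) / real q)"
  proof -
    have "cis (2 * pi / real q) ^ q = 1"
      using assms by (simp add: DeMoivre)
    then have "cis (2 * pi / real q) ^ (q * (k div q) + k mod q) = cis (2 * pi / real q) ^ (k mod q)"
      unfolding power_add power_mult by simp
    then have "cis (2 * pi / real q) ^ k = cis (2 * pi / real q) ^ (k mod q)"
      by simp
    then show ?thesis by (simp add: DeMoivre mult_ac)
  qed
  have inj: "inj_on (\<lambda>k. cis (2 * pi * real k / real q)) {..<q}"
    using bij_betw_roots_unity[OF assms] by (simp add: bij_betw_def)
  have "cis (2 * pi / real q) ^ k = 1 \<longleftrightarrow>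
      cis (2 * pi * real (k mod q) / real q) = cis (2 * pi * real 0 / real q)"
    unfolding * by simp
  also have "\<dots> \<longleftrightarrow> k mod q = 0"
    using inj_on_eq_iff[OF inj, of "k mod q" 0] assms by simp
  finally show ?thesis by (simp add: dvd_eq_mod_eq_0)
qed

lemma prufer_root_pow_eq_1_iff: "p > 0 \<Longrightarrow> prufer_root p n ^ k = 1 \<longleftrightarrow> p ^ n dvd k"
  unfolding prufer_root_def by (rule cis_root_eq_1_iff) simp

lemma prufer_root_0 [simp]: "prufer_root p 0 = 1"
  by (simp add: prufer_root_def)

lemma prufer_root_Suc_pow: "p > 0 \<Longrightarrow> prufer_root p (Suc n) ^ p = prufer_root p n"
  by (simp add: prufer_root_def DeMoivre)

lemma prufer_root_add_pow: "p > 0 \<Longrightarrow> prufer_root p (n + m) ^ (p ^ m) = prufer_root p n"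
  by (simp add: prufer_root_def DeMoivre power_add)

lemma prufer_root_pow_closed: "p > 0 \<Longrightarrow> prufer_root p n ^ k \<in> carrier (prufer_group p)"
  by (auto simp: carrier_prufer prufer_root_pow_eq_1_iff simp flip: power_mult intro!: exI[of _ n])

lemma prufer_root_closed: "p > 0 \<Longrightarrow> prufer_root p n \<in> carrier (prufer_group p)"
  using prufer_root_pow_closed[of p n 1] by simp

lemma prufer_root_generates:
  assumes "p > 0" "z ^ (p ^ n) = 1"
  obtains k where "k < p ^ n" "z = prufer_root p n ^ k"
proof -
  have "p ^ n > 0" using assms by simp
  then have "z \<in> (\<lambda>k. cis (2 * pi * real k / real (p ^ n))) ` {..<p ^ n}"
    using bij_betw_roots_unity[of "p ^ n"] assms(2) by (simp add: bij_betw_def)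
  then obtain k where "k < p ^ n" "z = cis (2 * pi * real k / real (p ^ n))" by auto
  moreover have "cis (2 * pi * real k / real (p ^ n)) = prufer_root p n ^ k"
    by (simp add: prufer_root_def DeMoivre mult_ac)
  ultimately show ?thesis using that by metis
qed

lemma prufer_divisible:
  assumes "p > 0" "x \<in> carrier (prufer_group p)"
  obtains y where "y \<in> carrier (prufer_group p)" "y ^ p = x"
proof -
  obtain n where "x ^ (p ^ n) = 1" using assms(2) by (auto simp: carrier_prufer)
  then obtain k where "x = prufer_root p n ^ k" using prufer_root_generates[OF assms(1)] by metis
  then have "(prufer_root p (Suc n) ^ k) ^ p = x"
    by (metis prufer_root_Suc_pow[OF assms(1)] mult.commute power_mult)
  then show ?thesis using that prufer_root_pow_closed[OF assms(1)] by blast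
qed

lemma countable_prufer: "p > 0 \<Longrightarrow> countable (carrier (prufer_group p))"
proof -
  assume p: "p > 0"
  have "carrier (prufer_group p) \<subseteq> (\<lambda>(n, k). prufer_root p n ^ k) ` UNIV"
  proof
    fix z assume "z \<in> carrier (prufer_group p)"
    then obtain n where "z ^ (p ^ n) = 1" by (auto simp: carrier_prufer)
    then obtain k where "z = prufer_root p n ^ k" using prufer_root_generates[OF p] by metis
    then show "z \<in> (\<lambda>(n, k). prufer_root p n ^ k) ` UNIV" by (auto intro!: image_eqI[of _ _ "(n, k)"])
  qed
  then show ?thesis by (rule countable_subset) simp
qed

section \<open>Towers exhausting a divisible group\<close>

text \<open>\<open>A\<close> is the direct limit of the sequence of \<open>p\<close>-th power maps \<open>X \<rightarrow> X \<rightarrow> \<dots>\<close>, and \<open>\<Phi> n x\<close> stands for \<open>x / p^n\<close>.\<close>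

locale divisible_tower = X: comm_group X + A: comm_group A
  for X :: "('x, 'k) monoid_scheme" and A :: "('a, 'l) monoid_scheme" +
  fixes p :: nat and \<Phi> :: "nat \<Rightarrow> 'x \<Rightarrow> 'a"
  assumes level_hom: "\<Phi> n \<in> hom X A"
    and level_kernel: "x \<in> carrier X \<Longrightarrow>
      \<Phi> n x = \<one>\<^bsub>A\<^esub> \<longleftrightarrow> (\<exists>y\<in>carrier X. x = y [^]\<^bsub>X\<^esub> (p ^ n))"
    and level_step: "x \<in> carrier X \<Longrightarrow> \<Phi> (Suc n) (x [^]\<^bsub>X\<^esub> p) = \<Phi> n x"
    and level_surj: "a \<in> carrier A \<Longrightarrow> \<exists>n. \<exists>x\<in>carrier X. a = \<Phi> n x"
begin

sublocale level: group_hom X A "\<Phi> n" for n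
  using level_hom by (intro group_hom.intro X.is_group A.is_group group_hom_axioms.intro)

text \<open>Expanding the fraction x / p^n by p^k. Thus any two elements of \<open>A\<close> can be
  written with a common denominator.\<close>

lemma level_add: "x \<in> carrier X \<Longrightarrow> \<Phi> (n + k) (x [^]\<^bsub>X\<^esub> (p ^ k)) = \<Phi> n x"
proof (induction k)
  case (Suc k)
  have "\<Phi> (n + Suc k) (x [^]\<^bsub>X\<^esub> (p ^ Suc k)) = \<Phi> (Suc (n + k)) ((x [^]\<^bsub>X\<^esub> (p ^ k)) [^]\<^bsub>X\<^esub> p)"
    using Suc.prems by (simp add: X.nat_pow_pow mult.commute)
  also have "\<dots> = \<Phi> n x"
    using Suc by (simp add: level_step)
  finally show ?case .
qed simp

lemma level_mono: "n \<le> m \<Longrightarrow> \<Phi> n ` carrier X \<subseteq> \<Phi> m ` carrier X"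
proof
  fix a assume nm: "n \<le> m" and "a \<in> \<Phi> n ` carrier X"
  then obtain x where "x \<in> carrier X" "a = \<Phi> n x" by blast
  then have "a = \<Phi> m (x [^]\<^bsub>X\<^esub> (p ^ (m - n)))" "x [^]\<^bsub>X\<^esub> (p ^ (m - n)) \<in> carrier X"
    using level_add[of x n "m - n"] nm by auto
  then show "a \<in> \<Phi> m ` carrier X" by blast
qed

lemma common_level:
  assumes "a \<in> carrier A" "b \<in> carrier A"
  obtains n x y where "x \<in> carrier X" "y \<in> carrier X" "a = \<Phi> n x" "b = \<Phi> n y"
proof -
  obtain n m where n: "a \<in> \<Phi> n ` carrier X" and m: "b \<in> \<Phi> m ` carrier X"
    using level_surj assms by blast
  have "a \<in> \<Phi> (max n m) ` carrier X" "b \<in> \<Phi> (max n m) ` carrier X"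
    using n m level_mono[of n "max n m"] level_mono[of m "max n m"] by auto
  then show ?thesis using that by blast
qed

text \<open>The kernel of \<open>\<Phi> n\<close> consists of the (p^n)-th powers, and every
  endomorphism of \<open>X\<close> preserves these. So x / p^n determines g(x) / p^n.\<close>

lemma hom_level_cong:
  assumes g: "g \<in> hom X X" and x: "x \<in> carrier X" and y: "y \<in> carrier X" and eq: "\<Phi> n x = \<Phi> n y"
  shows "\<Phi> n (g x) = \<Phi> n (g y)"
proof -
  interpret g: group_hom X X g
    using g by (intro group_hom.intro X.is_group group_hom_axioms.intro)
  have "\<Phi> n (x \<otimes>\<^bsub>X\<^esub> inv\<^bsub>X\<^esub> y) = \<one>\<^bsub>A\<^esub>"
    using x y eq by simp
  then obtain z where z: "z \<in> carrier X" "x \<otimes>\<^bsub>X\<^esub> inv\<^bsub>X\<^esub> y = z [^]\<^bsub>X\<^esub> (p ^ n)"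
    using level_kernel[of "x \<otimes>\<^bsub>X\<^esub> inv\<^bsub>X\<^esub> y" n] x y by auto
  then have "g x \<otimes>\<^bsub>X\<^esub> inv\<^bsub>X\<^esub> g y = g z [^]\<^bsub>X\<^esub> (p ^ n)"
    using x y by (metis g.hom_inv g.hom_mult g.hom_nat_pow X.inv_closed)
  then have "\<Phi> n (g x \<otimes>\<^bsub>X\<^esub> inv\<^bsub>X\<^esub> g y) = \<one>\<^bsub>A\<^esub>"
    using level_kernel[of "g x \<otimes>\<^bsub>X\<^esub> inv\<^bsub>X\<^esub> g y" n] x y z by auto
  then show ?thesis
    using x y A.inv_equality[of "\<Phi> n (g x)" "inv\<^bsub>A\<^esub> \<Phi> n (g y)"] by simp
qed

lemma hom_level_cong':
  assumes g: "g \<in> hom X X" and x: "x \<in> carrier X" and y: "y \<in> carrier X" and eq: "\<Phi> n x = \<Phi> m y"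
  shows "\<Phi> n (g x) = \<Phi> m (g y)"
proof -
  \<comment> \<open>The claim is symmetric in the two fractions. For n \<le> m the one with the
    smaller denominator is expanded to level \<open>m\<close>.\<close>
  have *: "\<Phi> n (g x) = \<Phi> m (g y)"
    if x: "x \<in> carrier X" and y: "y \<in> carrier X" and eq: "\<Phi> n x = \<Phi> m y" and nm: "n \<le> m" for n m x y
  proof -
    interpret g: group_hom X X g
      using g by (intro group_hom.intro X.is_group group_hom_axioms.intro)
    have "\<Phi> m (x [^]\<^bsub>X\<^esub> (p ^ (m - n))) = \<Phi> m y"
      using level_add[of x n "m - n"] nm x eq by simp
    then have "\<Phi> m (g (x [^]\<^bsub>X\<^esub> (p ^ (m - n)))) = \<Phi> m (g y)"
      using x y by (intro hom_level_cong[OF g]) auto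
    then show ?thesis
      using level_add[of "g x" n "m - n"] nm x by (simp add: g.hom_nat_pow)
  qed
  show ?thesis
    using *[OF x y eq] *[OF y x eq[symmetric]] by (cases "n \<le> m") auto
qed

text \<open>The extension x / p^n \<mapsto> g(x) / p^n; the description is unique by
  \<open>hom_level_cong'\<close> when \<open>g\<close> is an endomorphism. Restriction to the
  carrier makes the result extensional, as membership in \<open>Bij\<close> demands.\<close>

definition lift :: "('x \<Rightarrow> 'x) \<Rightarrow> 'a \<Rightarrow> 'a" where
  "lift g = (\<lambda>a\<in>carrier A. THE b. \<exists>n. \<exists>x\<in>carrier X. a = \<Phi> n x \<and> b = \<Phi> n (g x))"

lemma lift_level:
  assumes "g \<in> hom X X" "x \<in> carrier X"
  shows "lift g (\<Phi> n x) = \<Phi> n (g x)"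
proof -
  have "(THE b. \<exists>m. \<exists>y\<in>carrier X. \<Phi> n x = \<Phi> m y \<and> b = \<Phi> m (g y)) = \<Phi> n (g x)"
    using assms hom_level_cong'[OF assms(1)] by (intro the_equality) (metis+)
  then show ?thesis
    using assms by (simp add: lift_def)
qed

lemma lift_hom:
  assumes "g \<in> hom X X"
  shows "lift g \<in> hom A A"
proof (rule homI)
  interpret g: group_hom X X g
    using assms by (intro group_hom.intro X.is_group group_hom_axioms.intro)
  fix a b assume a: "a \<in> carrier A" and b: "b \<in> carrier A"
  then obtain n x y where xy: "x \<in> carrier X" "y \<in> carrier X" "a = \<Phi> n x" "b = \<Phi> n y"
    by (rule common_level)
  show "lift g a \<in> carrier A"
    using xy by (simp add: lift_level[OF assms])
  have "lift g (\<Phi> n (x \<otimes>\<^bsub>X\<^esub> y)) = \<Phi> n (g (x \<otimes>\<^bsub>X\<^esub> y))"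
    using xy by (intro lift_level[OF assms]) simp
  then show "lift g (a \<otimes>\<^bsub>A\<^esub> b) = lift g a \<otimes>\<^bsub>A\<^esub> lift g b"
    using xy by (simp add: lift_level[OF assms])
qed

lemma lift_compose:
  assumes "g \<in> hom X X" "h \<in> hom X X" "k \<in> hom X X"
    and "\<And>x. x \<in> carrier X \<Longrightarrow> k x = g (h x)" and a: "a \<in> carrier A"
  shows "lift k a = lift g (lift h a)"
proof -
  obtain n x where x: "x \<in> carrier X" "a = \<Phi> n x" using level_surj[OF a] by blast
  moreover have "h x \<in> carrier X" using assms(2) x(1) by (auto simp: hom_def)
  ultimately show ?thesis using assms by (simp add: lift_level)
qed

lemma lift_id:
  assumes "g \<in> hom X X" and "\<And>x. x \<in> carrier X \<Longrightarrow> g x = x" and a: "a \<in> carrier A"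
  shows "lift g a = a"
proof -
  obtain n x where x: "x \<in> carrier X" "a = \<Phi> n x" using level_surj[OF a] by blast
  then show ?thesis using assms by (simp add: lift_level)
qed

text \<open>Functoriality of \<open>lift\<close> turns products in \<open>H\<close> into
  compositions. Bijectivity comes from the group: the lift for the inverse of \<open>h\<close> is
  inverse to the lift for \<open>h\<close>.\<close>

lemma lift_action:
  assumes "group H"
    and hom: "\<And>h. h \<in> carrier H \<Longrightarrow> \<rho> h \<in> hom X X"
    and mult: "\<And>g h x. g \<in> carrier H \<Longrightarrow> h \<in> carrier H \<Longrightarrow> x \<in> carrier X \<Longrightarrow> \<rho> (g \<otimes>\<^bsub>H\<^esub> h) x = \<rho> g (\<rho> h x)"
    and one: "\<And>x. x \<in> carrier X \<Longrightarrow> \<rho> \<one>\<^bsub>H\<^esub> x = x"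
  shows "(\<lambda>h. lift (\<rho> h)) \<in> hom H (AutoGroup A)"
proof -
  interpret H: group H by fact
  have comp: "lift (\<rho> (g \<otimes>\<^bsub>H\<^esub> h)) a = lift (\<rho> g) (lift (\<rho> h) a)"
    if "g \<in> carrier H" "h \<in> carrier H" "a \<in> carrier A" for g h a
    using that hom mult by (intro lift_compose) auto
  have unit: "lift (\<rho> \<one>\<^bsub>H\<^esub>) a = a" if "a \<in> carrier A" for a
    using that hom one by (intro lift_id) auto
  have closed: "lift (\<rho> h) a \<in> carrier A" if "h \<in> carrier H" "a \<in> carrier A" for h a
    using lift_hom[OF hom] that by (auto simp: hom_def)
  have bij: "bij_betw (lift (\<rho> h)) (carrier A) (carrier A)" if h: "h \<in> carrier H" for h
    using h comp[of "inv\<^bsub>H\<^esub> h" h] comp[of h "inv\<^bsub>H\<^esub> h"]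
    by (intro bij_betwI[of _ _ _ "lift (\<rho> (inv\<^bsub>H\<^esub> h))"]) (auto simp: closed unit)
  have ext: "lift (\<rho> h) \<in> extensional (carrier A)" for h
    by (simp add: lift_def)
  have Bij: "lift (\<rho> h) \<in> Bij (carrier A)" if "h \<in> carrier H" for h
    using bij[OF that] ext by (simp add: Bij_def)
  show ?thesis
  proof (rule homI)
    fix h assume h: "h \<in> carrier H"
    then show "lift (\<rho> h) \<in> carrier (AutoGroup A)"
      using Bij lift_hom[OF hom[OF h]] by (simp add: AutoGroup_def auto_def)
    fix g assume g: "g \<in> carrier H"
    have "lift (\<rho> (h \<otimes>\<^bsub>H\<^esub> g)) = compose (carrier A) (lift (\<rho> h)) (lift (\<rho> g))"
      using h g comp ext by (intro extensionalityI[of _ "carrier A"]) (auto simp: compose_eq)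
    then show "lift (\<rho> (h \<otimes>\<^bsub>H\<^esub> g)) = lift (\<rho> h) \<otimes>\<^bsub>AutoGroup A\<^esub> lift (\<rho> g)"
      using h g Bij by (simp add: AutoGroup_def BijGroup_def)
  qed
qed

lemma torsion_eq: "{a \<in> carrier A. a [^]\<^bsub>A\<^esub> p = \<one>\<^bsub>A\<^esub>} = \<Phi> 1 ` carrier X"
proof (intro equalityI subsetI)
  fix a assume "a \<in> {a \<in> carrier A. a [^]\<^bsub>A\<^esub> p = \<one>\<^bsub>A\<^esub>}"
  then have a: "a \<in> carrier A" "a [^]\<^bsub>A\<^esub> p = \<one>\<^bsub>A\<^esub>" by auto
  obtain n x where "x \<in> carrier X" "a = \<Phi> n x" using level_surj[OF a(1)] by blast
  \<comment> \<open>A successor level is needed: if a = x / p^(n+1), then p a = 0 says x / p^n = 0,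
    so x is p^n y and a = y / p. A representation at level 0 would leave no room for this
    step.\<close>
  then have "a \<in> \<Phi> (Suc n) ` carrier X"
    using level_mono[of n "Suc n"] by auto
  then obtain x where x: "x \<in> carrier X" "a = \<Phi> (Suc n) x" by blast
  then have "\<Phi> n x = \<one>\<^bsub>A\<^esub>"
    using a(2) by (simp add: level_step flip: level.hom_nat_pow)
  then obtain y where y: "y \<in> carrier X" "x = y [^]\<^bsub>X\<^esub> (p ^ n)"
    using level_kernel x by blast
  then have "a = \<Phi> 1 y"
    using x level_add[of y 1 n] by simp
  then show "a \<in> \<Phi> 1 ` carrier X" using y by blast
next
  fix a assume "a \<in> \<Phi> 1 ` carrier X"
  then obtain x where x: "x \<in> carrier X" "a = \<Phi> 1 x" by blast
  then have "\<Phi> 1 (x [^]\<^bsub>X\<^esub> p) = \<one>\<^bsub>A\<^esub>"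
    using level_kernel[of "x [^]\<^bsub>X\<^esub> p" 1] by auto
  then show "a \<in> {a \<in> carrier A. a [^]\<^bsub>A\<^esub> p = \<one>\<^bsub>A\<^esub>}"
    using x by (simp add: level.hom_nat_pow)
qed

end

section \<open>Residues of a coefficient ring as roots of unity\<close>

lemma comm_group_sum_prufer:
  assumes "p > 0"
  shows "comm_group (sum_group {..<r} (\<lambda>_. prufer_group p))"
proof (rule group.group_comm_groupI)
  show "group (sum_group {..<r} (\<lambda>_. prufer_group p))"
    using comm_group_prufer[OF assms] by (simp add: comm_group_def)
qed (simp add: mult.commute)

lemma carrier_sum_prufer:
  assumes "p > 0"
  shows "carrier (sum_group {..<r::nat} (\<lambda>_. prufer_group p)) = {..<r} \<rightarrow>\<^sub>E carrier (prufer_group p)"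
proof -
  have "group (prufer_group p)"
    using comm_group_prufer[OF assms] by (simp add: comm_group_def)
  then show ?thesis by (simp add: carrier_sum_group)
qed

lemma countable_sum_prufer:
  assumes "p > 0"
  shows "countable (carrier (sum_group {..<r::nat} (\<lambda>_. prufer_group p)))"
proof -
  have "f \<in> (\<lambda>l. \<lambda>j\<in>{..<r}. l ! j) ` lists (carrier (prufer_group p))"
    if f: "f \<in> {..<r} \<rightarrow>\<^sub>E carrier (prufer_group p)" for f
  proof (rule image_eqI)
    show "f = (\<lambda>j\<in>{..<r}. map f [0..<r] ! j)"
      using f by (intro extensionalityI[of _ "{..<r}"]) (auto simp: PiE_def)
    show "map f [0..<r] \<in> lists (carrier (prufer_group p))"
      using PiE_mem[OF f] by auto
  qed
  then have "carrier (sum_group {..<r} (\<lambda>_. prufer_group p)) \<subseteq>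
      (\<lambda>l. \<lambda>j\<in>{..<r}. l ! j) ` lists (carrier (prufer_group p))"
    unfolding carrier_sum_prufer[OF assms] by blast
  then show ?thesis
    by (rule countable_subset) (simp add: countable_prufer[OF assms])
qed

text \<open>The target type is known only to be infinite. It contains a copy of the natural numbers,
  hence of any countable group, with the group structure transported along the injection.\<close>

lemma countable_group_copy:
  assumes "comm_group G" "countable (carrier G)" "infinite (UNIV :: 'a set)"
  obtains A :: "'a monoid" and e where "comm_group A" "e \<in> iso G A"
proof -
  interpret G: comm_group G by fact
  obtain f :: "nat \<Rightarrow> 'a" where f: "inj f"
    using infinite_countable_subset[OF assms(3)] by blast
  define e where "e = f \<circ> to_nat_on (carrier G)"
  have "inj_on e (carrier G)"
    unfolding e_def using assms(2) f by (intro comp_inj_on inj_on_to_nat_on) (auto intro: inj_on_subset)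
  then have iso: "e \<in> iso G (image_group e G)" and grp: "group (image_group e G)"
    using inj_imp_image_group_iso G.inj_imp_image_group_is_group by blast+
  have "comm_group (image_group e G)"
    using iso grp by (intro G.iso_imp_comm_group) (auto simp: is_iso_def group.is_monoid)
  then show ?thesis using that iso by blast
qed

text \<open>\<open>h\<close> is reduction modulo \<open>p\<close> with values represented in 0, ...,
  p - 1, so that \<open>nat (h y)\<close> can serve as a \<open>p\<close>-adic digit of
  \<open>y\<close>.\<close>

locale cover_ring = domain R for R (structure) +
  fixes p :: nat and h :: "'a \<Rightarrow> int"
  assumes p: "prime p"
    and char_0: "0 < n \<Longrightarrow> [(n::nat)] \<cdot> \<one> \<noteq> \<zero>"
    and hom: "h \<in> ring_hom R (prime_field p)"
    and ker: "x \<in> carrier R \<Longrightarrow> h x = 0 \<longleftrightarrow> (\<exists>y\<in>carrier R. x = [p] \<cdot> y)"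
begin

lemma p_pos: "p > 0"
  using p by (simp add: prime_gt_0_nat)

lemma h_closed: "x \<in> carrier R \<Longrightarrow> 0 \<le> h x \<and> h x < int p"
  using ring_hom_closed[OF hom] by (force simp: prime_field_simps)

lemma h_add: "x \<in> carrier R \<Longrightarrow> y \<in> carrier R \<Longrightarrow> h (x \<oplus> y) = (h x + h y) mod int p"
  using ring_hom_add[OF hom] by (simp add: prime_field_simps)

lemma h_zero: "h \<zero> = 0"
  using ker[of \<zero>] by (metis add.nat_pow_one zero_closed)

lemma h_nat: "h ([(n::nat)] \<cdot> \<one>) = int n mod int p"
proof (induction n)
  case (Suc n)
  have "h ([Suc n] \<cdot> \<one>) = (h ([n] \<cdot> \<one>) + h \<one>) mod int p"
    by (simp add: h_add)
  also have "h \<one> = 1"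
    using ring_hom_one[OF hom] by (simp add: prime_field_simps)
  finally show ?case using Suc by (simp add: mod_simps ac_simps)
qed (simp add: h_zero)

text \<open>Torsion-freeness, where being a domain and having characteristic 0 enter together:
  multiplication by \<open>n\<close> is multiplication by the nonzero ring element \<open>n\<close>
  times 1.\<close>

lemma nat_mult_cancel:
  assumes "n > 0" "x \<in> carrier R" "y \<in> carrier R" "[(n::nat)] \<cdot> x = [n] \<cdot> y"
  shows "x = y"
proof -
  have "[n] \<cdot> \<one> \<otimes> x = [n] \<cdot> \<one> \<otimes> y"
    using assms by (simp add: add_pow_ldistr)
  then show ?thesis
    using m_lcancel[of "[n] \<cdot> \<one>" x y] char_0[OF assms(1)] assms by simp
qed

text \<open>The first \<open>n\<close> digits of a \<open>p\<close>-adic expansion form the integer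
  \<open>k\<close>; the induction splits one further digit off the remainder
  \<open>y\<close>.\<close>

lemma residue_representation:
  "x \<in> carrier R \<Longrightarrow> \<exists>k::nat. \<exists>y\<in>carrier R. x = [k] \<cdot> \<one> \<oplus> [(p ^ n)] \<cdot> y"
proof (induction n)
  case 0
  then show ?case by (intro exI[of _ 0] bexI[of _ x]) auto
next
  case (Suc n)
  then obtain k y where k: "y \<in> carrier R" "x = [(k::nat)] \<cdot> \<one> \<oplus> [(p ^ n)] \<cdot> y" by blast
  \<comment> \<open>The next digit: \<open>j\<close> has the same residue as \<open>y\<close>, so y
    - j lies in the kernel of \<open>h\<close>, which is pR.\<close>
  define j where "j = nat (h y)"
  let ?z = "y \<oplus> \<ominus> ([j] \<cdot> \<one>)"
  have "y = ?z \<oplus> [j] \<cdot> \<one>"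
    using k(1) by (simp add: a_assoc l_neg)
  then have "h y = (h ?z + h ([j] \<cdot> \<one>)) mod int p"
    using h_add[of ?z "[j] \<cdot> \<one>"] k(1) by simp
  then have "h y = (h ?z + h y) mod int p"
    using h_closed[OF k(1)] by (simp add: h_nat j_def)
  then have "int p dvd h ?z"
    using h_closed[OF k(1)] by (metis add_diff_cancel_right' mod_eq_dvd_iff mod_pos_pos_trivial)
  then have "h ?z = 0"
    using h_closed[of ?z] k(1) zdvd_not_zless[of "h ?z" "int p"] by force
  then obtain w where w: "w \<in> carrier R" "?z = [p] \<cdot> w"
    using ker[of ?z] k(1) by auto
  have "y = [j] \<cdot> \<one> \<oplus> [p] \<cdot> w"
    using \<open>y = ?z \<oplus> [j] \<cdot> \<one>\<close> w by (simp add: a_comm)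
  then have "x = [k] \<cdot> \<one> \<oplus> ([(p ^ n)] \<cdot> ([j] \<cdot> \<one>) \<oplus> [(p ^ n)] \<cdot> ([p] \<cdot> w))"
    using k(2) w(1) by (simp add: add.nat_pow_distrib)
  also have "\<dots> = [(k + j * p ^ n)] \<cdot> \<one> \<oplus> [(p ^ Suc n)] \<cdot> w"
    using w(1) by (simp add: add.nat_pow_pow add.nat_pow_mult[symmetric] a_assoc mult.commute)
  finally show ?case using w(1) by blast
qed

text \<open>An integer divisible by p^n in R is divisible by p^n as an integer. The map
  \<open>h\<close> detects one factor \<open>p\<close>, torsion-freeness cancels it, and the
  induction continues with the quotient in place of \<open>m\<close>.\<close>

lemma dvd_if_multiple:
  "y \<in> carrier R \<Longrightarrow> [(m::nat)] \<cdot> \<one> = [(p ^ n)] \<cdot> y \<Longrightarrow> p ^ n dvd m"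
proof (induction n arbitrary: m)
  case (Suc n)
  have eq: "[m] \<cdot> \<one> = [p] \<cdot> ([(p ^ n)] \<cdot> y)"
    using Suc.prems by (simp add: add.nat_pow_pow mult.commute)
  then have "h ([m] \<cdot> \<one>) = 0"
    using ker[of "[m] \<cdot> \<one>"] Suc.prems(1) by (metis add.nat_pow_closed one_closed)
  then have "p dvd m"
    by (simp add: h_nat dvd_eq_mod_eq_0 flip: zmod_int)
  then obtain l where l: "m = p * l" by blast
  have "[p] \<cdot> ([l] \<cdot> \<one>) = [p] \<cdot> ([(p ^ n)] \<cdot> y)"
    using eq l by (simp add: add.nat_pow_pow mult.commute)
  then have "[l] \<cdot> \<one> = [(p ^ n)] \<cdot> y"
    using nat_mult_cancel[OF p_pos] Suc.prems(1) by (metis add.nat_pow_closed one_closed)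
  then show ?case using Suc l by simp
qed simp

text \<open>Two integers representing the same element modulo p^n R have a difference in p^n R,
  hence divisible by p^n, the order of the root. The order k \<le> l lets this difference be a
  natural number.\<close>

lemma residue_root_unique_aux:
  fixes k l :: nat
  assumes "y \<in> carrier R" "z \<in> carrier R" "k \<le> l"
    and eq: "[k] \<cdot> \<one> \<oplus> [(p ^ n)] \<cdot> y = [l] \<cdot> \<one> \<oplus> [(p ^ n)] \<cdot> z"
  shows "prufer_root p n ^ k = prufer_root p n ^ l"
proof -
  have "[l] \<cdot> \<one> = [k] \<cdot> \<one> \<oplus> [(l - k)] \<cdot> \<one>"
    using assms(3) by (simp add: add.nat_pow_mult)
  then have "[k] \<cdot> \<one> \<oplus> [(p ^ n)] \<cdot> y = [k] \<cdot> \<one> \<oplus> ([(l - k)] \<cdot> \<one> \<oplus> [(p ^ n)] \<cdot> z)"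
    using eq assms by (simp add: a_assoc)
  then have "[(p ^ n)] \<cdot> y = [(l - k)] \<cdot> \<one> \<oplus> [(p ^ n)] \<cdot> z"
    using add.Units_l_cancel[of "[k] \<cdot> \<one>" "[(p ^ n)] \<cdot> y" "[(l - k)] \<cdot> \<one> \<oplus> [(p ^ n)] \<cdot> z"] assms
    by (simp add: add.Units_eq)
  then have "[(p ^ n)] \<cdot> y \<oplus> [(p ^ n)] \<cdot> (\<ominus> z) = [(l - k)] \<cdot> \<one> \<oplus> ([(p ^ n)] \<cdot> z \<oplus> [(p ^ n)] \<cdot> (\<ominus> z))"
    using assms by (simp add: a_assoc)
  also have "[(p ^ n)] \<cdot> z \<oplus> [(p ^ n)] \<cdot> (\<ominus> z) = \<zero>"
    using assms add.nat_pow_distrib[of z "\<ominus> z" "p ^ n"] by (simp add: r_neg)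
  finally have "[(l - k)] \<cdot> \<one> = [(p ^ n)] \<cdot> (y \<oplus> \<ominus> z)"
    using assms by (simp add: add.nat_pow_distrib)
  then have "p ^ n dvd l - k"
    using assms by (intro dvd_if_multiple) auto
  then have "prufer_root p n ^ (l - k) = 1"
    by (simp add: prufer_root_pow_eq_1_iff p_pos)
  moreover have "prufer_root p n ^ l = prufer_root p n ^ k * prufer_root p n ^ (l - k)"
    using assms(3) by (simp flip: power_add)
  ultimately show ?thesis by simp
qed

lemma residue_root_unique:
  fixes k l :: nat
  assumes "y \<in> carrier R" "z \<in> carrier R"
    and "[k] \<cdot> \<one> \<oplus> [(p ^ n)] \<cdot> y = [l] \<cdot> \<one> \<oplus> [(p ^ n)] \<cdot> z"
  shows "prufer_root p n ^ k = prufer_root p n ^ l"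
  using residue_root_unique_aux[OF assms(1,2) _ assms(3)]
    residue_root_unique_aux[OF assms(2,1) _ assms(3)[symmetric]]
    linear[of k l] by metis

text \<open>The element by which \<open>x\<close> acts on \<open>\<zeta>\<^sub>n\<close> when \<open>C\<close> is regarded as a module over \<open>R\<close>.\<close>

definition residue_root :: "nat \<Rightarrow> 'a \<Rightarrow> complex" where
  "residue_root n x =
    (THE w. \<exists>k::nat. \<exists>y\<in>carrier R. x = [k] \<cdot> \<one> \<oplus> [(p ^ n)] \<cdot> y \<and> w = prufer_root p n ^ k)"

lemma residue_root_eq:
  fixes k :: nat
  assumes "y \<in> carrier R"
  shows "residue_root n ([k] \<cdot> \<one> \<oplus> [(p ^ n)] \<cdot> y) = prufer_root p n ^ k"
  unfolding residue_root_def
proof (rule the_equality)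
  show "\<exists>j::nat. \<exists>z\<in>carrier R. [k] \<cdot> \<one> \<oplus> [(p ^ n)] \<cdot> y = [j] \<cdot> \<one> \<oplus> [(p ^ n)] \<cdot> z \<and>
      prufer_root p n ^ k = prufer_root p n ^ j"
    using assms by blast
next
  fix w assume "\<exists>j::nat. \<exists>z\<in>carrier R. [k] \<cdot> \<one> \<oplus> [(p ^ n)] \<cdot> y = [j] \<cdot> \<one> \<oplus> [(p ^ n)] \<cdot> z \<and>
      w = prufer_root p n ^ j"
  then obtain j z where "z \<in> carrier R" "[k] \<cdot> \<one> \<oplus> [(p ^ n)] \<cdot> y = [(j::nat)] \<cdot> \<one> \<oplus> [(p ^ n)] \<cdot> z"
      "w = prufer_root p n ^ j"
    by blast
  then show "w = prufer_root p n ^ k"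
    using residue_root_unique[OF assms, of z k n j] by simp
qed

lemma residue_root_nat: "residue_root n ([(k::nat)] \<cdot> \<one>) = prufer_root p n ^ k"
  using residue_root_eq[of \<zero> n k] by simp

lemma residue_root_closed: "x \<in> carrier R \<Longrightarrow> residue_root n x \<in> carrier (prufer_group p)"
  using residue_representation[of x n] prufer_root_pow_closed[OF p_pos] residue_root_eq by metis

lemma residue_root_add:
  assumes "x \<in> carrier R" "y \<in> carrier R"
  shows "residue_root n (x \<oplus> y) = residue_root n x * residue_root n y"
proof -
  obtain k a where a: "a \<in> carrier R" "x = [(k::nat)] \<cdot> \<one> \<oplus> [(p ^ n)] \<cdot> a"
    using residue_representation[OF assms(1)] by blast
  obtain l b where b: "b \<in> carrier R" "y = [(l::nat)] \<cdot> \<one> \<oplus> [(p ^ n)] \<cdot> b"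
    using residue_representation[OF assms(2)] by blast
  have "x \<oplus> y = [(k + l)] \<cdot> \<one> \<oplus> [(p ^ n)] \<cdot> (a \<oplus> b)"
    using a b by (simp add: add.nat_pow_distrib add.nat_pow_mult[symmetric] a_ac)
  then have "residue_root n (x \<oplus> y) = prufer_root p n ^ (k + l)"
    using residue_root_eq[of "a \<oplus> b" n "k + l"] a b by simp
  then show ?thesis
    using a b by (simp add: residue_root_eq power_add)
qed

lemma residue_root_eq_1_iff:
  assumes "x \<in> carrier R"
  shows "residue_root n x = 1 \<longleftrightarrow> (\<exists>y\<in>carrier R. x = [(p ^ n)] \<cdot> y)"
proof
  assume one: "residue_root n x = 1"
  obtain k y where y: "y \<in> carrier R" "x = [(k::nat)] \<cdot> \<one> \<oplus> [(p ^ n)] \<cdot> y"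
    using residue_representation[OF assms] by blast
  then have "p ^ n dvd k"
    using one by (simp add: residue_root_eq prufer_root_pow_eq_1_iff p_pos)
  then obtain j where "k = p ^ n * j" by blast
  then have "x = [(p ^ n)] \<cdot> ([j] \<cdot> \<one> \<oplus> y)"
    using y by (simp add: add.nat_pow_distrib add.nat_pow_pow mult.commute)
  then show "\<exists>y\<in>carrier R. x = [(p ^ n)] \<cdot> y" using y by blast
next
  assume "\<exists>y\<in>carrier R. x = [(p ^ n)] \<cdot> y"
  then show "residue_root n x = 1"
    using residue_root_eq[of _ n 0] by auto
qed

lemma residue_root_step:
  assumes "x \<in> carrier R"
  shows "residue_root (Suc n) ([p] \<cdot> x) = residue_root n x"
proof -
  obtain k y where y: "y \<in> carrier R" "x = [(k::nat)] \<cdot> \<one> \<oplus> [(p ^ n)] \<cdot> y"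
    using residue_representation[OF assms] by blast
  then have "[p] \<cdot> x = [(p * k)] \<cdot> \<one> \<oplus> [(p ^ Suc n)] \<cdot> y"
    by (simp add: add.nat_pow_distrib add.nat_pow_pow mult.commute)
  then have "residue_root (Suc n) ([p] \<cdot> x) = prufer_root p (Suc n) ^ (p * k)"
    using residue_root_eq[of y "Suc n" "p * k"] y(1) by simp
  then show ?thesis
    using y by (simp add: residue_root_eq power_mult prufer_root_Suc_pow p_pos)
qed

end

section \<open>From integral covers to divisible hulls\<close>

lemma (in group_hom) hom_eq_iff:
  "x \<in> carrier G \<Longrightarrow> y \<in> carrier G \<Longrightarrow> h x = h y \<longleftrightarrow> h (x \<otimes>\<^bsub>G\<^esub> inv\<^bsub>G\<^esub> y) = \<one>\<^bsub>H\<^esub>"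
  using H.inv_solve_right'[of "\<one>\<^bsub>H\<^esub>" "h x" "h y"] by auto

text \<open>Makes linearity over the prime field a consequence of additivity. For
  \<open>k < p\<close> no reduction modulo \<open>p\<close> occurs while counting up to
  \<open>k\<close>, so a scalar is literally repeated addition.\<close>

lemma prime_field_smult:
  assumes "prime p" "module (prime_field p) V" "k < p" "v \<in> carrier V"
  shows "int k \<odot>\<^bsub>V\<^esub> v = [k] \<cdot>\<^bsub>V\<^esub> v"
  using assms(3)
proof (induction k)
  case 0
  interpret V: module "prime_field p" V by fact
  show ?case using V.smult_l_null[OF assms(4)] by (simp add: prime_field_simps)
next
  case (Suc k)
  interpret V: module "prime_field p" V by fact
  have "(int k \<oplus>\<^bsub>prime_field p\<^esub> 1) \<odot>\<^bsub>V\<^esub> v = int k \<odot>\<^bsub>V\<^esub> v \<oplus>\<^bsub>V\<^esub> 1 \<odot>\<^bsub>V\<^esub> v"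
    using Suc.prems assms(4) by (intro V.smult_l_distr) (auto simp: prime_field_simps)
  moreover have "1 \<odot>\<^bsub>V\<^esub> v = v"
    using V.smult_one[OF assms(4)] by (simp add: prime_field_simps)
  moreover have "int k \<oplus>\<^bsub>prime_field p\<^esub> 1 = int (Suc k)"
    using Suc.prems by (simp add: prime_field_simps)
  ultimately show ?case
    using Suc by simp
qed

lemma module_coords_nat:
  assumes "module R M" "x \<in> carrier M" "j < r" and K: "K \<in> carrier M \<rightarrow> ({..<r} \<rightarrow> carrier R)"
    and K_add: "\<And>x y j. x \<in> carrier M \<Longrightarrow> y \<in> carrier M \<Longrightarrow> j < r \<Longrightarrow>
      K (x \<oplus>\<^bsub>M\<^esub> y) j = K x j \<oplus>\<^bsub>R\<^esub> K y j"
  shows "K ([(k::nat)] \<cdot>\<^bsub>M\<^esub> x) j = [k] \<cdot>\<^bsub>R\<^esub> K x j"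
proof -
  interpret module R M by fact
  have Kc: "K x j \<in> carrier R" if "x \<in> carrier M" for x
    using K that assms(3) by auto
  have "K \<zero>\<^bsub>M\<^esub> j \<oplus>\<^bsub>R\<^esub> K \<zero>\<^bsub>M\<^esub> j = K \<zero>\<^bsub>M\<^esub> j"
    using K_add[of "\<zero>\<^bsub>M\<^esub>" "\<zero>\<^bsub>M\<^esub>" j] assms(3) by simp
  then have "K \<zero>\<^bsub>M\<^esub> j = \<zero>\<^bsub>R\<^esub>"
    using Kc[OF M.zero_closed] R.add.l_cancel_one by blast
  then show ?thesis
    using assms(2,3) Kc by (induction k) (simp_all add: K_add)
qed

lemma integral_cover_tower:
  fixes M :: "('r, 'm) module"
  assumes "prime p" "cover_coefficient_ring p R" "module R M" "free_module_of_rank R M r"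
    and A: "comm_group A" and e: "e \<in> iso (sum_group {..<r} (\<lambda>_. prufer_group p)) A"
  obtains \<Psi> where "divisible_tower (add_monoid M) A p \<Psi>"
proof -
  interpret module R M by fact
  interpret A: comm_group A by fact
  obtain h where h: "h \<in> ring_hom R (prime_field p)"
    "\<And>x. x \<in> carrier R \<Longrightarrow> h x = 0 \<longleftrightarrow> (\<exists>y\<in>carrier R. x = [p] \<cdot>\<^bsub>R\<^esub> y)"
    using cover_coefficient_ringE[OF assms(1,2)] by metis
  interpret C: cover_ring R p h
    using assms(1,2) h
    by (intro cover_ring.intro cover_ring_axioms.intro) (auto simp: cover_coefficient_ring_def)
  obtain K where Kb: "bij_betw K (carrier M) ({..<r} \<rightarrow>\<^sub>E carrier R)"
    and K_add: "\<And>x y j. x \<in> carrier M \<Longrightarrow> y \<in> carrier M \<Longrightarrow> j < r \<Longrightarrow>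
      K (x \<oplus>\<^bsub>M\<^esub> y) j = K x j \<oplus>\<^bsub>R\<^esub> K y j"
    using free_module_of_rank_coords[OF assms(3,4)] by metis
  have Kc: "K x j \<in> carrier R" if "x \<in> carrier M" "j < r" for x j
    using bij_betwE[OF Kb] that by (auto dest: PiE_mem)
  then have "K \<in> carrier M \<rightarrow> ({..<r} \<rightarrow> carrier R)" by auto
  note K_nat = module_coords_nat[OF assms(3) _ _ this K_add]
  have K_eqI: "x = y" if xy: "x \<in> carrier M" "y \<in> carrier M" "\<And>j. j < r \<Longrightarrow> K x j = K y j" for x y
  proof -
    have "K x = K y"
      using bij_betwE[OF Kb] xy by (intro PiE_ext[of _ "{..<r}" "\<lambda>_. carrier R"]) auto
    then show ?thesis using inj_onD[OF bij_betw_imp_inj_on[OF Kb]] xy(1,2) by blast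
  qed
  have K_surj: "\<exists>x\<in>carrier M. \<forall>j<r. K x j = c j" if c: "\<And>j. j < r \<Longrightarrow> c j \<in> carrier R" for c
  proof -
    have "(\<lambda>j\<in>{..<r}. c j) \<in> {..<r} \<rightarrow>\<^sub>E carrier R" using c by auto
    then obtain x where "x \<in> carrier M" "K x = (\<lambda>j\<in>{..<r}. c j)"
      using bij_betw_imp_surj_on[OF Kb] by (metis imageE)
    then show ?thesis by (intro bexI[of _ x]) auto
  qed
  let ?D = "sum_group {..<r} (\<lambda>_. prufer_group p)"
  interpret D: comm_group ?D by (rule comm_group_sum_prufer[OF C.p_pos])
  note carrD = carrier_sum_prufer[OF C.p_pos, of r]
  interpret e: group_hom ?D A e
    using e by (intro group_hom.intro D.is_group A.is_group group_hom_axioms.intro) (simp add: iso_def)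
  have eb: "bij_betw e (carrier ?D) (carrier A)" using e by (simp add: iso_def)
  \<comment> \<open>For fixed \<open>n\<close> this is reduction of M modulo p^n M, read in each of
    the \<open>r\<close> coordinates through \<open>C.residue_root\<close>.\<close>
  define \<Phi> where "\<Phi> n x = (\<lambda>j\<in>{..<r}. C.residue_root n (K x j))" for n x
  have \<Phi>_closed: "\<Phi> n x \<in> carrier ?D" if "x \<in> carrier M" for n x
    unfolding carrD \<Phi>_def using that Kc C.residue_root_closed by auto
  have "divisible_tower (add_monoid M) A p (\<lambda>n x. e (\<Phi> n x))"
  proof (intro divisible_tower.intro divisible_tower_axioms.intro M.a_comm_group A)
    fix n
    show "(\<lambda>x. e (\<Phi> n x)) \<in> hom (add_monoid M) A"
    proof (rule homI)
      fix x y assume xy: "x \<in> carrier (add_monoid M)" "y \<in> carrier (add_monoid M)"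
      then show "e (\<Phi> n x) \<in> carrier A" using \<Phi>_closed by simp
      have "\<Phi> n (x \<oplus>\<^bsub>M\<^esub> y) = \<Phi> n x \<otimes>\<^bsub>?D\<^esub> \<Phi> n y"
        unfolding \<Phi>_def using xy by (auto simp: K_add Kc C.residue_root_add)
      then show "e (\<Phi> n (x \<otimes>\<^bsub>add_monoid M\<^esub> y)) = e (\<Phi> n x) \<otimes>\<^bsub>A\<^esub> e (\<Phi> n y)"
        using xy \<Phi>_closed e.hom_mult by simp
    qed
  next
    fix x n assume "x \<in> carrier (add_monoid M)"
    then have x: "x \<in> carrier M" by simp
    have "e (\<Phi> n x) = \<one>\<^bsub>A\<^esub> \<longleftrightarrow> \<Phi> n x = \<one>\<^bsub>?D\<^esub>"
      using inj_on_eq_iff[OF bij_betw_imp_inj_on[OF eb] \<Phi>_closed[OF x] D.one_closed] e.hom_one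
      by (metis)
    also have "\<dots> \<longleftrightarrow> (\<forall>j<r. C.residue_root n (K x j) = 1)"
      unfolding \<Phi>_def by (auto simp: fun_eq_iff)
    also have "\<dots> \<longleftrightarrow> (\<forall>j<r. \<exists>y\<in>carrier R. K x j = [(p ^ n)] \<cdot>\<^bsub>R\<^esub> y)"
      using C.residue_root_eq_1_iff Kc x by simp
    also have "\<dots> \<longleftrightarrow> (\<exists>y\<in>carrier M. x = [(p ^ n)] \<cdot>\<^bsub>M\<^esub> y)"
    proof
      assume "\<forall>j<r. \<exists>y\<in>carrier R. K x j = [(p ^ n)] \<cdot>\<^bsub>R\<^esub> y"
      then obtain c where c: "\<And>j. j < r \<Longrightarrow> c j \<in> carrier R \<and> K x j = [(p ^ n)] \<cdot>\<^bsub>R\<^esub> c j"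
        by metis
      then obtain y where y: "y \<in> carrier M" "\<And>j. j < r \<Longrightarrow> K y j = c j"
        using K_surj[of c] by blast
      then have "x = [(p ^ n)] \<cdot>\<^bsub>M\<^esub> y"
        using x c by (intro K_eqI) (simp_all add: K_nat)
      then show "\<exists>y\<in>carrier M. x = [(p ^ n)] \<cdot>\<^bsub>M\<^esub> y" using y(1) by blast
    next
      assume "\<exists>y\<in>carrier M. x = [(p ^ n)] \<cdot>\<^bsub>M\<^esub> y"
      then obtain y where y: "y \<in> carrier M" "x = [(p ^ n)] \<cdot>\<^bsub>M\<^esub> y" by blast
      show "\<forall>j<r. \<exists>y\<in>carrier R. K x j = [(p ^ n)] \<cdot>\<^bsub>R\<^esub> y"
        using Kc[OF y(1)] K_nat[OF y(1)] unfolding y(2) by metis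
    qed
    finally show "e (\<Phi> n x) = \<one>\<^bsub>A\<^esub> \<longleftrightarrow>
        (\<exists>y\<in>carrier (add_monoid M). x = y [^]\<^bsub>add_monoid M\<^esub> (p ^ n))"
      by (simp add: add_pow_def)
    have "\<Phi> (Suc n) ([p] \<cdot>\<^bsub>M\<^esub> x) = \<Phi> n x"
      unfolding \<Phi>_def using x K_nat Kc C.residue_root_step by auto
    then show "e (\<Phi> (Suc n) (x [^]\<^bsub>add_monoid M\<^esub> p)) = e (\<Phi> n x)"
      by (simp add: add_pow_def)
  next
    fix a assume "a \<in> carrier A"
    then obtain d where d: "d \<in> carrier ?D" "a = e d"
      using bij_betw_imp_surj_on[OF eb] by blast
    have dj: "d j \<in> carrier (prufer_group p)" if "j < r" for j
      using d(1) that unfolding carrD by (auto dest: PiE_mem)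
    then have "\<forall>j\<in>{..<r}. \<exists>n. d j ^ (p ^ n) = 1"
      by (auto simp: carrier_prufer)
    then obtain N where N: "\<And>j. j < r \<Longrightarrow> d j ^ (p ^ N j) = 1"
      by (metis lessThan_iff)
    \<comment> \<open>A common level for all coordinates of \<open>d\<close>: the sum bounds each
      \<open>N j\<close> and also makes sense for r = 0.\<close>
    define n where "n = (\<Sum>j<r. N j)"
    have "\<exists>k. d j = prufer_root p n ^ k" if "j < r" for j
    proof -
      have "N j \<le> n" unfolding n_def using that by (intro member_le_sum) auto
      then have "d j ^ (p ^ n) = 1"
        using prufer_common_level N[OF that] by blast
      then show ?thesis using prufer_root_generates[OF C.p_pos] by metis
    qed
    then obtain k where k: "\<And>j. j < r \<Longrightarrow> d j = prufer_root p n ^ k j" by metis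
    obtain x where x: "x \<in> carrier M" "\<And>j. j < r \<Longrightarrow> K x j = [k j] \<cdot>\<^bsub>R\<^esub> \<one>\<^bsub>R\<^esub>"
      using K_surj[of "\<lambda>j. [k j] \<cdot>\<^bsub>R\<^esub> \<one>\<^bsub>R\<^esub>"] by auto
    have "\<Phi> n x = d"
    proof (rule extensionalityI[of _ "{..<r}"])
      show "d \<in> extensional {..<r}" using d(1) unfolding carrD by (simp add: PiE_def)
    qed (auto simp: \<Phi>_def x k C.residue_root_nat)
    then show "\<exists>n. \<exists>x\<in>carrier (add_monoid M). a = e (\<Phi> n x)"
      using x(1) d(2) by auto
  qed
  then show ?thesis by (rule that)
qed

lemma divisible_hull_if_integral_cover:
  fixes H :: "'h monoid" and M :: "('r, 'm) module" and V :: "(int, 'v) module"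
  assumes p: "prime p" and V: "group_module (prime_field p) H V \<sigma>"
    and cover: "integral_cover p H V \<sigma> R M \<rho>" and inf: "infinite (UNIV :: 'a set)"
  shows "has_divisible_hull_action TYPE('a) p H V \<sigma>"
proof -
  let ?r = "vectorspace.dim (prime_field p) V"
  let ?D = "sum_group {..<?r} (\<lambda>_. prufer_group p)"
  interpret V: group_module "prime_field p" H V \<sigma> by fact
  have M: "group_module R H M \<rho>" and R: "cover_coefficient_ring p R"
    and free: "free_module_of_rank R M ?r"
    using cover by (auto simp: integral_cover_def)
  interpret M: group_module R H M \<rho> by fact
  have p_pos: "p > 0" using p by (simp add: prime_gt_0_nat)
  interpret D: comm_group ?D by (rule comm_group_sum_prufer[OF p_pos])
  obtain f where f: "f \<in> iso (M A_Mod multiples p M) (add_monoid V)"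
    "\<And>h C. h \<in> carrier H \<Longrightarrow> C \<in> carrier (M A_Mod multiples p M) \<Longrightarrow> f (\<rho> h ` C) = \<sigma> h (f C)"
    using cover unfolding integral_cover_def by blast
  obtain g where g: "g \<in> hom (add_monoid M) (add_monoid V)" "g ` carrier M = carrier V"
    and g_ker: "\<And>x. x \<in> carrier M \<Longrightarrow> g x = \<zero>\<^bsub>V\<^esub> \<longleftrightarrow> x \<in> multiples p M"
    and g_equi: "\<And>h x. h \<in> carrier H \<Longrightarrow> x \<in> carrier M \<Longrightarrow> g (\<rho> h x) = \<sigma> h (g x)"
    using A_Mod_multiples_isoE[OF M V.M.a_group f] by metis
  obtain A :: "'a monoid" and e where A: "comm_group A" and e: "e \<in> iso ?D A"
    using countable_group_copy[OF D.comm_group_axioms countable_sum_prufer[OF p_pos] inf] by metis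
  obtain \<Psi> where "divisible_tower (add_monoid M) A p \<Psi>"
    using integral_cover_tower[OF p R M.module_axioms free A e] by metis
  then interpret T: divisible_tower "add_monoid M" A p \<Psi> .
  interpret g: group_hom "add_monoid M" "add_monoid V" g
    using g(1) by (intro group_hom.intro M.M.a_group V.M.a_group group_hom_axioms.intro)
  let ?\<phi> = "\<lambda>h. T.lift (\<rho> h)"
  have hom: "\<rho> h \<in> hom (add_monoid M) (add_monoid M)" if "h \<in> carrier H" for h
    using M.act_hom[OF that] .
  have H: "group H"
    using M.group_hom by (simp add: group_hom_def)
  have "\<rho> \<one>\<^bsub>H\<^esub> x = x" if "x \<in> carrier M" for x
    using fun_cong[OF M.id_eq_one, of x] that by simp
  then have \<phi>: "?\<phi> \<in> hom H (AutoGroup A)"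
    using hom M.composition_rule by (intro T.lift_action[OF H]) simp_all
  \<comment> \<open>\<open>\<Psi> 1\<close> and \<open>g\<close> have the same kernel pM, so the
    \<open>p\<close>-torsion of A and V are both quotients of M by the same subgroup.\<close>
  have \<Psi>g: "\<Psi> 1 x = \<Psi> 1 y \<longleftrightarrow> g x = g y" if "x \<in> carrier M" "y \<in> carrier M" for x y
  proof -
    let ?d = "x \<otimes>\<^bsub>add_monoid M\<^esub> inv\<^bsub>add_monoid M\<^esub> y"
    have d: "?d \<in> carrier M" using that M.M.add.inv_closed by simp
    have "\<Psi> 1 x = \<Psi> 1 y \<longleftrightarrow> \<Psi> 1 ?d = \<one>\<^bsub>A\<^esub>"
      using that T.level.hom_eq_iff[of x y 1] by simp
    also have "\<dots> \<longleftrightarrow> ?d \<in> multiples p M"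
      using T.level_kernel[of ?d 1] d by (auto simp: multiples_def add_pow_def)
    also have "\<dots> \<longleftrightarrow> g x = g y"
      using g_ker[OF d] that g.hom_eq_iff[of x y] by simp
    finally show ?thesis .
  qed
  have tors: "carrier (p_torsion p A) = \<Psi> 1 ` carrier M"
    using T.torsion_eq by (simp add: p_torsion_def)
  \<comment> \<open>The chosen preimage under \<open>\<Psi> 1\<close> does not matter, by
    \<open>\<Psi>g\<close>; the same equivalence later gives injectivity.\<close>
  define F where "F a = g (inv_into (carrier M) (\<Psi> 1) a)" for a
  have F: "F (\<Psi> 1 x) = g x" if "x \<in> carrier M" for x
  proof -
    have "\<Psi> 1 x \<in> \<Psi> 1 ` carrier M" using that by blast
    from f_inv_into_f[OF this] inv_into_into[OF this] show ?thesis
      unfolding F_def using \<Psi>g that by blast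
  qed
  have "F \<in> module_hom (prime_field p) (p_torsion p A) V"
    unfolding module_hom_def mem_Collect_eq
  proof (intro conjI allI impI)
    show "F \<in> carrier (p_torsion p A) \<rightarrow> carrier V"
      unfolding tors using F g(2) by auto
  next
    fix a b assume "a \<in> carrier (p_torsion p A) \<and> b \<in> carrier (p_torsion p A)"
    then obtain x y where xy: "x \<in> carrier M" "y \<in> carrier M" "a = \<Psi> 1 x" "b = \<Psi> 1 y"
      unfolding tors by blast
    then have "a \<oplus>\<^bsub>p_torsion p A\<^esub> b = \<Psi> 1 (x \<oplus>\<^bsub>M\<^esub> y)"
      using T.level.hom_mult[of x y 1] by (simp add: p_torsion_def)
    then show "F (a \<oplus>\<^bsub>p_torsion p A\<^esub> b) = F a \<oplus>\<^bsub>V\<^esub> F b"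
      using xy F g.hom_mult[of x y] by simp
  next
    fix k a assume ka: "k \<in> carrier (prime_field p) \<and> a \<in> carrier (p_torsion p A)"
    then obtain x where x: "x \<in> carrier M" "a = \<Psi> 1 x"
      unfolding tors by blast
    obtain n where n: "k = int n" "n < p"
      using ka by (auto simp: prime_field_simps elim: nonneg_int_cases)
    have "k \<odot>\<^bsub>p_torsion p A\<^esub> a = \<Psi> 1 ([n] \<cdot>\<^bsub>M\<^esub> x)"
      using x n T.level.hom_nat_pow[of x 1 n] by (simp add: p_torsion_def int_pow_int add_pow_def)
    moreover have "g ([n] \<cdot>\<^bsub>M\<^esub> x) = [n] \<cdot>\<^bsub>V\<^esub> g x"
      using x g.hom_nat_pow[of x n] by (simp add: add_pow_def)
    moreover have "g x \<in> carrier V" using x g(2) by blast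
    ultimately show "F (k \<odot>\<^bsub>p_torsion p A\<^esub> a) = k \<odot>\<^bsub>V\<^esub> F a"
      using x n F prime_field_smult[OF p V.module_axioms n(2)] by simp
  qed
  moreover have "bij_betw F (carrier (p_torsion p A)) (carrier V)"
  proof (rule bij_betw_imageI)
    show "inj_on F (carrier (p_torsion p A))"
      unfolding tors using F \<Psi>g by (auto simp: inj_on_def)
    show "F ` carrier (p_torsion p A) = carrier V"
      unfolding tors image_image using F g(2) by simp
  qed
  moreover have "F (?\<phi> h a) = \<sigma> h (F a)" if h: "h \<in> carrier H" and a: "a \<in> carrier (p_torsion p A)" for h a
  proof -
    obtain x where x: "x \<in> carrier M" "a = \<Psi> 1 x"
      using a unfolding tors by blast
    then show ?thesis
      using F h M.act_closed g_equi T.lift_level[OF hom[OF h], of x 1] by simp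
  qed
  ultimately have "group_module_isomorphic (prime_field p) H (p_torsion p A) ?\<phi> V \<sigma>"
    unfolding group_module_isomorphic_def by blast
  moreover have "divisible_p_group_of_rank p ?r A"
    unfolding divisible_p_group_of_rank_def
    using A D.iso_sym e by (auto simp: is_iso_def)
  ultimately show ?thesis
    unfolding has_divisible_hull_action_def divisible_hull_via_def using \<phi> by blast
qed

section \<open>Homomorphism groups\<close>

text \<open>Extensional functions are determined by their values on the carrier. This makes
  pointwise proofs of equations valid and keeps the set small enough for
  \<open>homs_embedding\<close>.\<close>

definition homs :: "('g, 'k) monoid_scheme \<Rightarrow> ('a, 'l) monoid_scheme \<Rightarrow> ('g \<Rightarrow> 'a) set" where
  "homs G A = hom G A \<inter> extensional (carrier G)"

lemma homs_closed: "f \<in> homs G A \<Longrightarrow> x \<in> carrier G \<Longrightarrow> f x \<in> carrier A"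
  by (auto simp: homs_def hom_def)

lemma homs_mult: "f \<in> homs G A \<Longrightarrow> x \<in> carrier G \<Longrightarrow> y \<in> carrier G \<Longrightarrow>
  f (x \<otimes>\<^bsub>G\<^esub> y) = f x \<otimes>\<^bsub>A\<^esub> f y"
  by (auto simp: homs_def hom_def)

lemma homs_eqI: "f \<in> homs G A \<Longrightarrow> g \<in> homs G A \<Longrightarrow> (\<And>x. x \<in> carrier G \<Longrightarrow> f x = g x) \<Longrightarrow> f = g"
  unfolding homs_def by (blast intro: extensionalityI)

lemma homsI:
  assumes "\<And>x. x \<in> carrier G \<Longrightarrow> f x \<in> carrier A"
    and "\<And>x y. x \<in> carrier G \<Longrightarrow> y \<in> carrier G \<Longrightarrow> f (x \<otimes>\<^bsub>G\<^esub> y) = f x \<otimes>\<^bsub>A\<^esub> f y"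
    and "group G"
  shows "(\<lambda>x\<in>carrier G. f x) \<in> homs G A"
  using assms unfolding homs_def hom_def
  by (auto simp: group.is_monoid monoid.m_closed)

lemma homs_pow:
  assumes "group G" "group A" "f \<in> homs G A" "x \<in> carrier G"
  shows "f (x [^]\<^bsub>G\<^esub> (n::nat)) = f x [^]\<^bsub>A\<^esub> n"
proof -
  interpret group_hom G A f
    using assms by (auto simp: homs_def group_hom_def group_hom_axioms_def)
  show ?thesis using assms(4) by (rule hom_nat_pow)
qed

lemma homs_one:
  assumes "group G" "group A" "f \<in> homs G A"
  shows "f \<one>\<^bsub>G\<^esub> = \<one>\<^bsub>A\<^esub>"
proof -
  interpret group_hom G A f
    using assms by (auto simp: homs_def group_hom_def group_hom_axioms_def)
  show ?thesis by (rule hom_one)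
qed

lemma homs_compose:
  assumes "group G" "f \<in> homs G A" "r \<in> homs G G"
  shows "compose (carrier G) f r \<in> homs G A"
  unfolding compose_def using assms
  by (intro homsI) (simp_all add: homs_closed homs_mult)

lemma homs_times:
  assumes "group G" "comm_group A" "f \<in> homs G A" "g \<in> homs G A"
  shows "(\<lambda>x\<in>carrier G. f x \<otimes>\<^bsub>A\<^esub> g x) \<in> homs G A"
proof -
  interpret A: comm_group A by fact
  show ?thesis
    using assms by (intro homsI) (simp_all add: homs_closed homs_mult A.m_ac)
qed

lemma homs_const:
  assumes "group G" "group A"
  shows "(\<lambda>x\<in>carrier G. \<one>\<^bsub>A\<^esub>) \<in> homs G A"
proof -
  interpret A: group A by fact
  show ?thesis using assms by (intro homsI) simp_all
qed

lemma homs_inv: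
  assumes "group G" "comm_group A" "f \<in> homs G A"
  shows "(\<lambda>x\<in>carrier G. inv\<^bsub>A\<^esub> f x) \<in> homs G A"
proof -
  interpret A: comm_group A by fact
  show ?thesis
    using assms by (intro homsI) (simp_all add: homs_closed homs_mult A.inv_mult)
qed

lemma homs_id:
  assumes "group G"
  shows "(\<lambda>x\<in>carrier G. x) \<in> homs G G"
  using assms by (intro homsI) simp_all

definition end_ring :: "('g, 'k) monoid_scheme \<Rightarrow> ('g \<Rightarrow> 'g) ring" where
  "end_ring G = \<lparr>carrier = homs G G, monoid.mult = compose (carrier G),
     one = (\<lambda>x\<in>carrier G. x), ring.zero = (\<lambda>x\<in>carrier G. \<one>\<^bsub>G\<^esub>),
     ring.add = (\<lambda>f g. \<lambda>x\<in>carrier G. f x \<otimes>\<^bsub>G\<^esub> g x)\<rparr>"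

lemma end_ring_simps:
  "carrier (end_ring G) = homs G G"
  "x \<in> carrier G \<Longrightarrow> (r \<otimes>\<^bsub>end_ring G\<^esub> s) x = r (s x)"
  "x \<in> carrier G \<Longrightarrow> (r \<oplus>\<^bsub>end_ring G\<^esub> s) x = r x \<otimes>\<^bsub>G\<^esub> s x"
  "x \<in> carrier G \<Longrightarrow> \<one>\<^bsub>end_ring G\<^esub> x = x"
  "x \<in> carrier G \<Longrightarrow> \<zero>\<^bsub>end_ring G\<^esub> x = \<one>\<^bsub>G\<^esub>"
  by (simp_all add: end_ring_def compose_eq)

lemma end_ring_closed:
  assumes "comm_group G"
  shows "r \<in> homs G G \<Longrightarrow> s \<in> homs G G \<Longrightarrow> r \<otimes>\<^bsub>end_ring G\<^esub> s \<in> homs G G"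
    and "r \<in> homs G G \<Longrightarrow> s \<in> homs G G \<Longrightarrow> r \<oplus>\<^bsub>end_ring G\<^esub> s \<in> homs G G"
    and "\<one>\<^bsub>end_ring G\<^esub> \<in> homs G G" "\<zero>\<^bsub>end_ring G\<^esub> \<in> homs G G"
proof -
  interpret G: comm_group G by fact
  show "r \<in> homs G G \<Longrightarrow> s \<in> homs G G \<Longrightarrow> r \<otimes>\<^bsub>end_ring G\<^esub> s \<in> homs G G"
    and "r \<in> homs G G \<Longrightarrow> s \<in> homs G G \<Longrightarrow> r \<oplus>\<^bsub>end_ring G\<^esub> s \<in> homs G G"
    and "\<one>\<^bsub>end_ring G\<^esub> \<in> homs G G" "\<zero>\<^bsub>end_ring G\<^esub> \<in> homs G G"
    using homs_compose[OF G.is_group] homs_times[OF G.is_group assms]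
      homs_id[OF G.is_group] homs_const[OF G.is_group G.is_group]
    by (simp_all add: end_ring_def)
qed

lemma ring_end_ring:
  assumes G: "comm_group G"
  shows "ring (end_ring G)"
proof -
  interpret G: comm_group G by fact
  note closed = end_ring_closed[OF G]
  note simps = end_ring_simps(2-) homs_closed
  have eqI: "r = s" if "r \<in> homs G G" "s \<in> homs G G" "\<And>x. x \<in> carrier G \<Longrightarrow> r x = s x" for r s
    using that by (rule homs_eqI)
  show ?thesis
  proof (rule ringI)
    show "abelian_group (end_ring G)"
    proof (rule abelian_groupI, unfold end_ring_simps(1))
      fix r assume r: "r \<in> homs G G"
      show "\<exists>s\<in>homs G G. s \<oplus>\<^bsub>end_ring G\<^esub> r = \<zero>\<^bsub>end_ring G\<^esub>"
      proof
        show i: "(\<lambda>x\<in>carrier G. inv\<^bsub>G\<^esub> r x) \<in> homs G G"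
          using homs_inv[OF G.is_group G r] .
        show "(\<lambda>x\<in>carrier G. inv\<^bsub>G\<^esub> r x) \<oplus>\<^bsub>end_ring G\<^esub> r = \<zero>\<^bsub>end_ring G\<^esub>"
          using r i by (intro eqI closed) (simp_all add: simps G.l_inv)
      qed
    next
      fix r s t assume "r \<in> homs G G" "s \<in> homs G G" "t \<in> homs G G"
      then show "r \<oplus>\<^bsub>end_ring G\<^esub> s \<oplus>\<^bsub>end_ring G\<^esub> t = r \<oplus>\<^bsub>end_ring G\<^esub> (s \<oplus>\<^bsub>end_ring G\<^esub> t)"
        by (intro eqI closed) (simp_all add: simps G.m_assoc)
    next
      fix r s assume "r \<in> homs G G" "s \<in> homs G G"
      then show "r \<oplus>\<^bsub>end_ring G\<^esub> s = s \<oplus>\<^bsub>end_ring G\<^esub> r"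
        by (intro eqI closed) (simp_all add: simps G.m_comm)
    next
      fix r assume "r \<in> homs G G"
      then show "\<zero>\<^bsub>end_ring G\<^esub> \<oplus>\<^bsub>end_ring G\<^esub> r = r"
        by (intro eqI closed) (simp_all add: simps)
    qed (simp_all add: closed)
    show "monoid (end_ring G)"
    proof (rule monoidI, unfold end_ring_simps(1))
      fix r s t assume "r \<in> homs G G" "s \<in> homs G G" "t \<in> homs G G"
      then show "r \<otimes>\<^bsub>end_ring G\<^esub> s \<otimes>\<^bsub>end_ring G\<^esub> t = r \<otimes>\<^bsub>end_ring G\<^esub> (s \<otimes>\<^bsub>end_ring G\<^esub> t)"
        by (intro eqI closed) (simp_all add: simps)
    next
      fix r assume "r \<in> homs G G"
      then show "\<one>\<^bsub>end_ring G\<^esub> \<otimes>\<^bsub>end_ring G\<^esub> r = r" "r \<otimes>\<^bsub>end_ring G\<^esub> \<one>\<^bsub>end_ring G\<^esub> = r"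
        by (intro eqI closed; simp add: simps)+
    qed (simp_all add: closed)
  next
    fix r s t assume "r \<in> carrier (end_ring G)" "s \<in> carrier (end_ring G)" "t \<in> carrier (end_ring G)"
    then have rst: "r \<in> homs G G" "s \<in> homs G G" "t \<in> homs G G" by (simp_all add: end_ring_simps)
    then show "(r \<oplus>\<^bsub>end_ring G\<^esub> s) \<otimes>\<^bsub>end_ring G\<^esub> t =
        r \<otimes>\<^bsub>end_ring G\<^esub> t \<oplus>\<^bsub>end_ring G\<^esub> s \<otimes>\<^bsub>end_ring G\<^esub> t"
      by (intro eqI closed) (simp_all add: simps)
    show "t \<otimes>\<^bsub>end_ring G\<^esub> (r \<oplus>\<^bsub>end_ring G\<^esub> s) =
        t \<otimes>\<^bsub>end_ring G\<^esub> r \<oplus>\<^bsub>end_ring G\<^esub> t \<otimes>\<^bsub>end_ring G\<^esub> s"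
      using rst by (intro eqI closed) (simp_all add: simps homs_mult)
  qed
qed

lemma end_ring_nat_apply:
  assumes "comm_group G" "r \<in> homs G G" "x \<in> carrier G"
  shows "([n] \<cdot>\<^bsub>end_ring G\<^esub> r) x = r x [^]\<^bsub>G\<^esub> (n::nat)"
proof -
  interpret G: comm_group G by fact
  interpret E: ring "end_ring G" using assms(1) by (rule ring_end_ring)
  show ?thesis
    using assms by (induction n) (simp_all add: end_ring_simps)
qed

text \<open>The image of \<open>prufer_root p n\<close> has order dividing p^n, hence is a power of
  that root, and the root generates the whole level. The exponent \<open>k\<close> may change with
  \<open>n\<close>; only its residue modulo p^n matters.\<close>

lemma prufer_end_level:
  assumes p: "p > 0" and r: "r \<in> homs (prufer_group p) (prufer_group p)"
  obtains k where "\<And>x. x ^ (p ^ n) = 1 \<Longrightarrow> r x = x ^ k"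
proof -
  let ?C = "prufer_group p"
  have C: "group ?C" using comm_group_prufer[OF p] by (simp add: comm_group_def)
  have root: "prufer_root p n \<in> carrier ?C" by (rule prufer_root_closed[OF p])
  have pow: "r (x ^ m) = r x ^ m" if "x \<in> carrier ?C" for x m
    using homs_pow[OF C C r that, of m] by simp
  have "r (prufer_root p n) ^ (p ^ n) = 1"
    using pow[OF root, of "p ^ n"] homs_one[OF C C r] prufer_root_pow_eq_1_iff[OF p, of n "p ^ n"] by simp
  then obtain k where k: "r (prufer_root p n) = prufer_root p n ^ k"
    using prufer_root_generates[OF p] by metis
  have "r x = x ^ k" if "x ^ (p ^ n) = 1" for x
  proof -
    obtain l where "x = prufer_root p n ^ l"
      using prufer_root_generates[OF p \<open>x ^ (p ^ n) = 1\<close>] by metis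
    then show ?thesis
      using pow[OF root, of l] k by (simp flip: power_mult add: mult.commute)
  qed
  then show ?thesis by (rule that)
qed

text \<open>Each element lies in some finite level, where both endomorphisms are power maps.\<close>

lemma prufer_end_commute:
  assumes p: "p > 0" and r: "r \<in> homs (prufer_group p) (prufer_group p)"
    and s: "s \<in> homs (prufer_group p) (prufer_group p)" and x: "x \<in> carrier (prufer_group p)"
  shows "r (s x) = s (r x)"
proof -
  obtain n where n: "x ^ (p ^ n) = 1" using x by (auto simp: carrier_prufer)
  obtain k where k: "\<And>x. x ^ (p ^ n) = 1 \<Longrightarrow> r x = x ^ k" using prufer_end_level[OF p r] by metis
  obtain l where l: "\<And>x. x ^ (p ^ n) = 1 \<Longrightarrow> s x = x ^ l" using prufer_end_level[OF p s] by metis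
  have "(x ^ m) ^ (p ^ n) = 1" for m
    using n by (metis mult.commute power_mult power_one)
  then show ?thesis
    using n k l by (simp flip: power_mult add: mult.commute)
qed

text \<open>
  At level \<open>n + m\<close> the endomorphism \<open>r\<close> is \<open>x \<mapsto> x^k\<close>, where \<open>p^n\<close> does not divide \<open>k\<close>. Hence \<open>gcd k (p^(n + m))\<close>
  divides \<open>p^n\<close>, and \<open>k\<close> times a suitable number is any given multiple of \<open>p^n\<close> modulo \<open>p^(n + m)\<close>.
\<close>

lemma prufer_end_surj:
  assumes prime: "prime p" and r: "r \<in> homs (prufer_group p) (prufer_group p)"
    and x0: "x0 \<in> carrier (prufer_group p)" "r x0 \<noteq> 1" and y: "y \<in> carrier (prufer_group p)"
  shows "\<exists>x\<in>carrier (prufer_group p). r x = y"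
proof -
  have p: "p > 0" using prime by (simp add: prime_gt_0_nat)
  obtain n where n: "x0 ^ (p ^ n) = 1" using x0 by (auto simp: carrier_prufer)
  obtain m where m: "y ^ (p ^ m) = 1" using y by (auto simp: carrier_prufer)
  obtain k where k: "\<And>x. x ^ (p ^ (n + m)) = 1 \<Longrightarrow> r x = x ^ k" using prufer_end_level[OF p r] by metis
  have "r x0 = x0 ^ k"
    using k[OF prufer_common_level[OF n]] by simp
  have "\<not> p ^ n dvd k"
  proof
    assume "p ^ n dvd k"
    then obtain q where "k = p ^ n * q" by blast
    then have "x0 ^ k = 1" using n by (simp add: power_mult)
    then show False using \<open>r x0 = x0 ^ k\<close> x0 by simp
  qed
  obtain b where b: "gcd k (p ^ (n + m)) = p ^ b"
    using divides_primepow_nat[OF prime, of "gcd k (p ^ (n + m))" "n + m"] by auto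
  then have "b \<le> n"
    using \<open>\<not> p ^ n dvd k\<close> by (metis dvd_trans gcd_dvd1 le_imp_power_dvd nat_le_linear)
  obtain z where z: "[k * z = p ^ b] (mod p ^ (n + m))"
    using cong_solve_nat[of k "p ^ (n + m)"] b by auto
  obtain l where l: "y = prufer_root p m ^ l"
    using prufer_root_generates[OF p m] by metis
  let ?w = "prufer_root p (n + m)"
  have w: "?w ^ (p ^ (n + m)) = 1" by (simp add: prufer_root_pow_eq_1_iff p)
  have mod: "?w ^ u = ?w ^ (u mod p ^ (n + m))" for u
  proof -
    have "?w ^ u = ?w ^ (p ^ (n + m) * (u div p ^ (n + m)) + u mod p ^ (n + m))" by simp
    also have "\<dots> = ?w ^ (u mod p ^ (n + m))"
      unfolding power_add[of ?w "p ^ (n + m) * (u div p ^ (n + m))"] power_mult w by simp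
    finally show ?thesis .
  qed
  \<comment> \<open>The exponent is found backwards: \<open>r\<close> multiplies it by
    \<open>k\<close>, k z is p^b modulo p^(n+m), and p^b p^(n-b) l = p^n l is the exponent at which
    the root of level n + m gives \<open>y\<close>.\<close>
  let ?x = "?w ^ (z * (p ^ (n - b) * l))"
  have "?x ^ (p ^ (n + m)) = 1"
    using w by (metis mult.commute power_mult power_one)
  then have "r ?x = ?w ^ (k * z * (p ^ (n - b) * l))"
    using k by (simp flip: power_mult add: ac_simps)
  also have "\<dots> = ?w ^ (p ^ b * (p ^ (n - b) * l))"
    using mod cong_mult[OF z cong_refl[of "p ^ (n - b) * l"]] unfolding cong_def by metis
  also have "p ^ b * (p ^ (n - b) * l) = p ^ n * l"
    using \<open>b \<le> n\<close> by (simp flip: power_add mult.assoc)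
  also have "?w ^ (p ^ n * l) = y"
    using prufer_root_add_pow[OF p, of m n] l by (simp add: power_mult add.commute)
  finally show ?thesis using prufer_root_pow_closed[OF p] by blast
qed

text \<open>Used twice: with A = C it shows that the endomorphisms killing
  \<open>prufer_root p 1\<close> are the multiples of \<open>p\<close> in End C, and with A the hull
  it identifies the kernel of evaluation with pM.\<close>

lemma prufer_hom_divisible:
  assumes p: "p > 0" and A: "comm_group A" and f: "f \<in> homs (prufer_group p) A"
    and one: "f (prufer_root p 1) = \<one>\<^bsub>A\<^esub>"
  obtains g where "g \<in> homs (prufer_group p) A"
    and "\<And>x. x \<in> carrier (prufer_group p) \<Longrightarrow> f x = g x [^]\<^bsub>A\<^esub> p"
proof -
  let ?C = "prufer_group p"
  interpret A: comm_group A by fact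
  interpret C: comm_group ?C by (rule comm_group_prufer[OF p])
  interpret f: group_hom ?C A f
    using f by (auto simp: homs_def group_hom_def group_hom_axioms_def C.is_group A.is_group)
  have ker: "f y = \<one>\<^bsub>A\<^esub>" if y: "y \<in> carrier ?C" "y ^ p = 1" for y
  proof -
    obtain k where "y = prufer_root p 1 ^ k"
      using prufer_root_generates[OF p, of y 1] y(2) by auto
    then show ?thesis
      using f.hom_nat_pow[OF prufer_root_closed[OF p, of 1], of k] one by simp
  qed
  have cong: "f y = f z" if y: "y \<in> carrier ?C" and z: "z \<in> carrier ?C" and eq: "y ^ p = z ^ p" for y z
  proof -
    have "(y \<otimes>\<^bsub>?C\<^esub> inv\<^bsub>?C\<^esub> z) [^]\<^bsub>?C\<^esub> p = (y [^]\<^bsub>?C\<^esub> p) \<otimes>\<^bsub>?C\<^esub> inv\<^bsub>?C\<^esub> (z [^]\<^bsub>?C\<^esub> p)"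
      using y z by (simp add: C.nat_pow_distrib C.nat_pow_inv del: mult_prufer pow_prufer)
    also have "\<dots> = \<one>\<^bsub>?C\<^esub>"
      using C.r_inv[of "z [^]\<^bsub>?C\<^esub> p"] z eq C.nat_pow_closed[OF z, of p] by simp
    finally have "(y \<otimes>\<^bsub>?C\<^esub> inv\<^bsub>?C\<^esub> z) ^ p = 1" by (simp del: mult_prufer)
    then show ?thesis
      using f.hom_eq_iff[OF y z] ker y z C.m_closed C.inv_closed by blast
  qed
  \<comment> \<open>\<open>q\<close> picks some \<open>p\<close>-th root in C and is not a
    homomorphism itself. By \<open>cong\<close> the value of \<open>f\<close> at a root does not
    depend on the choice, so f after q is a homomorphism; since \<open>q x ^ p = x\<close>, its
    \<open>p\<close>-th power is \<open>f\<close>.\<close>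
  define q where "q x = (SOME y. y \<in> carrier ?C \<and> y ^ p = x)" for x
  have q: "q x \<in> carrier ?C" "q x ^ p = x" if "x \<in> carrier ?C" for x
  proof -
    have "\<exists>y. y \<in> carrier ?C \<and> y ^ p = x" using prufer_divisible[OF p that] by metis
    from someI_ex[OF this] show "q x \<in> carrier ?C" "q x ^ p = x" by (simp_all add: q_def)
  qed
  let ?g = "\<lambda>x\<in>carrier ?C. f (q x)"
  have "?g \<in> homs ?C A"
  proof (rule homsI[OF _ _ C.is_group])
    fix x y assume x: "x \<in> carrier ?C" and y: "y \<in> carrier ?C"
    show "f (q x) \<in> carrier A" using q(1)[OF x] by simp
    have xy: "x \<otimes>\<^bsub>?C\<^esub> y \<in> carrier ?C" using x y by (rule C.m_closed)
    have qq: "q x \<otimes>\<^bsub>?C\<^esub> q y \<in> carrier ?C" using q(1) x y by (intro C.m_closed)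
    have "q (x \<otimes>\<^bsub>?C\<^esub> y) ^ p = (q x \<otimes>\<^bsub>?C\<^esub> q y) ^ p"
      using q(2)[OF xy] q(2)[OF x] q(2)[OF y] by (simp add: power_mult_distrib)
    then have "f (q (x \<otimes>\<^bsub>?C\<^esub> y)) = f (q x \<otimes>\<^bsub>?C\<^esub> q y)"
      using cong q(1)[OF xy] qq by blast
    then show "f (q (x \<otimes>\<^bsub>?C\<^esub> y)) = f (q x) \<otimes>\<^bsub>A\<^esub> f (q y)"
      using f.hom_mult q(1) x y by metis
  qed
  moreover have "f x = ?g x [^]\<^bsub>A\<^esub> p" if x: "x \<in> carrier ?C" for x
    using f.hom_nat_pow[OF q(1)[OF x], of p] q(2)[OF x] x by simp
  ultimately show ?thesis by (rule that)
qed

lemma prufer_hom_root_eq_one: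
  assumes p: "p > 0" and A: "comm_group A" and g: "g \<in> homs (prufer_group p) A"
  shows "g (prufer_root p 1) [^]\<^bsub>A\<^esub> p = \<one>\<^bsub>A\<^esub>"
proof -
  have C: "group (prufer_group p)" and "group A"
    using comm_group_prufer[OF p] A by (simp_all add: comm_group_def)
  then show ?thesis
    using homs_pow[OF C _ g prufer_root_closed[OF p], of 1 p] homs_one[OF C _ g]
      prufer_root_Suc_pow[OF p, of 0] by simp
qed

section \<open>The endomorphism ring of the Pruefer group\<close>

text \<open>End C consists of functions on the complex numbers, whereas the coefficient ring must
  live in the prescribed type; its properties are carried along an injection.\<close>

lemma cover_coefficient_ring_image:
  fixes R :: "'s ring" and i :: "'s \<Rightarrow> 'r"
  assumes "prime p" and R: "cover_coefficient_ring p R" and inj: "inj_on i (carrier R)"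
  shows "cover_coefficient_ring p (image_ring i R)"
proof -
  let ?S = "image_ring i R"
  interpret R: domain R using R by (simp add: cover_coefficient_ring_def)
  interpret S: domain ?S by (rule R.inj_imp_image_ring_is_domain[OF inj])
  have iso: "i \<in> ring_iso R ?S" by (rule inj_imp_image_ring_iso[OF inj])
  have carr: "carrier ?S = i ` carrier R" by (rule image_ring_carrier)
  interpret i: ring_hom_ring R ?S i
    using iso by (intro ring_hom_ringI2 R.ring_axioms S.ring_axioms) (simp add: ring_iso_def)
  have nat: "i ([n] \<cdot>\<^bsub>R\<^esub> x) = [n] \<cdot>\<^bsub>?S\<^esub> i x" if "x \<in> carrier R" for n :: nat and x
    using that by (induction n) simp_all
  obtain h where h: "h \<in> ring_hom R (prime_field p)" "h ` carrier R = carrier (prime_field p)"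
    and ker: "\<And>x. x \<in> carrier R \<Longrightarrow> h x = 0 \<longleftrightarrow> (\<exists>y\<in>carrier R. x = [p] \<cdot>\<^bsub>R\<^esub> y)"
    using cover_coefficient_ringE[OF assms(1) R] by metis
  let ?d = "inv_into (carrier R) i"
  have d: "?d \<in> ring_iso ?S R" by (rule ring_iso_set_sym[OF R.ring_axioms iso])
  show ?thesis
  proof (rule cover_coefficient_ringI[OF assms(1) S.domain_axioms])
    fix n :: nat assume "0 < n"
    then have "[n] \<cdot>\<^bsub>R\<^esub> \<one>\<^bsub>R\<^esub> \<noteq> \<zero>\<^bsub>R\<^esub>" using R by (simp add: cover_coefficient_ring_def)
    then have "i ([n] \<cdot>\<^bsub>R\<^esub> \<one>\<^bsub>R\<^esub>) \<noteq> i \<zero>\<^bsub>R\<^esub>"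
      using inj_on_eq_iff[OF inj, of "[n] \<cdot>\<^bsub>R\<^esub> \<one>\<^bsub>R\<^esub>" "\<zero>\<^bsub>R\<^esub>"] by simp
    then show "[n] \<cdot>\<^bsub>?S\<^esub> \<one>\<^bsub>?S\<^esub> \<noteq> \<zero>\<^bsub>?S\<^esub>"
      by (simp add: nat)
  next
    show "h \<circ> ?d \<in> ring_hom ?S (prime_field p)"
      using d h(1) by (intro ring_hom_trans) (simp_all add: ring_iso_def)
    have "(h \<circ> ?d) ` carrier ?S = h ` ((\<lambda>x. ?d (i x)) ` carrier R)"
      unfolding carr image_comp by (simp add: comp_def)
    also have "(\<lambda>x. ?d (i x)) ` carrier R = carrier R"
      using inj by simp
    finally show "(h \<circ> ?d) ` carrier ?S = carrier (prime_field p)" using h(2) by simp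
  next
    fix x assume "x \<in> carrier ?S"
    then obtain z where z: "z \<in> carrier R" "x = i z" unfolding carr by blast
    have "(h \<circ> ?d) x = 0 \<longleftrightarrow> (\<exists>y\<in>carrier R. z = [p] \<cdot>\<^bsub>R\<^esub> y)"
      using z inj ker by simp
    also have "\<dots> \<longleftrightarrow> (\<exists>y\<in>carrier R. i z = i ([p] \<cdot>\<^bsub>R\<^esub> y))"
      using inj_on_eq_iff[OF inj z(1)] R.add.nat_pow_closed by metis
    also have "\<dots> \<longleftrightarrow> (\<exists>y\<in>carrier ?S. x = [p] \<cdot>\<^bsub>?S\<^esub> y)"
      unfolding carr z(2) by (simp add: nat)
    finally show "(h \<circ> ?d) x = 0 \<longleftrightarrow> (\<exists>y\<in>carrier ?S. x = [p] \<cdot>\<^bsub>?S\<^esub> y)" .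
  qed
qed

text \<open>If \<open>s\<close> is nonzero it is surjective, so r after s being zero forces
  \<open>r\<close> to be zero.\<close>

lemma domain_end_prufer:
  assumes prime: "prime p"
  shows "domain (end_ring (prufer_group p))"
proof -
  let ?C = "prufer_group p"
  let ?E = "end_ring ?C"
  have p: "p > 0" using prime by (simp add: prime_gt_0_nat)
  have C: "comm_group ?C" by (rule comm_group_prufer[OF p])
  interpret C: comm_group ?C by fact
  interpret E: ring ?E by (rule ring_end_ring[OF C])
  note closed = end_ring_closed[OF C] and simps = end_ring_simps(2-) homs_closed
  have eqI: "r = s" if "r \<in> homs ?C ?C" "s \<in> homs ?C ?C" "\<And>x. x \<in> carrier ?C \<Longrightarrow> r x = s x" for r s
    using that by (rule homs_eqI)
  have comm: "r \<otimes>\<^bsub>?E\<^esub> s = s \<otimes>\<^bsub>?E\<^esub> r" if "r \<in> homs ?C ?C" "s \<in> homs ?C ?C" for r s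
    using that by (intro eqI closed) (simp_all add: simps prufer_end_commute[OF p])
  have "comm_monoid ?E"
    by (intro comm_monoid.intro comm_monoid_axioms.intro E.monoid_axioms) (simp add: end_ring_simps(1) comm)
  then have "cring ?E" by (intro cring.intro E.ring_axioms)
  moreover have "\<one>\<^bsub>?E\<^esub> \<noteq> \<zero>\<^bsub>?E\<^esub>"
  proof
    assume "\<one>\<^bsub>?E\<^esub> = \<zero>\<^bsub>?E\<^esub>"
    then have "prufer_root p 1 = 1"
      using end_ring_simps(4,5)[OF prufer_root_closed[OF p, of 1]] by simp
    then show False
      using prufer_root_pow_eq_1_iff[OF p, of 1 1] prime by auto
  qed
  moreover have "r = \<zero>\<^bsub>?E\<^esub> \<or> s = \<zero>\<^bsub>?E\<^esub>"
    if rs: "r \<otimes>\<^bsub>?E\<^esub> s = \<zero>\<^bsub>?E\<^esub>" "r \<in> carrier ?E" "s \<in> carrier ?E" for r s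
  proof (rule disjCI)
    assume "s \<noteq> \<zero>\<^bsub>?E\<^esub>"
    have r: "r \<in> homs ?C ?C" and s: "s \<in> homs ?C ?C" using rs by (simp_all add: end_ring_simps)
    obtain x0 where x0: "x0 \<in> carrier ?C" "s x0 \<noteq> 1"
      using eqI[OF s closed(4)] \<open>s \<noteq> \<zero>\<^bsub>?E\<^esub>\<close> end_ring_simps(5) one_prufer by metis
    show "r = \<zero>\<^bsub>?E\<^esub>"
    proof (rule eqI[OF r closed(4)])
      fix y assume "y \<in> carrier ?C"
      then obtain x where x: "x \<in> carrier ?C" "s x = y"
        using prufer_end_surj[OF prime s x0] by blast
      have "r (s x) = \<zero>\<^bsub>?E\<^esub> x"
        using end_ring_simps(2)[OF x(1), of r s] rs(1) by simp
      then show "r y = \<zero>\<^bsub>?E\<^esub> y"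
        using x \<open>y \<in> carrier ?C\<close> by (simp add: end_ring_simps)
    qed
  qed
  ultimately show ?thesis
    by (intro domain.intro domain_axioms.intro)
qed

lemma prufer_power_endo:
  assumes "p > 0"
  shows "(\<lambda>x\<in>carrier (prufer_group p). x ^ k) \<in> homs (prufer_group p) (prufer_group p)"
proof -
  interpret C: comm_group "prufer_group p" by (rule comm_group_prufer[OF assms])
  show ?thesis
  proof (rule homsI[OF _ _ C.is_group])
    fix x assume "x \<in> carrier (prufer_group p)"
    then show "x ^ k \<in> carrier (prufer_group p)"
      using C.nat_pow_closed[of x k] by simp
  qed (simp add: power_mult_distrib)
qed

text \<open>Reduction modulo \<open>p\<close> is restriction to the subgroup of order
  \<open>p\<close> generated by \<open>?z\<close>, on which every endomorphism is a power map with
  exponent unique modulo \<open>p\<close>.\<close>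

lemma cover_coefficient_ring_end_prufer:
  assumes prime: "prime p"
  shows "cover_coefficient_ring p (end_ring (prufer_group p))"
proof -
  let ?C = "prufer_group p"
  let ?E = "end_ring ?C"
  let ?z = "prufer_root p 1"
  have p: "p > 0" using prime by (simp add: prime_gt_0_nat)
  have C: "comm_group ?C" by (rule comm_group_prufer[OF p])
  interpret C: comm_group ?C by fact
  interpret E: domain ?E by (rule domain_end_prufer[OF prime])
  have z: "?z \<in> carrier ?C" by (rule prufer_root_closed[OF p])
  have z_pow: "?z ^ k = 1 \<longleftrightarrow> p dvd k" for k
    using prufer_root_pow_eq_1_iff[OF p, of 1 k] by simp
  have z_mod: "?z ^ (k mod p) = ?z ^ k" for k
  proof -
    have "?z ^ k = ?z ^ (p * (k div p) + k mod p)" by simp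
    also have "\<dots> = ?z ^ (k mod p)"
      unfolding power_add[of ?z "p * (k div p)"] power_mult using z_pow[of p] by simp
    finally show ?thesis by simp
  qed
  have z_inj: "k = l" if "k < p" "l < p" "?z ^ k = ?z ^ l" for k l
  proof -
    have *: "k = l" if kl: "k < p" "l < p" "?z ^ k = ?z ^ l" "k \<le> l" for k l
    proof -
      have "?z ^ l = ?z ^ k * ?z ^ (l - k)" using power_add[of ?z k "l - k"] kl(4) by simp
      then have "?z ^ (l - k) = 1"
        using kl prufer_nonzero[OF p z] by simp
      then have "p dvd l - k" using z_pow by simp
      then have "l - k = 0"
        using nat_dvd_not_less[of "l - k" p] kl(2) by linarith
      then show ?thesis using kl(4) by simp
    qed
    show ?thesis using that *[of k l] *[of l k] by (cases "k \<le> l") auto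
  qed
  \<comment> \<open>The exponent by which \<open>r\<close> acts on \<open>?z\<close>, reduced to its
    least representative. By \<open>h_eq\<close> any exponent may be used to compute it, so sums and
    products of endomorphisms become sums and products of exponents.\<close>
  define h where "h r = (THE k. k < p \<and> r ?z = ?z ^ k)" for r :: "complex \<Rightarrow> complex"
  have h_eq: "h r = k mod p" if "r ?z = ?z ^ k" for r k
    unfolding h_def
  proof (rule the_equality)
    show "k mod p < p \<and> r ?z = ?z ^ (k mod p)" using that p z_mod by simp
    show "l = k mod p" if "l < p \<and> r ?z = ?z ^ l" for l
      using that \<open>r ?z = ?z ^ k\<close> p z_mod by (intro z_inj) simp_all
  qed
  have h_ex: "\<exists>k. r ?z = ?z ^ k" if r: "r \<in> homs ?C ?C" for r
  proof -
    obtain k where k: "\<And>x. x ^ (p ^ 1) = 1 \<Longrightarrow> r x = x ^ k"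
      using prufer_end_level[OF p r, of 1] by metis
    then show ?thesis using z_pow[of p] by auto
  qed
  show ?thesis
  proof (rule cover_coefficient_ringI[OF prime E.domain_axioms])
    fix n :: nat assume n: "0 < n"
    show "[n] \<cdot>\<^bsub>?E\<^esub> \<one>\<^bsub>?E\<^esub> \<noteq> \<zero>\<^bsub>?E\<^esub>"
    proof
      assume eq: "[n] \<cdot>\<^bsub>?E\<^esub> \<one>\<^bsub>?E\<^esub> = \<zero>\<^bsub>?E\<^esub>"
      \<comment> \<open>Level \<open>n\<close> suffices to refute n * 1 = 0: the root there has
        order p^n, which exceeds \<open>n\<close>.\<close>
      have r: "prufer_root p n \<in> carrier ?C" by (rule prufer_root_closed[OF p])
      have "prufer_root p n ^ n = 1"
        using end_ring_nat_apply[OF C end_ring_closed(3)[OF C] r, of n] eq r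
        by (simp add: end_ring_simps)
      then have "p ^ n dvd n"
        using prufer_root_pow_eq_1_iff[OF p] by blast
      then have "p ^ n \<le> n" using n by (simp add: dvd_imp_le)
      moreover have "n < p ^ n" by (rule power_gt_expt[OF prime_gt_Suc_0_nat[OF prime]])
      ultimately show False by simp
    qed
  next
    show "(\<lambda>r. int (h r)) \<in> ring_hom ?E (prime_field p)"
    proof (rule ring_hom_memI)
      fix r assume "r \<in> carrier ?E"
      then have r: "r \<in> homs ?C ?C" by (simp add: end_ring_simps)
      then obtain k where k: "r ?z = ?z ^ k" using h_ex by blast
      show "int (h r) \<in> carrier (prime_field p)"
        using h_eq[of r k, OF k] p by (simp add: prime_field_simps)
      fix s assume "s \<in> carrier ?E"
      then have s: "s \<in> homs ?C ?C" by (simp add: end_ring_simps)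
      then obtain l where l: "s ?z = ?z ^ l" using h_ex by blast
      have "(r \<oplus>\<^bsub>?E\<^esub> s) ?z = ?z ^ (k + l)"
        using z k l by (simp add: end_ring_simps power_add)
      from h_eq[of "r \<oplus>\<^bsub>?E\<^esub> s" "k + l", OF this] show "int (h (r \<oplus>\<^bsub>?E\<^esub> s)) = int (h r) \<oplus>\<^bsub>prime_field p\<^esub> int (h s)"
        using h_eq[of r k, OF k] h_eq[of s l, OF l] by (simp add: prime_field_simps zmod_int mod_simps)
      have "r (?z ^ l) = (?z ^ k) ^ l"
        using homs_pow[OF C.is_group C.is_group r z, of l] k by simp
      then have "(r \<otimes>\<^bsub>?E\<^esub> s) ?z = ?z ^ (k * l)"
        using z l by (simp add: end_ring_simps power_mult)
      from h_eq[of "r \<otimes>\<^bsub>?E\<^esub> s" "k * l", OF this] show "int (h (r \<otimes>\<^bsub>?E\<^esub> s)) = int (h r) \<otimes>\<^bsub>prime_field p\<^esub> int (h s)"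
        using h_eq[of r k, OF k] h_eq[of s l, OF l] by (simp add: prime_field_simps zmod_int mod_simps)
    next
      have "\<one>\<^bsub>?E\<^esub> ?z = ?z ^ 1" using z by (simp add: end_ring_simps)
      from h_eq[of "\<one>\<^bsub>?E\<^esub>" 1, OF this] show "int (h \<one>\<^bsub>?E\<^esub>) = \<one>\<^bsub>prime_field p\<^esub>"
        using prime_gt_1_nat[OF prime] by (simp add: prime_field_simps)
    qed
    show "(\<lambda>r. int (h r)) ` carrier ?E = carrier (prime_field p)"
    proof (intro equalityI subsetI)
      fix k assume "k \<in> (\<lambda>r. int (h r)) ` carrier ?E"
      then obtain r where r: "r \<in> homs ?C ?C" "k = int (h r)" by (auto simp: end_ring_simps)
      then obtain l where "r ?z = ?z ^ l" using h_ex by blast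
      from h_eq[of r l, OF this] show "k \<in> carrier (prime_field p)"
        using r(2) p by (simp add: prime_field_simps)
    next
      fix k assume "k \<in> carrier (prime_field p)"
      then obtain n where n: "k = int n" "n < p"
        by (auto simp: prime_field_simps elim: nonneg_int_cases)
      let ?r = "\<lambda>x\<in>carrier ?C. x ^ n"
      have "?r \<in> carrier ?E"
        using prufer_power_endo[OF p, of n] by (simp add: end_ring_simps)
      moreover have "k = int (h ?r)"
        using h_eq[of ?r n] z n by simp
      ultimately show "k \<in> (\<lambda>r. int (h r)) ` carrier ?E" by blast
    qed
  next
    fix r assume "r \<in> carrier ?E"
    then have r: "r \<in> homs ?C ?C" by (simp add: end_ring_simps)
    then obtain k where k: "r ?z = ?z ^ k" using h_ex by blast
    have "int (h r) = 0 \<longleftrightarrow> r ?z = 1"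
      unfolding h_eq[of r k, OF k] k z_pow by (simp add: dvd_eq_mod_eq_0)
    also have "\<dots> \<longleftrightarrow> (\<exists>s\<in>carrier ?E. r = [p] \<cdot>\<^bsub>?E\<^esub> s)"
    proof
      assume "r ?z = 1"
      then obtain g where g: "g \<in> homs ?C ?C" "\<And>x. x \<in> carrier ?C \<Longrightarrow> r x = g x [^]\<^bsub>?C\<^esub> p"
        using prufer_hom_divisible[OF p C r] one_prufer by metis
      have "[p] \<cdot>\<^bsub>?E\<^esub> g \<in> homs ?C ?C"
        using E.add.nat_pow_closed[of g p] g(1) by (simp add: end_ring_simps)
      then have "r = [p] \<cdot>\<^bsub>?E\<^esub> g"
        using g by (intro homs_eqI[OF r]) (simp_all add: end_ring_nat_apply[OF C])
      then show "\<exists>s\<in>carrier ?E. r = [p] \<cdot>\<^bsub>?E\<^esub> s" using g(1) by (auto simp: end_ring_simps)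
    next
      assume "\<exists>s\<in>carrier ?E. r = [p] \<cdot>\<^bsub>?E\<^esub> s"
      then obtain s where "s \<in> homs ?C ?C" "r = [p] \<cdot>\<^bsub>?E\<^esub> s" by (auto simp: end_ring_simps)
      then show "r ?z = 1"
        using prufer_hom_root_eq_one[OF p C, of s] z by (simp add: end_ring_nat_apply[OF C])
    qed
    finally show "int (h r) = 0 \<longleftrightarrow> (\<exists>s\<in>carrier ?E. r = [p] \<cdot>\<^bsub>?E\<^esub> s)" .
  qed
qed

section \<open>Encoded homomorphism modules\<close>

text \<open>
  \<open>Hom(G, A)\<close> as a module over \<open>End G\<close>, with both carriers moved to arbitrary types by injections \<open>i\<close>
  and \<open>j\<close>.
\<close>

definition coded_hom_module ::
  "(('g \<Rightarrow> 'g) \<Rightarrow> 'r) \<Rightarrow> (('g \<Rightarrow> 'a) \<Rightarrow> 'm) \<Rightarrow> ('g, 'k) monoid_scheme \<Rightarrow> ('a, 'l) monoid_scheme \<Rightarrow> ('r, 'm) module"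
  where "coded_hom_module i j G A =
    (let d = inv_into (homs G A) j in
    \<lparr>carrier = j ` homs G A, monoid.mult = (\<lambda>x y. undefined), one = undefined,
     ring.zero = j (\<lambda>x\<in>carrier G. \<one>\<^bsub>A\<^esub>),
     ring.add = (\<lambda>m n. j (\<lambda>x\<in>carrier G. d m x \<otimes>\<^bsub>A\<^esub> d n x)),
     smult = (\<lambda>r m. j (compose (carrier G) (d m) (inv_into (homs G G) i r)))\<rparr>)"

text \<open>Precomposition is a right action of End G. The assumption \<open>comm\<close> makes it a
  left action and makes the coefficient ring commutative, as \<open>module\<close> requires.\<close>

locale coded_homs =
  fixes i :: "('g \<Rightarrow> 'g) \<Rightarrow> 'r" and j :: "('g \<Rightarrow> 'a) \<Rightarrow> 'm"
    and G :: "('g, 'k) monoid_scheme" and A :: "('a, 'l) monoid_scheme"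
  assumes G: "comm_group G" and A: "comm_group A"
    and comm: "\<And>r s x. r \<in> homs G G \<Longrightarrow> s \<in> homs G G \<Longrightarrow> x \<in> carrier G \<Longrightarrow> r (s x) = s (r x)"
    and inj_i: "inj_on i (homs G G)" and inj_j: "inj_on j (homs G A)"
begin

interpretation G: comm_group G by (rule G)
interpretation A: comm_group A by (rule A)

abbreviation "R \<equiv> image_ring i (end_ring G)"
abbreviation "M \<equiv> coded_hom_module i j G A"
abbreviation dec_end :: "'r \<Rightarrow> 'g \<Rightarrow> 'g" where "dec_end \<equiv> inv_into (homs G G) i"
abbreviation dec :: "'m \<Rightarrow> 'g \<Rightarrow> 'a" where "dec \<equiv> inv_into (homs G A) j"

lemma carrier_R: "carrier R = i ` homs G G"
  by (simp add: image_ring_carrier end_ring_simps)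

lemma carrier_M: "carrier M = j ` homs G A"
  by (simp add: coded_hom_module_def Let_def)

lemma dec_end_homs: "r \<in> carrier R \<Longrightarrow> dec_end r \<in> homs G G"
  unfolding carrier_R by (rule inv_into_into)

lemma dec_homs: "m \<in> carrier M \<Longrightarrow> dec m \<in> homs G A"
  unfolding carrier_M by (rule inv_into_into)

lemma enc_closed: "f \<in> homs G A \<Longrightarrow> j f \<in> carrier M"
  unfolding carrier_M by (rule imageI)

lemma dec_enc: "f \<in> homs G A \<Longrightarrow> dec (j f) = f"
  using inj_j by simp

lemma dec_end_enc: "r \<in> homs G G \<Longrightarrow> dec_end (i r) = r"
  using inj_i by simp

lemma M_eqI:
  assumes "m \<in> carrier M" "n \<in> carrier M" "\<And>x. x \<in> carrier G \<Longrightarrow> dec m x = dec n x"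
  shows "m = n"
proof -
  have "dec m = dec n"
    using dec_homs[OF assms(1)] dec_homs[OF assms(2)] assms(3) by (rule homs_eqI)
  then show ?thesis
    using assms(1,2) unfolding carrier_M by (metis f_inv_into_f)
qed

lemma R_eqI:
  assumes "r \<in> carrier R" "s \<in> carrier R" "\<And>x. x \<in> carrier G \<Longrightarrow> dec_end r x = dec_end s x"
  shows "r = s"
proof -
  have "dec_end r = dec_end s"
    using dec_end_homs[OF assms(1)] dec_end_homs[OF assms(2)] assms(3) by (rule homs_eqI)
  then show ?thesis
    using assms(1,2) unfolding carrier_R by (metis f_inv_into_f)
qed

lemma dec_closed: "m \<in> carrier M \<Longrightarrow> x \<in> carrier G \<Longrightarrow> dec m x \<in> carrier A"
  using dec_homs homs_closed by metis

lemma dec_end_closed: "r \<in> carrier R \<Longrightarrow> x \<in> carrier G \<Longrightarrow> dec_end r x \<in> carrier G"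
  using dec_end_homs homs_closed by metis

lemma M_closed:
  shows "m \<in> carrier M \<Longrightarrow> n \<in> carrier M \<Longrightarrow> m \<oplus>\<^bsub>M\<^esub> n \<in> carrier M"
    and "\<zero>\<^bsub>M\<^esub> \<in> carrier M"
    and "r \<in> carrier R \<Longrightarrow> m \<in> carrier M \<Longrightarrow> r \<odot>\<^bsub>M\<^esub> m \<in> carrier M"
proof -
  show "m \<oplus>\<^bsub>M\<^esub> n \<in> carrier M" if "m \<in> carrier M" "n \<in> carrier M"
    using enc_closed[OF homs_times[OF G.is_group A dec_homs[OF that(1)] dec_homs[OF that(2)]]]
    by (simp add: coded_hom_module_def Let_def)
  show "\<zero>\<^bsub>M\<^esub> \<in> carrier M"
    using enc_closed[OF homs_const[OF G.is_group A.is_group]]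
    by (simp add: coded_hom_module_def Let_def)
  show "r \<odot>\<^bsub>M\<^esub> m \<in> carrier M" if "r \<in> carrier R" "m \<in> carrier M"
    using enc_closed[OF homs_compose[OF G.is_group dec_homs[OF that(2)] dec_end_homs[OF that(1)]]]
    by (simp add: coded_hom_module_def Let_def)
qed

lemma dec_add:
  assumes "m \<in> carrier M" "n \<in> carrier M" "x \<in> carrier G"
  shows "dec (m \<oplus>\<^bsub>M\<^esub> n) x = dec m x \<otimes>\<^bsub>A\<^esub> dec n x"
  using dec_enc[OF homs_times[OF G.is_group A dec_homs[OF assms(1)] dec_homs[OF assms(2)]]] assms(3)
  by (simp add: coded_hom_module_def Let_def)

lemma dec_zero: "x \<in> carrier G \<Longrightarrow> dec \<zero>\<^bsub>M\<^esub> x = \<one>\<^bsub>A\<^esub>"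
  using dec_enc[OF homs_const[OF G.is_group A.is_group]]
  by (simp add: coded_hom_module_def Let_def)

lemma dec_smult:
  assumes "r \<in> carrier R" "m \<in> carrier M" "x \<in> carrier G"
  shows "dec (r \<odot>\<^bsub>M\<^esub> m) x = dec m (dec_end r x)"
  using dec_enc[OF homs_compose[OF G.is_group dec_homs[OF assms(2)] dec_end_homs[OF assms(1)]]] assms(3)
  by (simp add: coded_hom_module_def Let_def compose_eq)

lemma ring_R: "ring R"
  using inj_i by (intro ring.inj_imp_image_ring_is_ring ring_end_ring[OF G]) (simp add: end_ring_simps)

lemma dec_end_apply:
  shows "r \<in> carrier R \<Longrightarrow> s \<in> carrier R \<Longrightarrow> x \<in> carrier G \<Longrightarrow> dec_end (r \<otimes>\<^bsub>R\<^esub> s) x = dec_end r (dec_end s x)"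
    and "r \<in> carrier R \<Longrightarrow> s \<in> carrier R \<Longrightarrow> x \<in> carrier G \<Longrightarrow> dec_end (r \<oplus>\<^bsub>R\<^esub> s) x = dec_end r x \<otimes>\<^bsub>G\<^esub> dec_end s x"
    and "x \<in> carrier G \<Longrightarrow> dec_end \<one>\<^bsub>R\<^esub> x = x"
    and "x \<in> carrier G \<Longrightarrow> dec_end \<zero>\<^bsub>R\<^esub> x = \<one>\<^bsub>G\<^esub>"
proof -
  have c: "carrier (end_ring G) = homs G G" by (simp add: end_ring_simps)
  fix r s x assume r: "r \<in> carrier R" and s: "s \<in> carrier R" and x: "x \<in> carrier G"
  show "dec_end (r \<otimes>\<^bsub>R\<^esub> s) x = dec_end r (dec_end s x)"
    using dec_end_enc[OF end_ring_closed(1)[OF G dec_end_homs[OF r] dec_end_homs[OF s]]] end_ring_simps(2)[OF x]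
    by (simp add: image_ring_def image_group_def monoid.defs c)
  show "dec_end (r \<oplus>\<^bsub>R\<^esub> s) x = dec_end r x \<otimes>\<^bsub>G\<^esub> dec_end s x"
    using dec_end_enc[OF end_ring_closed(2)[OF G dec_end_homs[OF r] dec_end_homs[OF s]]] end_ring_simps(3)[OF x]
    by (simp add: image_ring_def image_group_def monoid.defs c)
next
  fix x assume x: "x \<in> carrier G"
  show "dec_end \<one>\<^bsub>R\<^esub> x = x" "dec_end \<zero>\<^bsub>R\<^esub> x = \<one>\<^bsub>G\<^esub>"
    using dec_end_enc[OF end_ring_closed(3)[OF G]] dec_end_enc[OF end_ring_closed(4)[OF G]]
      end_ring_simps(4,5)[OF x]
    by (simp_all add: image_ring_one image_ring_zero)
qed

lemma cring_R: "cring R"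
proof -
  interpret R: ring R by (rule ring_R)
  have "comm_monoid R"
  proof (intro comm_monoid.intro comm_monoid_axioms.intro R.monoid_axioms)
    fix r s assume "r \<in> carrier R" "s \<in> carrier R"
    then show "r \<otimes>\<^bsub>R\<^esub> s = s \<otimes>\<^bsub>R\<^esub> r"
      by (intro R_eqI R.m_closed) (simp_all add: dec_end_apply comm dec_end_homs)
  qed
  then show ?thesis by (intro cring.intro R.ring_axioms)
qed

lemma module_M: "module R M"
proof (rule moduleI[OF cring_R])
  interpret R: cring R by (rule cring_R)
  show "abelian_group M"
  proof (rule abelian_groupI)
    fix m assume m: "m \<in> carrier M"
    let ?n = "j (\<lambda>x\<in>carrier G. inv\<^bsub>A\<^esub> dec m x)"
    have h: "(\<lambda>x\<in>carrier G. inv\<^bsub>A\<^esub> dec m x) \<in> homs G A"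
      by (rule homs_inv[OF G.is_group A dec_homs[OF m]])
    then have n: "?n \<in> carrier M" by (rule enc_closed)
    have "?n \<oplus>\<^bsub>M\<^esub> m = \<zero>\<^bsub>M\<^esub>"
      using m n by (intro M_eqI M_closed) (simp_all add: dec_add dec_zero dec_enc[OF h] dec_closed A.l_inv)
    then show "\<exists>n\<in>carrier M. n \<oplus>\<^bsub>M\<^esub> m = \<zero>\<^bsub>M\<^esub>" using n by blast
  next
    fix m n k assume "m \<in> carrier M" "n \<in> carrier M" "k \<in> carrier M"
    then show "m \<oplus>\<^bsub>M\<^esub> n \<oplus>\<^bsub>M\<^esub> k = m \<oplus>\<^bsub>M\<^esub> (n \<oplus>\<^bsub>M\<^esub> k)"
      by (intro M_eqI M_closed) (simp_all add: dec_add dec_closed M_closed A.m_assoc)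
  next
    fix m n assume "m \<in> carrier M" "n \<in> carrier M"
    then show "m \<oplus>\<^bsub>M\<^esub> n = n \<oplus>\<^bsub>M\<^esub> m"
      by (intro M_eqI M_closed) (simp_all add: dec_add dec_closed A.m_comm)
  next
    fix m assume "m \<in> carrier M"
    then show "\<zero>\<^bsub>M\<^esub> \<oplus>\<^bsub>M\<^esub> m = m"
      by (intro M_eqI M_closed) (simp_all add: dec_add dec_closed dec_zero M_closed)
  qed (simp_all add: M_closed)
  show "\<one>\<^bsub>R\<^esub> \<odot>\<^bsub>M\<^esub> m = m" if "m \<in> carrier M" for m
    using that by (intro M_eqI M_closed) (simp_all add: dec_smult dec_end_apply)
  fix r s m n assume r: "r \<in> carrier R" and m: "m \<in> carrier M"
  show "r \<odot>\<^bsub>M\<^esub> m \<in> carrier M" using r m by (rule M_closed)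
  show "(r \<oplus>\<^bsub>R\<^esub> s) \<odot>\<^bsub>M\<^esub> m = r \<odot>\<^bsub>M\<^esub> m \<oplus>\<^bsub>M\<^esub> s \<odot>\<^bsub>M\<^esub> m" if s: "s \<in> carrier R"
    using r s m by (intro M_eqI M_closed R.a_closed)
      (simp_all add: dec_smult dec_add dec_end_apply dec_end_closed M_closed homs_mult[OF dec_homs])
  show "(r \<otimes>\<^bsub>R\<^esub> s) \<odot>\<^bsub>M\<^esub> m = r \<odot>\<^bsub>M\<^esub> (s \<odot>\<^bsub>M\<^esub> m)" if s: "s \<in> carrier R"
    using r s m by (intro M_eqI M_closed R.m_closed)
      (simp_all add: dec_smult dec_end_apply dec_end_closed M_closed comm dec_end_homs)
  show "r \<odot>\<^bsub>M\<^esub> (m \<oplus>\<^bsub>M\<^esub> n) = r \<odot>\<^bsub>M\<^esub> m \<oplus>\<^bsub>M\<^esub> r \<odot>\<^bsub>M\<^esub> n" if n: "n \<in> carrier M"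
    using r m n by (intro M_eqI M_closed)
      (simp_all add: dec_smult dec_add dec_end_closed M_closed)
qed

text \<open>Postcomposition with \<open>\<alpha>\<close>, seen through the coding \<open>j\<close>;
  it is restricted to the carrier because \<open>BijGroup\<close> consists of extensional
  maps.\<close>

definition act :: "('a \<Rightarrow> 'a) \<Rightarrow> 'm \<Rightarrow> 'm" where
  "act \<alpha> = (\<lambda>m\<in>carrier M. j (compose (carrier G) \<alpha> (dec m)))"

lemma post_compose: "\<alpha> \<in> hom A A \<Longrightarrow> f \<in> homs G A \<Longrightarrow> compose (carrier G) \<alpha> f \<in> homs G A"
  unfolding compose_def
  by (intro homsI[OF _ _ G.is_group]) (auto simp: homs_closed homs_mult hom_def)

lemma act_closed: "\<alpha> \<in> hom A A \<Longrightarrow> m \<in> carrier M \<Longrightarrow> act \<alpha> m \<in> carrier M"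
  unfolding act_def by (simp add: enc_closed post_compose dec_homs)

lemma dec_act: "\<alpha> \<in> hom A A \<Longrightarrow> m \<in> carrier M \<Longrightarrow> x \<in> carrier G \<Longrightarrow> dec (act \<alpha> m) x = \<alpha> (dec m x)"
  unfolding act_def by (simp add: dec_enc post_compose dec_homs compose_eq)

text \<open>Postcomposition commutes with precomposition, hence the action of \<open>H\<close> is
  linear over the coefficient ring; it respects addition because each \<open>\<phi> h\<close> is an
  endomorphism of \<open>A\<close>.\<close>

lemma group_module_act:
  assumes "group H" and \<phi>: "\<phi> \<in> hom H (AutoGroup A)"
  shows "group_module R H M (\<lambda>h. act (\<phi> h))"
proof -
  interpret H: group H by fact
  interpret \<phi>: group_hom H "AutoGroup A" \<phi>
    using \<phi> A.AutoGroup by (intro group_hom.intro H.is_group group_hom_axioms.intro)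
  have auto: "\<phi> h \<in> hom A A" "\<phi> h \<in> Bij (carrier A)" if "h \<in> carrier H" for h
    using \<phi>.hom_closed[OF that] by (simp_all add: AutoGroup_def auto_def)
  have mult: "\<phi> (h \<otimes>\<^bsub>H\<^esub> k) a = \<phi> h (\<phi> k a)" if "h \<in> carrier H" "k \<in> carrier H" "a \<in> carrier A" for h k a
    using \<phi>.hom_mult[OF that(1,2)] that(3) auto[OF that(1)] auto[OF that(2)]
    by (simp add: AutoGroup_def BijGroup_def compose_eq)
  have one: "\<phi> \<one>\<^bsub>H\<^esub> a = a" if "a \<in> carrier A" for a
    using \<phi>.hom_one that by (simp add: AutoGroup_def BijGroup_def)
  have comp: "act (\<phi> (h \<otimes>\<^bsub>H\<^esub> k)) m = act (\<phi> h) (act (\<phi> k) m)"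
    if "h \<in> carrier H" "k \<in> carrier H" "m \<in> carrier M" for h k m
    using that auto(1) by (intro M_eqI act_closed) (simp_all add: dec_act act_closed mult dec_closed del: \<phi>.hom_mult)
  have unit: "act (\<phi> \<one>\<^bsub>H\<^esub>) m = m" if "m \<in> carrier M" for m
    using that auto(1) by (intro M_eqI act_closed) (simp_all add: dec_act one dec_closed del: \<phi>.hom_one)
  have bij: "act (\<phi> h) \<in> Bij (carrier M)" if h: "h \<in> carrier H" for h
  proof -
    have "bij_betw (act (\<phi> h)) (carrier M) (carrier M)"
      using h comp[of "inv\<^bsub>H\<^esub> h" h] comp[of h "inv\<^bsub>H\<^esub> h"] act_closed auto(1)
      by (intro bij_betwI[of _ _ _ "act (\<phi> (inv\<^bsub>H\<^esub> h))"]) (simp_all add: unit del: \<phi>.hom_one \<phi>.hom_mult \<phi>.hom_inv)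
    then show ?thesis by (simp add: Bij_def act_def)
  qed
  have "(\<lambda>h. act (\<phi> h)) \<in> hom H (BijGroup (carrier M))"
  proof (rule homI)
    fix h assume h: "h \<in> carrier H"
    then show "act (\<phi> h) \<in> carrier (BijGroup (carrier M))"
      using bij by (simp add: BijGroup_def)
    fix k assume k: "k \<in> carrier H"
    have "act (\<phi> (h \<otimes>\<^bsub>H\<^esub> k)) = compose (carrier M) (act (\<phi> h)) (act (\<phi> k))"
      using h k comp by (intro extensionalityI[of _ "carrier M"]) (simp_all add: compose_eq act_def del: \<phi>.hom_mult)
    then show "act (\<phi> (h \<otimes>\<^bsub>H\<^esub> k)) = act (\<phi> h) \<otimes>\<^bsub>BijGroup (carrier M)\<^esub> act (\<phi> k)"
      using h k bij by (simp add: BijGroup_def del: \<phi>.hom_mult)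
  qed
  then have "group_action H (carrier M) (\<lambda>h. act (\<phi> h))"
    by (intro group_action.intro group_hom.intro H.is_group group_BijGroup group_hom_axioms.intro)
  moreover have "act (\<phi> h) \<in> module_hom R M M" if h: "h \<in> carrier H" for h
    unfolding module_hom_def mem_Collect_eq
  proof (intro conjI allI impI)
    show "act (\<phi> h) \<in> carrier M \<rightarrow> carrier M" using act_closed[OF auto(1)[OF h]] by blast
    have hm: "\<phi> h (a \<otimes>\<^bsub>A\<^esub> b) = \<phi> h a \<otimes>\<^bsub>A\<^esub> \<phi> h b" if "a \<in> carrier A" "b \<in> carrier A" for a b
      using auto(1)[OF h] that by (simp add: hom_def)
    show "act (\<phi> h) (m \<oplus>\<^bsub>M\<^esub> n) = act (\<phi> h) m \<oplus>\<^bsub>M\<^esub> act (\<phi> h) n"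
      if "m \<in> carrier M \<and> n \<in> carrier M" for m n
      using that auto(1)[OF h]
      by (intro M_eqI act_closed M_closed) (simp_all add: dec_act dec_add act_closed M_closed dec_closed hm)
    show "act (\<phi> h) (r \<odot>\<^bsub>M\<^esub> m) = r \<odot>\<^bsub>M\<^esub> act (\<phi> h) m"
      if "r \<in> carrier R \<and> m \<in> carrier M" for r m
      using that auto(1)[OF h]
      by (intro M_eqI act_closed M_closed) (simp_all add: dec_act dec_smult act_closed M_closed dec_end_closed)
  qed
  ultimately show ?thesis
    by (intro group_module.intro group_module_axioms.intro module_M)
qed

lemma dec_nat:
  assumes "m \<in> carrier M" "x \<in> carrier G"
  shows "dec ([n] \<cdot>\<^bsub>M\<^esub> m) x = dec m x [^]\<^bsub>A\<^esub> (n::nat)"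
proof -
  interpret M: module R M by (rule module_M)
  show ?thesis
    using assms by (induction n) (simp_all add: dec_zero dec_add)
qed

end

section \<open>From divisible hulls to integral covers\<close>

text \<open>A function is coded by its graph, a subset of a countable product and thus a set of
  natural numbers.\<close>

lemma PiE_countable_lepoll_reals:
  assumes "countable B" "countable D"
  shows "(B \<rightarrow>\<^sub>E D) \<lesssim> (UNIV :: real set)"
proof -
  define code where "code f = to_nat_on (B \<times> D) ` (\<lambda>x. (x, f x)) ` B" for f :: "'a \<Rightarrow> 'b"
  have inj: "inj_on (to_nat_on (B \<times> D)) (B \<times> D)"
    using assms by (intro inj_on_to_nat_on countable_SIGMA) auto
  have "inj_on code (B \<rightarrow>\<^sub>E D)"
  proof (rule inj_onI)
    fix f g assume f: "f \<in> B \<rightarrow>\<^sub>E D" and g: "g \<in> B \<rightarrow>\<^sub>E D" and eq: "code f = code g"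
    have sub: "(\<lambda>x. (x, f x)) ` B \<subseteq> B \<times> D" "(\<lambda>x. (x, g x)) ` B \<subseteq> B \<times> D"
      using PiE_mem[OF f] PiE_mem[OF g] by auto
    have graph: "(\<lambda>x. (x, f x)) ` B = (\<lambda>x. (x, g x)) ` B"
      using eq inj_on_image_eq_iff[OF inj sub] unfolding code_def by (rule iffD1[rotated])
    have "f x = g x" if "x \<in> B" for x
    proof -
      have "(x, f x) \<in> (\<lambda>x. (x, g x)) ` B" using that graph by blast
      then show ?thesis by auto
    qed
    then show "f = g" using f g by (intro PiE_ext) auto
  qed
  then have "(B \<rightarrow>\<^sub>E D) \<lesssim> (UNIV :: nat set set)"
    unfolding lepoll_def by blast
  then show ?thesis
    using nat_sets_eqpoll_reals eqpoll_imp_lepoll lepoll_trans by blast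
qed

lemma homs_embedding:
  assumes "countable (carrier G)" "countable (carrier A)" "(UNIV :: real set) \<lesssim> (UNIV :: 'c set)"
  obtains i :: "('g \<Rightarrow> 'a) \<Rightarrow> 'c" where "inj_on i (homs G A)"
proof -
  have "homs G A \<subseteq> carrier G \<rightarrow>\<^sub>E carrier A"
    by (auto simp: homs_def hom_def PiE_def)
  then have "homs G A \<lesssim> (UNIV :: 'c set)"
    using PiE_countable_lepoll_reals[OF assms(1,2)] assms(3)
    by (meson lepoll_trans subset_imp_lepoll)
  then show ?thesis using that by (auto simp: lepoll_def)
qed

lemma hom_finsum_finprod:
  assumes "abelian_group M" "comm_group G" and f: "f \<in> hom (add_monoid M) G"
    and "finite S" "g \<in> S \<rightarrow> carrier M"
  shows "f (finsum M g S) = finprod G (\<lambda>k. f (g k)) S"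
proof -
  interpret M: abelian_group M by fact
  interpret G: comm_group G by fact
  interpret f: group_hom "add_monoid M" G f
    using f by (intro group_hom.intro M.a_group G.is_group group_hom_axioms.intro)
  have fc: "f x \<in> carrier G" if "x \<in> carrier M" for x using f.hom_closed that by simp
  show ?thesis
    using assms(4,5)
  proof (induction S rule: finite_induct)
    case empty
    show ?case using f.hom_one by simp
  next
    case (insert k S)
    then have g: "g \<in> S \<rightarrow> carrier M" "g k \<in> carrier M" by auto
    then have "f (finsum M g (insert k S)) = f (g k) \<otimes>\<^bsub>G\<^esub> f (finsum M g S)"
      using insert.hyps f.hom_mult[of "g k" "finsum M g S"] by simp
    moreover have "finprod G (\<lambda>k. f (g k)) (insert k S) = f (g k) \<otimes>\<^bsub>G\<^esub> finprod G (\<lambda>k. f (g k)) S"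
      using insert.hyps fc[OF funcset_mem[OF insert.prems]] by (intro G.finprod_insert) auto
    ultimately show ?case using insert.IH g by simp
  qed
qed

text \<open>Hom(C, C^r) is the r-fold product of End C: the coordinate inclusions form a basis, and
  the coefficients of a homomorphism are its coordinates.\<close>

lemma free_module_of_rank_coded_homs:
  fixes A :: "'a monoid" and i :: "(complex \<Rightarrow> complex) \<Rightarrow> 'r" and j :: "(complex \<Rightarrow> 'a) \<Rightarrow> 'm"
  assumes prime: "prime p" and coded: "coded_homs i j (prufer_group p) A"
    and \<psi>: "\<psi> \<in> iso A (sum_group {..<r} (\<lambda>_. prufer_group p))"
  shows "free_module_of_rank (image_ring i (end_ring (prufer_group p))) (coded_hom_module i j (prufer_group p) A) r"
proof -
  let ?C = "prufer_group p"
  let ?D = "sum_group {..<r} (\<lambda>_. ?C)"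
  have p: "p > 0" using prime by (simp add: prime_gt_0_nat)
  interpret S: coded_homs i j ?C A by fact
  interpret C: comm_group ?C by (rule S.G)
  interpret A: comm_group A by (rule S.A)
  interpret D: comm_group ?D by (rule comm_group_sum_prufer[OF p])
  interpret M: module S.R S.M by (rule S.module_M)
  note carrD = carrier_sum_prufer[OF p, of r]
  interpret \<psi>: group_hom A ?D \<psi>
    using \<psi> by (intro group_hom.intro A.is_group D.is_group group_hom_axioms.intro) (simp add: iso_def)
  have \<psi>b: "bij_betw \<psi> (carrier A) (carrier ?D)" using \<psi> by (simp add: iso_def)
  have coord_closed: "\<psi> a l \<in> carrier ?C" if "a \<in> carrier A" "l < r" for a l
    using \<psi>.hom_closed[OF that(1)] that(2) unfolding carrD by (auto dest: PiE_mem)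
  have coord_mult: "\<psi> (a \<otimes>\<^bsub>A\<^esub> b) l = \<psi> a l \<otimes>\<^bsub>?C\<^esub> \<psi> b l" if "a \<in> carrier A" "b \<in> carrier A" "l < r" for a b l
    using \<psi>.hom_mult[OF that(1,2)] that(3) by simp
  have coord_one: "\<psi> \<one>\<^bsub>A\<^esub> l = 1" if "l < r" for l
    using \<psi>.hom_one that by simp
  have sep: "a = b" if ab: "a \<in> carrier A" "b \<in> carrier A" "\<And>l. l < r \<Longrightarrow> \<psi> a l = \<psi> b l" for a b
  proof -
    have "\<psi> a = \<psi> b"
      using \<psi>.hom_closed[OF ab(1)] \<psi>.hom_closed[OF ab(2)] ab(3) unfolding carrD
      by (intro PiE_ext[of _ "{..<r}" "\<lambda>_. carrier ?C"]) auto
    then show ?thesis using inj_onD[OF bij_betw_imp_inj_on[OF \<psi>b]] ab(1,2) by blast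
  qed
  \<comment> \<open>The inclusion of the \<open>k\<close>-th summand of C^r, transported to
    \<open>A\<close> by the inverse of \<open>\<psi>\<close>.\<close>
  define e where "e k = (\<lambda>x\<in>carrier ?C. inv_into (carrier A) \<psi> (\<lambda>l\<in>{..<r}. if l = k then x else 1))" for k
  have delta: "(\<lambda>l\<in>{..<r}. if l = k then x else 1) \<in> carrier ?D" if "x \<in> carrier ?C" for x k
    unfolding carrD using that C.one_closed by auto
  have e_closed: "e k x \<in> carrier A" if "x \<in> carrier ?C" for k x
    using bij_betwE[OF bij_betw_inv_into[OF \<psi>b]] delta[OF that] that by (simp add: e_def)
  have e_coord: "\<psi> (e k x) l = (if l = k then x else 1)" if "x \<in> carrier ?C" "l < r" for k x l
    using bij_betw_inv_into_right[OF \<psi>b delta[OF that(1)]] that by (simp add: e_def)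
  have e_homs: "e k \<in> homs ?C A" for k
  proof -
    have "(\<lambda>x\<in>carrier ?C. e k x) \<in> homs ?C A"
    proof (rule homsI[OF e_closed _ C.is_group])
      fix x y assume xy: "x \<in> carrier ?C" "y \<in> carrier ?C"
      then have "x \<otimes>\<^bsub>?C\<^esub> y \<in> carrier ?C" by (rule C.m_closed)
      then show "e k (x \<otimes>\<^bsub>?C\<^esub> y) = e k x \<otimes>\<^bsub>A\<^esub> e k y"
        using xy e_closed by (intro sep) (simp_all only: A.m_closed coord_mult e_coord, simp)
    qed
    moreover have "restrict (e k) (carrier ?C) = e k"
      by (rule extensional_restrict) (simp add: e_def)
    ultimately show ?thesis by (simp only:)
  qed
  define b where "b k = j (e k)" for k
  have b_closed: "b k \<in> carrier S.M" for k
    unfolding b_def by (rule S.enc_closed[OF e_homs])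
  have b_dec: "S.dec (b k) = e k" for k
    unfolding b_def by (rule S.dec_enc[OF e_homs])
  \<comment> \<open>Evaluating at \<open>x\<close> and taking coordinate \<open>l\<close> is
    additive in \<open>m\<close>. It therefore turns a linear combination of the basis into a
    product in C, in which only the factor with k = l differs from 1.\<close>
  have coord_hom: "(\<lambda>m. \<psi> (S.dec m x) l) \<in> hom (add_monoid S.M) ?C" if x: "x \<in> carrier ?C" and l: "l < r" for x l
    using x l by (intro homI) (simp_all only: monoid.simps partial_object.simps
        coord_closed S.dec_closed S.dec_add coord_mult)
  have coord_sum: "\<psi> (S.dec (\<Oplus>\<^bsub>S.M\<^esub>k\<in>{..<r}. c k \<odot>\<^bsub>S.M\<^esub> b k) x) l = S.dec_end (c l) x"
    if c: "c \<in> {..<r} \<rightarrow> carrier S.R" and x: "x \<in> carrier ?C" and l: "l < r" for c x l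
  proof -
    have ck: "c k \<in> carrier S.R" if "k < r" for k using c that by auto
    have ckx: "S.dec_end (c k) x \<in> carrier ?C" if "k < r" for k
      using S.dec_end_closed[OF ck[OF that] x] .
    have "\<psi> (S.dec (\<Oplus>\<^bsub>S.M\<^esub>k\<in>{..<r}. c k \<odot>\<^bsub>S.M\<^esub> b k) x) l =
        finprod ?C (\<lambda>k. \<psi> (S.dec (c k \<odot>\<^bsub>S.M\<^esub> b k) x) l) {..<r}"
      using ck b_closed by (intro hom_finsum_finprod[OF M.abelian_group_axioms S.G coord_hom[OF x l]]) auto
    also have "\<dots> = finprod ?C (\<lambda>k. if l = k then S.dec_end (c k) x else \<one>\<^bsub>?C\<^esub>) {..<r}"
      using ckx l C.one_closed by (intro C.finprod_cong') (auto simp: S.dec_smult[OF ck b_closed x] b_dec e_coord)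
    also have "\<dots> = S.dec_end (c l) x"
      using ckx l by (intro C.finprod_singleton) auto
    finally show ?thesis .
  qed
  show ?thesis
  proof (rule free_module_of_rankI[OF S.module_M])
    show "b \<in> {..<r} \<rightarrow> carrier S.M" using b_closed by blast
    show "inj_on b {..<r}"
    proof (rule inj_onI, rule ccontr)
      fix k l assume kl: "k \<in> {..<r}" "l \<in> {..<r}" "b k = b l" "k \<noteq> l"
      \<comment> \<open>A nontrivial element of C is needed to tell the inclusions apart: coordinate
        \<open>k\<close> of \<open>e k\<close> is the identity of C and that of \<open>e l\<close>
        is trivial.\<close>
      have z: "prufer_root p 1 \<in> carrier ?C" by (rule prufer_root_closed[OF p])
      have "e k = e l" using kl(3) b_dec by metis
      then have "prufer_root p 1 = 1"
        using e_coord[OF z, of k k] e_coord[OF z, of k l] kl by simp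
      then show False
        using prufer_root_pow_eq_1_iff[OF p, of 1 1] prime by auto
    qed
  next
    fix m assume m: "m \<in> carrier S.M"
    define c where "c k = i (\<lambda>x\<in>carrier ?C. \<psi> (S.dec m x) k)" for k
    have ch: "(\<lambda>x\<in>carrier ?C. \<psi> (S.dec m x) k) \<in> homs ?C ?C" if "k < r" for k
    proof (rule homsI[OF _ _ C.is_group])
      fix x y assume x: "x \<in> carrier ?C" and y: "y \<in> carrier ?C"
      show "\<psi> (S.dec m x) k \<in> carrier ?C" using coord_closed[OF S.dec_closed[OF m x] that] .
      show "\<psi> (S.dec m (x \<otimes>\<^bsub>?C\<^esub> y)) k = \<psi> (S.dec m x) k \<otimes>\<^bsub>?C\<^esub> \<psi> (S.dec m y) k"
        using coord_mult[OF S.dec_closed[OF m x] S.dec_closed[OF m y] that] homs_mult[OF S.dec_homs[OF m] x y]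
        by simp
    qed
    have c_dec: "S.dec_end (c k) = (\<lambda>x\<in>carrier ?C. \<psi> (S.dec m x) k)" if "k < r" for k
      unfolding c_def by (rule S.dec_end_enc[OF ch[OF that]])
    have c: "c \<in> {..<r} \<rightarrow> carrier S.R"
      using ch by (auto simp: c_def S.carrier_R)
    have sum: "(\<Oplus>\<^bsub>S.M\<^esub>k\<in>{..<r}. c k \<odot>\<^bsub>S.M\<^esub> b k) \<in> carrier S.M"
      using c b_closed by (intro M.M.finsum_closed) auto
    have "m = (\<Oplus>\<^bsub>S.M\<^esub>k\<in>{..<r}. c k \<odot>\<^bsub>S.M\<^esub> b k)"
    proof (rule S.M_eqI[OF m sum], rule sep)
      fix x assume x: "x \<in> carrier ?C"
      show "S.dec m x \<in> carrier A" "S.dec (\<Oplus>\<^bsub>S.M\<^esub>k\<in>{..<r}. c k \<odot>\<^bsub>S.M\<^esub> b k) x \<in> carrier A"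
        using S.dec_closed[OF m x] S.dec_closed[OF sum x] .
      fix l assume l: "l < r"
      show "\<psi> (S.dec m x) l = \<psi> (S.dec (\<Oplus>\<^bsub>S.M\<^esub>k\<in>{..<r}. c k \<odot>\<^bsub>S.M\<^esub> b k) x) l"
        unfolding coord_sum[OF c x l] c_dec[OF l] using x by simp
    qed
    then show "\<exists>c\<in>{..<r} \<rightarrow> carrier S.R. m = (\<Oplus>\<^bsub>S.M\<^esub>k\<in>{..<r}. c k \<odot>\<^bsub>S.M\<^esub> b k)"
      using c by (rule bexI)
  next
    fix c l assume c: "c \<in> {..<r} \<rightarrow> carrier S.R" and l: "l < r"
      and zero: "(\<Oplus>\<^bsub>S.M\<^esub>k\<in>{..<r}. c k \<odot>\<^bsub>S.M\<^esub> b k) = \<zero>\<^bsub>S.M\<^esub>"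
    show "c l = \<zero>\<^bsub>S.R\<^esub>"
    proof (rule S.R_eqI)
      show "c l \<in> carrier S.R" using c l by auto
      show "\<zero>\<^bsub>S.R\<^esub> \<in> carrier S.R" by simp
      fix x assume x: "x \<in> carrier ?C"
      have "S.dec_end (c l) x = \<psi> (S.dec \<zero>\<^bsub>S.M\<^esub> x) l"
        using coord_sum[OF c x l] unfolding zero by simp
      then show "S.dec_end (c l) x = S.dec_end \<zero>\<^bsub>S.R\<^esub> x"
        unfolding S.dec_zero[OF x] S.dec_end_apply(4)[OF x] coord_one[OF l] by simp
    qed
  qed
qed

text \<open>In the coordinates of C^r a torsion element is a family of powers of
  \<open>prufer_root p 1\<close>. Raising an arbitrary x in C to the same exponents is a
  homomorphism to C^r taking that root to the given element.\<close>

lemma prufer_hom_through_torsion: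
  assumes p: "p > 0" and A: "comm_group A" and \<psi>: "\<psi> \<in> iso A (sum_group {..<r::nat} (\<lambda>_. prufer_group p))"
    and a: "a \<in> carrier A" "a [^]\<^bsub>A\<^esub> p = \<one>\<^bsub>A\<^esub>"
  obtains f where "f \<in> homs (prufer_group p) A" "f (prufer_root p 1) = a"
proof -
  let ?C = "prufer_group p"
  let ?D = "sum_group {..<r} (\<lambda>_. ?C)"
  interpret C: comm_group ?C by (rule comm_group_prufer[OF p])
  interpret D: comm_group ?D by (rule comm_group_sum_prufer[OF p])
  interpret A: comm_group A by fact
  note carrD = carrier_sum_prufer[OF p, of r]
  have inv: "inv_into (carrier A) \<psi> \<in> iso ?D A" by (rule A.iso_set_sym[OF \<psi>])
  interpret \<psi>: group_hom A ?D \<psi>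
    using \<psi> by (intro group_hom.intro A.is_group D.is_group group_hom_axioms.intro) (simp add: iso_def)
  interpret inv: group_hom ?D A "inv_into (carrier A) \<psi>"
    using inv by (intro group_hom.intro A.is_group D.is_group group_hom_axioms.intro) (simp add: iso_def)
  have D_pow: "(d [^]\<^bsub>?D\<^esub> n) l = d l ^ n" if "d \<in> carrier ?D" "l < r" for d l and n :: nat
    using that by (induction n) (simp_all add: mult.commute)
  have "\<psi> a l ^ (p ^ 1) = 1" if "l < r" for l
  proof -
    have "\<psi> a [^]\<^bsub>?D\<^esub> p = \<one>\<^bsub>?D\<^esub>"
      using \<psi>.hom_nat_pow[OF a(1), of p] a(2) \<psi>.hom_one by metis
    then show ?thesis using D_pow[OF \<psi>.hom_closed[OF a(1)] that, of p] that by simp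
  qed
  then have "\<exists>k. \<psi> a l = prufer_root p 1 ^ k" if "l < r" for l
    using prufer_root_generates[OF p] that by metis
  then obtain k where k: "\<And>l. l < r \<Longrightarrow> \<psi> a l = prufer_root p 1 ^ k l" by metis
  let ?d = "\<lambda>x. \<lambda>l\<in>{..<r}. x ^ k l"
  have d: "?d x \<in> carrier ?D" if "x \<in> carrier ?C" for x
    unfolding carrD using C.nat_pow_closed[OF that] by auto
  let ?f = "\<lambda>x\<in>carrier ?C. inv_into (carrier A) \<psi> (?d x)"
  have "?f \<in> homs ?C A"
  proof (rule homsI[OF _ _ C.is_group])
    fix x y assume x: "x \<in> carrier ?C" and y: "y \<in> carrier ?C"
    show "inv_into (carrier A) \<psi> (?d x) \<in> carrier A" using inv.hom_closed[OF d[OF x]] .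
    have "?d (x \<otimes>\<^bsub>?C\<^esub> y) = ?d x \<otimes>\<^bsub>?D\<^esub> ?d y"
      by (auto simp: power_mult_distrib)
    then show "inv_into (carrier A) \<psi> (?d (x \<otimes>\<^bsub>?C\<^esub> y)) =
        inv_into (carrier A) \<psi> (?d x) \<otimes>\<^bsub>A\<^esub> inv_into (carrier A) \<psi> (?d y)"
      using inv.hom_mult[OF d[OF x] d[OF y]] by metis
  qed
  moreover have "?f (prufer_root p 1) = a"
  proof -
    have "?d (prufer_root p 1) = \<psi> a"
      using \<psi>.hom_closed[OF a(1)] k unfolding carrD
      by (intro extensionalityI[of _ "{..<r}"]) (auto simp: PiE_def)
    moreover have "inj_on \<psi> (carrier A)" using \<psi> by (simp add: iso_def bij_betw_def)
    ultimately show ?thesis using a(1) prufer_root_closed[OF p, of 1] by simp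
  qed
  ultimately show ?thesis by (rule that)
qed

lemma integral_cover_if_divisible_hull:
  fixes H :: "'h monoid" and A :: "'a monoid" and V :: "(int, 'v) module"
  assumes prime: "prime p" and H: "group H" and V: "group_module (prime_field p) H V \<sigma>"
    and hull: "divisible_hull_via p H V \<sigma> A \<phi>"
    and r: "(UNIV :: real set) \<lesssim> (UNIV :: 'r set)" and m: "(UNIV :: real set) \<lesssim> (UNIV :: 'm set)"
  shows "has_integral_cover TYPE('r) TYPE('m) p H V \<sigma>"
proof -
  let ?r = "vectorspace.dim (prime_field p) V"
  let ?C = "prufer_group p"
  let ?D = "sum_group {..<?r} (\<lambda>_. ?C)"
  let ?z = "prufer_root p 1"
  have p: "p > 0" using prime by (simp add: prime_gt_0_nat)
  have z: "?z \<in> carrier ?C" by (rule prufer_root_closed[OF p])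
  interpret V: group_module "prime_field p" H V \<sigma> by fact
  have A: "comm_group A" and "A \<cong> ?D" and \<phi>: "\<phi> \<in> hom H (AutoGroup A)"
    using hull by (simp_all add: divisible_hull_via_def divisible_p_group_of_rank_def)
  then obtain \<psi> where \<psi>: "\<psi> \<in> iso A ?D" by (auto simp: is_iso_def)
  interpret A: comm_group A by fact
  have "bij_betw \<psi> (carrier A) (carrier ?D)" using \<psi> by (simp add: iso_def)
  then have cA: "countable (carrier A)"
    using countable_sum_prufer[OF p, of ?r] by (metis bij_betw_def countable_image_inj_on)
  have cC: "countable (carrier ?C)" by (rule countable_prufer[OF p])
  obtain i :: "(complex \<Rightarrow> complex) \<Rightarrow> 'r" where i: "inj_on i (homs ?C ?C)"
    using homs_embedding[OF cC cC r] .
  obtain j :: "(complex \<Rightarrow> 'a) \<Rightarrow> 'm" where j: "inj_on j (homs ?C A)"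
    using homs_embedding[OF cC cA m] .
  have coded: "coded_homs i j ?C A"
    using comm_group_prufer[OF p] A prufer_end_commute[OF p] i j by (intro coded_homs.intro)
  interpret S: coded_homs i j ?C A by fact
  interpret M: group_module S.R H S.M "\<lambda>h. S.act (\<phi> h)"
    by (rule S.group_module_act[OF H \<phi>])
  have auto: "\<phi> h \<in> hom A A" if "h \<in> carrier H" for h
    using \<phi> that by (auto simp: hom_def AutoGroup_def auto_def)
  obtain F where F: "F \<in> module_hom (prime_field p) (p_torsion p A) V"
    and Fb: "bij_betw F (carrier (p_torsion p A)) (carrier V)"
    and F_equi: "\<And>h a. h \<in> carrier H \<Longrightarrow> a \<in> carrier (p_torsion p A) \<Longrightarrow> F (\<phi> h a) = \<sigma> h (F a)"
    using hull unfolding divisible_hull_via_def group_module_isomorphic_def by blast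
  have tors: "a \<in> carrier (p_torsion p A) \<longleftrightarrow> a \<in> carrier A \<and> a [^]\<^bsub>A\<^esub> p = \<one>\<^bsub>A\<^esub>" for a
    by (simp add: p_torsion_def)
  have F_add: "F (a \<otimes>\<^bsub>A\<^esub> b) = F a \<oplus>\<^bsub>V\<^esub> F b"
    if "a \<in> carrier (p_torsion p A)" "b \<in> carrier (p_torsion p A)" for a b
  proof -
    have "F (a \<oplus>\<^bsub>p_torsion p A\<^esub> b) = F a \<oplus>\<^bsub>V\<^esub> F b"
      using F that unfolding module_hom_def by blast
    then show ?thesis by (simp add: p_torsion_def)
  qed
  have one_tors: "\<one>\<^bsub>A\<^esub> \<in> carrier (p_torsion p A)" by (simp add: tors)
  have F_closed: "F a \<in> carrier V" if "a \<in> carrier (p_torsion p A)" for a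
    using bij_betwE[OF Fb] that by blast
  have "F \<one>\<^bsub>A\<^esub> \<oplus>\<^bsub>V\<^esub> F \<one>\<^bsub>A\<^esub> = F \<one>\<^bsub>A\<^esub>"
    using F_add[OF one_tors one_tors] by simp
  then have F_one: "F \<one>\<^bsub>A\<^esub> = \<zero>\<^bsub>V\<^esub>"
    using V.M.add.l_cancel_one F_closed[OF one_tors] by blast
  have at_root: "S.dec m ?z \<in> carrier (p_torsion p A)" if "m \<in> carrier S.M" for m
    using prufer_hom_root_eq_one[OF p A S.dec_homs[OF that]] S.dec_closed[OF that z] by (simp add: tors)
  \<comment> \<open>Evaluation at \<open>?z\<close> lands in the \<open>p\<close>-torsion by
    \<open>at_root\<close>, and \<open>F\<close> then leads to V. Since \<open>H\<close> acts on M
    by postcomposition, evaluation commutes with the action, and \<open>F\<close> is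
    equivariant.\<close>
  let ?g = "\<lambda>m. F (S.dec m ?z)"
  have "\<exists>f \<in> iso (S.M A_Mod multiples p S.M) (add_monoid V).
    \<forall>h \<in> carrier H. \<forall>C \<in> carrier (S.M A_Mod multiples p S.M). f (S.act (\<phi> h) ` C) = \<sigma> h (f C)"
  proof (rule A_Mod_multiples_isoI[OF M.group_module_axioms V.M.a_group, of ?g])
    show "?g \<in> hom (add_monoid S.M) (add_monoid V)"
    proof (rule homI)
      fix m n assume "m \<in> carrier (add_monoid S.M)" "n \<in> carrier (add_monoid S.M)"
      then have mn: "m \<in> carrier S.M" "n \<in> carrier S.M" by simp_all
      show "?g m \<in> carrier (add_monoid V)" using F_closed[OF at_root[OF mn(1)]] by simp
      show "?g (m \<otimes>\<^bsub>add_monoid S.M\<^esub> n) = ?g m \<otimes>\<^bsub>add_monoid V\<^esub> ?g n"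
        using F_add[OF at_root[OF mn(1)] at_root[OF mn(2)]] S.dec_add[OF mn z] by simp
    qed
    show "?g ` carrier S.M = carrier V"
    proof (intro equalityI subsetI)
      show "v \<in> carrier V" if "v \<in> ?g ` carrier S.M" for v
        using that F_closed[OF at_root] by blast
      fix v assume "v \<in> carrier V"
      then obtain a where a: "a \<in> carrier (p_torsion p A)" "v = F a"
        using bij_betw_imp_surj_on[OF Fb] by blast
      then obtain f where f: "f \<in> homs ?C A" "f ?z = a"
        using prufer_hom_through_torsion[OF p A \<psi>, of a] unfolding tors by metis
      then have "v = ?g (j f)" using S.dec_enc[OF f(1)] a(2) by simp
      then show "v \<in> ?g ` carrier S.M" using S.enc_closed[OF f(1)] by blast
    qed
  next
    fix m assume m: "m \<in> carrier S.M"
    have "?g m = \<zero>\<^bsub>V\<^esub> \<longleftrightarrow> S.dec m ?z = \<one>\<^bsub>A\<^esub>"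
      using inj_on_eq_iff[OF bij_betw_imp_inj_on[OF Fb] at_root[OF m] one_tors] F_one by simp
    also have "\<dots> \<longleftrightarrow> m \<in> multiples p S.M"
    proof
      assume "S.dec m ?z = \<one>\<^bsub>A\<^esub>"
      then obtain f where f: "f \<in> homs ?C A" "\<And>x. x \<in> carrier ?C \<Longrightarrow> S.dec m x = f x [^]\<^bsub>A\<^esub> p"
        using prufer_hom_divisible[OF p A S.dec_homs[OF m]] by metis
      have jf: "j f \<in> carrier S.M" by (rule S.enc_closed[OF f(1)])
      have "m = [p] \<cdot>\<^bsub>S.M\<^esub> j f"
        using m jf f by (intro S.M_eqI M.M.add.nat_pow_closed) (simp_all add: S.dec_nat S.dec_enc)
      then show "m \<in> multiples p S.M" using jf by (auto simp: multiples_def)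
    next
      assume "m \<in> multiples p S.M"
      then obtain n where n: "n \<in> carrier S.M" "m = [p] \<cdot>\<^bsub>S.M\<^esub> n" by (auto simp: multiples_def)
      then show "S.dec m ?z = \<one>\<^bsub>A\<^esub>"
        using prufer_hom_root_eq_one[OF p A S.dec_homs[OF n(1)]] S.dec_nat[OF n(1) z, of p] by simp
    qed
    finally show "?g m = \<zero>\<^bsub>V\<^esub> \<longleftrightarrow> m \<in> multiples p S.M" .
  next
    fix h m assume h: "h \<in> carrier H" and m: "m \<in> carrier S.M"
    then show "?g (S.act (\<phi> h) m) = \<sigma> h (?g m)"
      using S.dec_act[OF auto[OF h] m z] F_equi[OF h at_root[OF m]] by simp
  qed
  moreover have "cover_coefficient_ring p S.R"
    using i by (intro cover_coefficient_ring_image[OF prime cover_coefficient_ring_end_prufer[OF prime]])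
      (simp only: end_ring_simps(1))
  ultimately have "integral_cover p H V \<sigma> S.R S.M (\<lambda>h. S.act (\<phi> h))"
    unfolding integral_cover_def
    by (intro conjI M.group_module_axioms free_module_of_rank_coded_homs[OF prime coded \<psi>])
  then show ?thesis unfolding has_integral_cover_def by blast
qed

text \<open>Through the bijection \<open>F\<close>, \<open>\<phi> g\<close> determines
  \<open>\<sigma> g\<close> on the carrier of V, and extensionality makes this an equality of
  functions. So \<open>\<phi>\<close> cannot identify elements that \<open>\<sigma>\<close>
  separates.\<close>

lemma divisible_hull_faithful:
  assumes V: "group_module (prime_field p) H V \<sigma>" and hull: "divisible_hull_via p H V \<sigma> A \<phi>"
    and inj: "inj_on \<sigma> (carrier H)"
  shows "inj_on \<phi> (carrier H)"
proof (rule inj_onI)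
  interpret V: group_module "prime_field p" H V \<sigma> by fact
  obtain F where Fb: "bij_betw F (carrier (p_torsion p A)) (carrier V)"
    and F_equi: "\<And>h a. h \<in> carrier H \<Longrightarrow> a \<in> carrier (p_torsion p A) \<Longrightarrow> F (\<phi> h a) = \<sigma> h (F a)"
    using hull unfolding divisible_hull_via_def group_module_isomorphic_def by blast
  fix g h assume g: "g \<in> carrier H" and h: "h \<in> carrier H" and eq: "\<phi> g = \<phi> h"
  have "\<sigma> g v = \<sigma> h v" if "v \<in> carrier V" for v
  proof -
    have "v \<in> F ` carrier (p_torsion p A)"
      using bij_betw_imp_surj_on[OF Fb] that by simp
    then obtain a where a: "a \<in> carrier (p_torsion p A)" "v = F a"
      by (rule imageE)
    show ?thesis
      using F_equi[OF g a(1)] F_equi[OF h a(1)] eq a(2) by simp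
  qed
  moreover have "\<sigma> g \<in> extensional (carrier V)" "\<sigma> h \<in> extensional (carrier V)"
    using V.bij_prop0 g h by (simp_all add: Bij_def)
  ultimately have "\<sigma> g = \<sigma> h" by (intro extensionalityI)
  then show "g = h" using inj g h by (simp add: inj_on_def)
qed

theorem theorem4p8:
  fixes p :: nat
    and H :: "'h monoid"
    and V :: "(int, 'v) module"
    and \<sigma> :: "'h \<Rightarrow> 'v \<Rightarrow> 'v"
  assumes "prime p"
    and "group H" and "finite (carrier H)"
    and "group_module (prime_field p) H V \<sigma>"
    and "vectorspace.fin_dim (prime_field p) V"
    and "infinite (UNIV :: 'a set)"
    and "(UNIV :: real set) \<lesssim> (UNIV :: 'r set)"
    and "(UNIV :: real set) \<lesssim> (UNIV :: 'm set)"
  shows "(has_divisible_hull_action TYPE('a) p H V \<sigma> \<longleftrightarrow>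
            has_integral_cover TYPE('r) TYPE('m) p H V \<sigma>) \<and>
         (inj_on \<sigma> (carrier H) \<longrightarrow>
           (has_divisible_hull TYPE('a) p H V \<sigma> \<longleftrightarrow>
            has_integral_cover TYPE('r) TYPE('m) p H V \<sigma>))"
proof -
  have action: "has_divisible_hull_action TYPE('a) p H V \<sigma> \<longleftrightarrow>
      has_integral_cover TYPE('r) TYPE('m) p H V \<sigma>"
  proof
    assume "has_divisible_hull_action TYPE('a) p H V \<sigma>"
    then obtain A :: "'a monoid" and \<phi> where "divisible_hull_via p H V \<sigma> A \<phi>"
      unfolding has_divisible_hull_action_def by blast
    then show "has_integral_cover TYPE('r) TYPE('m) p H V \<sigma>"
      by (rule integral_cover_if_divisible_hull[OF assms(1,2,4) _ assms(7,8)])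
  next
    assume "has_integral_cover TYPE('r) TYPE('m) p H V \<sigma>"
    then obtain R :: "'r ring" and M :: "('r, 'm) module" and \<rho> where "integral_cover p H V \<sigma> R M \<rho>"
      unfolding has_integral_cover_def by blast
    then show "has_divisible_hull_action TYPE('a) p H V \<sigma>"
      by (rule divisible_hull_if_integral_cover[OF assms(1,4) _ assms(6)])
  qed
  moreover have "has_divisible_hull TYPE('a) p H V \<sigma> \<longleftrightarrow> has_divisible_hull_action TYPE('a) p H V \<sigma>"
    if "inj_on \<sigma> (carrier H)"
    using divisible_hull_faithful[OF assms(4) _ that]
    unfolding has_divisible_hull_def has_divisible_hull_action_def by blast
  ultimately show ?thesis by blast
qed

end
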